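(* Let $n\ge 3$ and $p$ be integers, where $p=p_n$ may depend on (and grow with) $n$, such that $n\ge p+2$. Let $y_1,\dots,y_n$ be independent random vectors with distribution $N_p(\mu,\Lambda^{-1})$, where $\mu\in\mathbb{R}^p$ and the symmetric positive definite concentration matrix $\Lambda$ are unknown. Consider the conditional independence hypothesis $$H_\psi:\ \Lambda=\Lambda_0,$$ where $\Lambda_0$ is an unknown (symmetric positive definite) matrix constrained only to have a specified nonempty set of off-diagonal elements equal to zero. Under $H_\psi$ (i.e. for every $\mu$ and every positive definite $\Lambda$ with the specified zeros), the directional $p$-value $p(\psi)$ for $H_\psi$ (defined in the context) is exactly uniformly distributed on $(0,1)$.
   Context: Notation. $y=[y_1\cdots y_n]^T$ is the $n\times p$ data matrix, $\bar y=y^T1_n/n$ with $1_n$ the vector of ones. The unconstrained maximum likelihood estimates are $\hat\mu=\bar y$ and $\hat\Lambda^{-1}=y^Ty/n-\bar y\bar y^T$; under $H_\psi$ the constrained estimate of $\mu$ is again $\bar y$, and $\hat\Lambda_0^{-1}$ denotes the constrained maximum likelihood estimate of $\Lambda^{-1}$ (its inverse $\hat\Lambda_0$ has the specified zeros). $d$ is the difference between the numbers of free parameters without and with the constraint $H_\psi$, i.e. the number of pairs $i<j$ for which the $(i,j)$ entry of $\Lambda$ is set to zero. Directional $p$-value (general definition in a linear exponential family). Let $\varphi$ be the canonical parameter, $u$ the canonical sufficient statistic, $u^0$ its observed value, $s=u-u^0$, and $\ell(\varphi;s)=\varphi^Ts+\ell^0(\varphi)$, where $\ell^0(\varphi)$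 is the observed log-likelihood. Let $\hat\varphi^0_\psi$ be the constrained maximum likelihood estimate under $H_\psi$ from the observed data, $s_\psi=-\partial\ell^0(\varphi)/\partial\varphi|_{\varphi=\hat\varphi^0_\psi}$, and $s(t)=(1-t)s_\psi$, $t\in\mathbb{R}$ (so $s(1)=0$ is the observed value and $s(0)=s_\psi$). Let $\hat\varphi(s)$ be the maximizer of $\ell(\varphi;s)$, let $J_{\varphi\varphi}(\varphi;s)=-\partial^2\ell(\varphi;s)/\partial\varphi\,\partial\varphi^T$, and let the saddlepoint approximation be $$h(s;\psi)=c\,\exp\left[\ell(\hat\varphi^0_\psi;s)-\ell\{\hat\varphi(s);s\}\right]\,|J_{\varphi\varphi}\{\hat\varphi(s);s\}|^{-1/2},$$ with $c$ a constant. Then $$p(\psi)=\frac{\int_1^{t_{sup}}t^{d-1}h\{s(t);\psi\}\,dt}{\int_0^{t_{sup}}t^{d-1}h\{s(t);\psi\}\,dt},$$ where $t_{sup}$ is the largest value (supremum) of $t$ for which the maximum likelihood estimate $\hat\varphi\{s(t)\}$ exists. In the present model, $\varphi$ has components $\xi=\Lambda\mu$ and the distinct entries of $\Lambda$, and $$\ell\{\varphi;s(t)\}=n\xi^T\bar y-\frac n2\mathrm{tr}\left[\Lambda\left\{\frac{y^Ty}{n}+(1-t)(\hat\Lambda_0^{-1}-\hat\Lambda^{-1})\right\}\right]+\frac n2\log|\Lambda|-\frac n2\xi^T\Lambda^{-1}\xi .$$ Its maximizer corresponds to $\hat\mu(t)=\bar y$ and $\hat\Lambda(t)^{-1}=(1-t)\hat\Lambda_0^{-1}+t\hat\Lambda^{-1}$,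 and explicitly $$h\{s(t);\psi\}=c\,\exp\left\{\frac{n-p-2}{2}\log|\hat\Lambda(t)^{-1}|\right\},$$ with $c$ not depending on $t$ (it cancels in $p(\psi)$); $t_{sup}$ is the largest $t$ for which $\hat\Lambda(t)^{-1}$ is positive definite. *)

theory Defs
  imports "HOL-Probability.Probability" "HOL-Library.Uprod"
begin

subsection \<open>Directional p-value in a linear exponential family\<close>

definition gradient :: "(real^'k \<Rightarrow> real) \<Rightarrow> real^'k \<Rightarrow> real^'k::finite" where
  "gradient f x = (\<chi> i. frechet_derivative f (at x) (axis i 1))"

definition tilted_loglik :: "(real^'k \<Rightarrow> real) \<Rightarrow> real^'k \<Rightarrow> real^'k \<Rightarrow> real" where
  "tilted_loglik l0 s \<phi> = \<phi> \<bullet> s + l0 \<phi>"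

definition mle_exists :: "'b set \<Rightarrow> ('b \<Rightarrow> real) \<Rightarrow> bool" where
  "mle_exists \<Omega> l \<longleftrightarrow> (\<exists>\<phi>. is_arg_max l (\<lambda>x. x \<in> \<Omega>) \<phi>)"

abbreviation mle :: "'b set \<Rightarrow> ('b \<Rightarrow> real) \<Rightarrow> 'b" where
  "mle \<Omega> l \<equiv> arg_max_on l \<Omega>"

definition information :: "(real^'k \<Rightarrow> real) \<Rightarrow> real^'k \<Rightarrow> real^'k^'k::finite" where
  "information l \<phi> = - jacobian (gradient l) (at \<phi>)"

definition saddlepoint ::
  "real \<Rightarrow> (real^'k) set \<Rightarrow> (real^'k) set \<Rightarrow> (real^'k \<Rightarrow> real) \<Rightarrow> real^'k \<Rightarrow> real" where
  "saddlepoint c \<Omega> \<Omega>0 l0 s =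
    (let l = tilted_loglik l0 s; \<phi>0 = mle \<Omega>0 l0; \<phi>s = mle \<Omega> l
     in c * exp (l \<phi>0 - l \<phi>s) * det (information l \<phi>s) powr (- 1/2))"

definition directional_path :: "(real^'k) set \<Rightarrow> (real^'k \<Rightarrow> real) \<Rightarrow> real \<Rightarrow> real^'k" where
  "directional_path \<Omega>0 l0 t = (1 - t) *\<^sub>R (- gradient l0 (mle \<Omega>0 l0))"

definition t_sup :: "(real^'k) set \<Rightarrow> (real^'k) set \<Rightarrow> (real^'k \<Rightarrow> real) \<Rightarrow> ereal" where
  "t_sup \<Omega> \<Omega>0 l0 =
    (SUP t\<in>{t. mle_exists \<Omega> (tilted_loglik l0 (directional_path \<Omega>0 l0 t))}. ereal t)"

(* The p-value is only defined when the observed data admit both the constrained and the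
   unconstrained maximum likelihood estimate. Elsewhere it is set to 0, a value outside (0,1),
   so that uniformity on (0,1) includes the almost sure existence of the two estimates. *)
definition directional_pvalue ::
  "real \<Rightarrow> (real^'k) set \<Rightarrow> (real^'k) set \<Rightarrow> nat \<Rightarrow> (real^'k \<Rightarrow> real) \<Rightarrow> real" where
  "directional_pvalue c \<Omega> \<Omega>0 d l0 =
    (if mle_exists \<Omega>0 l0 \<and> mle_exists \<Omega> l0 then
       (LBINT t=1..t_sup \<Omega> \<Omega>0 l0. t ^ (d - 1) * saddlepoint c \<Omega> \<Omega>0 l0 (directional_path \<Omega>0 l0 t)) /
       (LBINT t=0..t_sup \<Omega> \<Omega>0 l0. t ^ (d - 1) * saddlepoint c \<Omega> \<Omega>0 l0 (directional_path \<Omega>0 l0 t))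
     else 0)"

subsection \<open>Multivariate normal model in canonical parameters\<close>

definition posdef :: "real^'p^'p \<Rightarrow> bool" where
  "posdef A \<longleftrightarrow> transpose A = A \<and> (\<forall>x. x \<noteq> 0 \<longrightarrow> 0 < x \<bullet> (A *v x))"

definition mvnormal_density :: "real^'p \<Rightarrow> real^'p^'p \<Rightarrow> real^'p \<Rightarrow> real" where
  "mvnormal_density \<mu> \<Sigma> x =
    exp (- ((x - \<mu>) \<bullet> (matrix_inv \<Sigma> *v (x - \<mu>))) / 2) / sqrt ((2 * pi) ^ CARD('p) * det \<Sigma>)"

instance uprod :: (finite) finite
  by standard simp

(* A canonical parameter has one coordinate Inl i for each entry of xi = Lambda mu and one
   coordinate Inr (Upair i j) for each distinct entry of the symmetric matrix Lambda, indexed by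
   unordered pairs (with i = j allowed). *)
type_synonym 'p canonical = "real^('p + 'p uprod)"

definition xi_of :: "('p::finite) canonical \<Rightarrow> real^'p" where
  "xi_of \<phi> = (\<chi> i. \<phi> $ Inl i)"

definition Lambda_of :: "('p::finite) canonical \<Rightarrow> real^'p^'p" where
  "Lambda_of \<phi> = (\<chi> i j. \<phi> $ Inr (Upair i j))"

definition has_zeros :: "'p uprod set \<Rightarrow> real^'p^'p \<Rightarrow> bool" where
  "has_zeros E \<Lambda> \<longleftrightarrow> (\<forall>i j. Upair i j \<in> E \<longrightarrow> \<Lambda> $ i $ j = 0)"

definition full_params :: "('p::finite) canonical set" where
  "full_params = {\<phi>. posdef (Lambda_of \<phi>)}"

definition null_params :: "('p::finite) uprod set \<Rightarrow> 'p canonical set" where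
  "null_params E = {\<phi> \<in> full_params. has_zeros E (Lambda_of \<phi>)}"

definition normal_loglik :: "nat \<Rightarrow> (nat \<Rightarrow> real^'p) \<Rightarrow> ('p::finite) canonical \<Rightarrow> real" where
  "normal_loglik n y \<phi> =
    (\<Sum>i=1..n. ln (mvnormal_density (matrix_inv (Lambda_of \<phi>) *v xi_of \<phi>)
                                      (matrix_inv (Lambda_of \<phi>)) (y i)))"

(* Each unordered pair in E removes one free parameter, hence d = card E. *)
definition zeros_pvalue ::
  "real \<Rightarrow> nat \<Rightarrow> ('p::finite) uprod set \<Rightarrow> (nat \<Rightarrow> real^'p) \<Rightarrow> real" where
  "zeros_pvalue c n E y =
    directional_pvalue c full_params (null_params E) (card E) (normal_loglik n y)"

end

theory Submission
  imports Defs
begin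

text \<open>Up to a constant the sample covariance \<open>S\<close> has the Wishart density
  \<open>det S powr ((n - p - 2) / 2) * exp (- n / 2 * trace (\<Lambda> ** S))\<close> with respect to Lebesgue measure on
  symmetric matrices. Since \<open>\<Lambda>\<close> vanishes on \<open>E\<close>, the exponential factor does not involve the
  entries of \<open>S\<close> in \<open>E\<close>, and the constrained estimate, the positive definite completion of the
  remaining entries, is a function of those entries alone. Hence, conditionally on the entries
  outside \<open>E\<close> and on the direction from the constrained to the unconstrained estimate, the distance
  between the two has density proportional to \<open>t ^ (d - 1) * det S(t) powr ((n - p - 2) / 2)\<close>. This is
  also the integrand of the directional p-value: the likelihood ratio contributes the power
  \<open>n / 2\<close> of the determinant, the information determinant \<open>det S(t) ^ (p + 2)\<close> the remaining
  \<open>- (p + 2) / 2\<close>. So the p-value is the upper tail probability of a continuous distribution at a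
  point drawn from it.\<close>

subsection \<open>The spectral theorem and positive definite matrices\<close>

text \<open>The exponents are Jacobians of linear actions. On symmetric matrices
  \<open>X \<mapsto> g X g^T\<close> scales volume by \<open>|det g| ^ (p + 1)\<close>, because for
  diagonal \<open>g\<close> the factor \<open>g_i g_j\<close> occurs once per unordered pair. On the
  sample \<open>g\<close> scales volume by \<open>|det g| ^ n\<close>, and one of these factors
  belongs to the mean. Hence \<open>(n - 1) / 2 - (p + 1) / 2 = (n - p - 2) / 2\<close> in the
  Wishart density; in the information the component \<open>xi\<close> adds one factor, giving
  \<open>p + 2\<close>. The Wishart density comes from uniqueness, up to a constant, of invariant
  measures on the cone. No normalizing constant is evaluated: the p-value is a ratio, and it
  suffices to know which constants are neither zero nor infinite. Derivatives of log-determinants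
  and likelihoods are read off from one inequality, that \<open>ln (det B) - trace B\<close> is
  largest at the identity. The completion has no closed form; its measurability comes from
  invariance of domain. The bound \<open>n \<ge> p + 2\<close> makes the exponent nonnegative, so
  the integrals over rays converge at the boundary of the cone.\<close>

lemma selfadjoint_maximizer_eigenvector:
  fixes f :: "'a::euclidean_space \<Rightarrow> 'a"
  assumes f: "linear f" and sa: "\<And>x y. f x \<bullet> y = x \<bullet> f y"
    and S: "subspace S" "f ` S \<subseteq> S" and v: "v \<in> S" "norm v = 1"
    and max: "\<And>x. x \<in> S \<Longrightarrow> norm x = 1 \<Longrightarrow> x \<bullet> f x \<le> v \<bullet> f v"
  shows "f v = (v \<bullet> f v) *\<^sub>R v"
proof -
  define c where "c = v \<bullet> f v"
  define w where "w = f v - c *\<^sub>R v"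
  have vv: "v \<bullet> v = 1" using v by (simp add: dot_square_norm)
  have wS: "w \<in> S" unfolding w_def using S v by (auto intro: subspace_diff subspace_scale)
  have wv: "w \<bullet> v = 0" unfolding w_def c_def by (simp add: inner_diff_left vv inner_commute[of "f v" v])
  have wfv: "w \<bullet> f v = w \<bullet> w" 
  proof -
    have "f v = w + c *\<^sub>R v" by (simp add: w_def)
    then show ?thesis by (simp add: inner_add_right wv)
  qed
  \<comment> \<open>Homogeneity extends the bound from the unit sphere to all of
    \<open>S\<close>.\<close>
  have le: "x \<bullet> f x \<le> c * (x \<bullet> x)" if "x \<in> S" for x
  proof (cases "x = 0")
    case True then show ?thesis by (simp)
  next
    case False
    let ?u = "(1 / norm x) *\<^sub>R x"
    have "?u \<in> S" "norm ?u = 1" using that S False by (auto intro: subspace_scale)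
    then have "?u \<bullet> f ?u \<le> c" using max c_def by blast
    moreover have "?u \<bullet> f ?u = (x \<bullet> f x) / (x \<bullet> x)"
      using False by (simp add: linear_scale[OF f] dot_square_norm power2_eq_square)
    ultimately have "(x \<bullet> f x) / (x \<bullet> x) \<le> c" by (simp only:)
    then show ?thesis using False by (simp add: divide_le_eq)
  qed
  \<comment> \<open>Expansion of \<open>le\<close> at \<open>v + s *\<^sub>R w\<close>. The terms of
    order zero cancel, and the linear coefficient is \<open>2 * (w \<bullet> w)\<close>; a quadratic
    in \<open>s\<close> that vanishes at 0 and is never positive has no linear part.\<close>
  have "2 * s * (w \<bullet> w) + s^2 * (w \<bullet> f w - c * (w \<bullet> w)) \<le> 0" for s
  proof -
    have "(v + s *\<^sub>R w) \<in> S" using v wS S by (auto intro: subspace_add subspace_scale)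
    from le[OF this] show ?thesis
      using wv wfv sa[of w v] sa[of v w] vv
      by (simp add: linear_add[OF f] linear_scale[OF f] inner_add_left inner_add_right inner_commute
          c_def[symmetric] power2_eq_square algebra_simps)
  qed
  note q = this
  have "w \<bullet> w = 0"
  proof (rule ccontr)
    assume "w \<bullet> w \<noteq> 0"
    then have pos: "w \<bullet> w > 0" by simp
    \<comment> \<open>\<open>r\<close> dominates the quadratic coefficient, and for
      \<open>s = (w \<bullet> w) / r\<close> the linear term is twice as large as the bound
      \<open>s^2 * r\<close> on the quadratic one.\<close>
    define r where "r = \<bar>w \<bullet> f w - c * (w \<bullet> w)\<bar> + 1"
    define s where "s = (w \<bullet> w) / r"
    have r: "r > 0" by (simp add: r_def add_nonneg_pos)
    have s: "s > 0" using pos r by (simp add: s_def)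
    have "- r \<le> w \<bullet> f w - c * (w \<bullet> w)" unfolding r_def by linarith
    then have "s^2 * (- r) \<le> s^2 * (w \<bullet> f w - c * (w \<bullet> w))" by (intro mult_left_mono) auto
    moreover have "s^2 * r = s * (w \<bullet> w)" using r by (simp add: s_def power2_eq_square)
    ultimately have "s * (w \<bullet> w) \<le> 0" using q[of s] by (simp add: algebra_simps)
    then show False using s pos by (simp add: mult_le_0_iff)
  qed
  then show ?thesis by (simp add: w_def c_def)
qed

text \<open>Induction on the dimension: the quadratic form attains its maximum on the compact unit
  sphere of \<open>S\<close> at an eigenvector \<open>v\<close>, and self-adjointness makes the
  orthogonal complement of \<open>v\<close> in \<open>S\<close> invariant again.\<close>

lemma selfadjoint_orthonormal_eigenbasis:
  fixes f :: "'a::euclidean_space \<Rightarrow> 'a"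
  assumes f: "linear f" and sa: "\<And>x y. f x \<bullet> y = x \<bullet> f y"
    and "subspace S" "f ` S \<subseteq> S"
  shows "\<exists>B. B \<subseteq> S \<and> pairwise orthogonal B \<and> (\<forall>b\<in>B. norm b = 1 \<and> (\<exists>c. f b = c *\<^sub>R b)) \<and> S \<subseteq> span B"
  using assms(3,4)
proof (induction "dim S" arbitrary: S rule: less_induct)
  case less
  show ?case
  proof (cases "S \<subseteq> {0}")
    case True
    then show ?thesis by (intro exI[of _ "{}"]) auto
  next
    case False
    then obtain z where z: "z \<in> S" "z \<noteq> 0" by blast
    have cont: "continuous_on A (\<lambda>x. x \<bullet> f x)" for A
      by (intro continuous_intros linear_continuous_on f[unfolded linear_conv_bounded_linear])
    have "compact (S \<inter> sphere 0 1)"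
      using closed_subspace[OF less.prems(1)] by (intro closed_Int_compact) auto
    moreover have "S \<inter> sphere 0 1 \<noteq> {}"
    proof -
      have "(1 / norm z) *\<^sub>R z \<in> S \<inter> sphere 0 1"
        using z less.prems(1) by (auto intro: subspace_scale)
      then show ?thesis by blast
    qed
    ultimately obtain v where v: "v \<in> S \<inter> sphere 0 1"
      and vmax: "\<And>x. x \<in> S \<inter> sphere 0 1 \<Longrightarrow> x \<bullet> f x \<le> v \<bullet> f v"
      using continuous_attains_sup[OF _ _ cont] by metis
    have vS: "v \<in> S" and nv: "norm v = 1" using v by auto
    have ev: "f v = (v \<bullet> f v) *\<^sub>R v"
      using vmax by (intro selfadjoint_maximizer_eigenvector[OF f sa less.prems vS nv]) auto
    define S' where "S' = {x \<in> S. x \<bullet> v = 0}"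
    have sub: "subspace S'" unfolding S'_def using less.prems(1)
      by (auto simp: subspace_def inner_add_left)
    have inv: "f ` S' \<subseteq> S'"
    proof -
      have "f x \<bullet> v = 0" if "x \<bullet> v = 0" for x
        using that by (subst sa, subst ev) simp
      then show ?thesis using less.prems(2) unfolding S'_def by auto
    qed
    have "v \<notin> S'" using nv by (simp add: S'_def dot_square_norm)
    then have "S' \<subset> S" using vS unfolding S'_def by blast
    moreover have "span S' = S'" "span S = S" using sub less.prems(1) span_eq_iff by blast+
    ultimately have "dim S' < dim S" by (metis dim_psubset)
    from less.hyps[OF this sub inv] obtain B where B: "B \<subseteq> S'" "pairwise orthogonal B"
      "\<forall>b\<in>B. norm b = 1 \<and> (\<exists>c. f b = c *\<^sub>R b)" "S' \<subseteq> span B" by blast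
    have "S \<subseteq> span (insert v B)"
    proof
      fix x assume x: "x \<in> S"
      have "x - (x \<bullet> v) *\<^sub>R v \<in> S'" unfolding S'_def using x vS less.prems(1) nv
        by (auto simp: inner_diff_left dot_square_norm intro: subspace_diff subspace_scale)
      then have "x - (x \<bullet> v) *\<^sub>R v \<in> span B" using B by blast
      then show "x \<in> span (insert v B)" by (auto simp: span_insert)
    qed
    moreover have "pairwise orthogonal (insert v B)"
      using B(1,2) by (auto simp: pairwise_insert S'_def orthogonal_def inner_commute)
    ultimately show ?thesis using B ev nv vS unfolding S'_def
      by (intro exI[of _ "insert v B"]) auto
  qed
qed

section \<open>Diagonal matrices and orthogonal diagonalization\<close>

definition diag_mat :: "real^'n \<Rightarrow> real^'n^'n" where
  "diag_mat d = (\<chi> i j. if i = j then d $ i else 0)"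

lemma diag_mat_nth [simp]: "diag_mat d $ i $ j = (if i = j then d $ i else 0)"
  by (simp add: diag_mat_def)

lemma det_diag_mat: "det (diag_mat d) = (\<Prod>i\<in>UNIV. d $ i)"
  by (subst det_diagonal) auto

lemma transpose_diag_mat [simp]: "transpose (diag_mat d) = diag_mat d"
  by (simp add: transpose_def vec_eq_iff)

lemma diag_mat_mult: "diag_mat c ** diag_mat d = diag_mat (\<chi> i. c $ i * d $ i)"
proof -
  have "(\<Sum>k\<in>UNIV. (if i = k then c $ i else 0) * (if k = j then d $ k else 0)) =
      (if i = j then c $ i * d $ i else 0)" for i j
  proof -
    have "(\<Sum>k\<in>UNIV. (if i = k then c $ i else 0) * (if k = j then d $ k else 0)) =
        (\<Sum>k\<in>UNIV. if k = i then c $ i * (if i = j then d $ i else 0) else 0)"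
      by (intro sum.cong) auto
    then show ?thesis by simp
  qed
  then show ?thesis by (simp add: matrix_matrix_mult_def vec_eq_iff)
qed

lemma diag_mat_vec: "diag_mat d *v x = (\<chi> i. d $ i * x $ i)"
proof -
  have "(\<Sum>j\<in>UNIV. (if i = j then d $ i else 0) * x $ j) = d $ i * x $ i" for i
  proof -
    have "(\<Sum>j\<in>UNIV. (if i = j then d $ i else 0) * x $ j) =
        (\<Sum>j\<in>UNIV. if j = i then d $ i * x $ i else 0)"
      by (intro sum.cong) auto
    then show ?thesis by simp
  qed
  then show ?thesis by (simp add: matrix_vector_mult_def vec_eq_iff)
qed

lemma inner_matrix_vector: "x \<bullet> (A *v y) = (transpose A *v x) \<bullet> (y :: real^'n)"
  for A :: "real^'n^'m"
  by (simp add: transpose_matrix_vector dot_lmul_matrix)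

theorem symmetric_spectral:
  fixes A :: "real^'n^'n"
  assumes A: "transpose A = A"
  shows "\<exists>Q d. orthogonal_matrix Q \<and> A = Q ** diag_mat d ** transpose Q"
proof -
  let ?f = "\<lambda>x. A *v x"
  have lin: "linear ?f" by (rule matrix_vector_mul_linear)
  have sa: "?f x \<bullet> y = x \<bullet> ?f y" for x y
    by (simp add: inner_matrix_vector A)
  from selfadjoint_orthonormal_eigenbasis[OF lin sa, of UNIV]
  obtain B where B: "pairwise orthogonal B" "\<forall>b\<in>B. norm b = 1 \<and> (\<exists>c. A *v b = c *\<^sub>R b)"
    "UNIV \<subseteq> span B" by (auto simp: subspace_UNIV)
  have "0 \<notin> B" using B(2) by auto
  then have ind: "independent B" using B(1) pairwise_orthogonal_independent by blast
  then have "card B = CARD('n)"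
    using B(3) dim_unique[of B UNIV "CARD('n)"] dim_UNIV basis_card_eq_dim[of B UNIV]
    by (auto simp: )
  moreover have "finite B" using ind independent_imp_finite by blast
  ultimately obtain b :: "'n \<Rightarrow> real^'n" where b: "bij_betw b UNIV B"
    using finite_same_card_bij[of "UNIV::'n set" B] by auto
  obtain c where c: "\<And>i. A *v b i = c i *\<^sub>R b i"
  proof -
    have "\<forall>i. \<exists>c. A *v b i = c *\<^sub>R b i" using B(2) bij_betwE[OF b] by blast
    then show ?thesis using that by metis
  qed
  define Q :: "real^'n^'n" where "Q = (\<chi> i j. b j $ i)"
  have bb: "b i \<bullet> b j = (if i = j then 1 else 0)" for i j
  proof (cases "i = j")
    case True
    have "b j \<in> B" using b by (auto simp: bij_betw_def)
    then show ?thesis using True B(2) by (simp add: dot_square_norm)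
  next
    case False
    have "b i \<in> B" "b j \<in> B" using b by (auto simp: bij_betw_def)
    moreover have "b i \<noteq> b j" using False b by (auto simp: bij_betw_def inj_on_def)
    ultimately show ?thesis using B(1) False by (auto simp: pairwise_def orthogonal_def)
  qed
  have QtQ: "transpose Q ** Q = mat 1"
    using bb by (simp add: Q_def matrix_matrix_mult_def transpose_def mat_def vec_eq_iff inner_vec_def)
  then have orth: "orthogonal_matrix Q" by (simp add: orthogonal_matrix)
  have "(A ** Q) $ i $ j = (Q ** diag_mat (\<chi> i. c i)) $ i $ j" for i j
  proof -
    have "(A ** Q) $ i $ j = (A *v b j) $ i"
      by (simp add: Q_def matrix_matrix_mult_def matrix_vector_mult_def)
    also have "\<dots> = b j $ i * c j" by (simp add: c)
    also have "\<dots> = (\<Sum>k\<in>UNIV. if k = j then b j $ i * c j else 0)" by simp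
    also have "\<dots> = (\<Sum>k\<in>UNIV. b k $ i * (if k = j then c k else 0))"
      by (intro sum.cong) auto
    also have "\<dots> = (Q ** diag_mat (\<chi> i. c i)) $ i $ j"
      by (simp add: matrix_matrix_mult_def Q_def cong: if_cong)
    finally show ?thesis .
  qed
  then have AQ: "A ** Q = Q ** diag_mat (\<chi> i. c i)" by (simp add: vec_eq_iff)
  have "A = A ** (Q ** transpose Q)" using orth by (simp add: orthogonal_matrix_def)
  also have "\<dots> = Q ** diag_mat (\<chi> i. c i) ** transpose Q" by (simp add: matrix_mul_assoc AQ)
  finally show ?thesis using orth by blast
qed

lemma orthogonal_matrix_cancel:
  fixes Q :: "real^'n^'n"
  assumes "orthogonal_matrix Q"
  shows "transpose Q ** Q = mat 1" "Q ** transpose Q = mat 1"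
    "transpose Q ** (Q ** X) = X" "Q ** (transpose Q ** X) = X"
  using assms by (simp_all add: orthogonal_matrix_def matrix_mul_assoc)

lemma det_orthogonal_conj:
  fixes Q :: "real^'n^'n"
  assumes "orthogonal_matrix Q"
  shows "det (Q ** X ** transpose Q) = det X"
proof -
  have "det Q * det (transpose Q) = 1" 
    using orthogonal_matrix_cancel(2)[OF assms] by (metis det_I det_mul)
  then show ?thesis by (simp add: det_mul algebra_simps)
qed

lemma trace_orthogonal_conj:
  fixes Q :: "real^'n^'n"
  assumes "orthogonal_matrix Q"
  shows "trace (Q ** X ** transpose Q) = trace X"
  by (subst trace_mul_sym) (simp add: matrix_mul_assoc orthogonal_matrix_cancel[OF assms])

section \<open>Congruences, square roots and inverses of positive definite matrices\<close>

lemma posdef_congruence: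
  fixes A g :: "real^'n^'n"
  assumes A: "posdef A" and g: "invertible g"
  shows "posdef (g ** A ** transpose g)"
  unfolding posdef_def
proof (intro conjI allI impI)
  show "transpose (g ** A ** transpose g) = g ** A ** transpose g"
    using A by (simp add: posdef_def matrix_transpose_mul matrix_mul_assoc)
  fix x :: "real^'n" assume "x \<noteq> 0"
  then have "transpose g *v x \<noteq> 0"
    using g by (metis invertible_left_inverse transpose_invertible matrix_left_invertible_ker)
  then have "0 < (transpose g *v x) \<bullet> (A *v (transpose g *v x))" using A by (simp add: posdef_def)
  then show "0 < x \<bullet> (g ** A ** transpose g *v x)"
    by (simp add: inner_matrix_vector[of x g] matrix_vector_mul_assoc[symmetric])
qed

lemma invertible_orthogonal: "orthogonal_matrix (Q::real^'n^'n) \<Longrightarrow> invertible Q"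
  unfolding invertible_def orthogonal_matrix_def by blast

lemma orthogonal_transpose: "orthogonal_matrix (Q::real^'n^'n) \<Longrightarrow> orthogonal_matrix (transpose Q)"
  by (simp add: orthogonal_matrix_def)

lemma posdef_diag_mat: "posdef (diag_mat d) \<longleftrightarrow> (\<forall>i. d $ i > 0)"
proof
  assume p: "posdef (diag_mat d)"
  show "\<forall>i. d $ i > 0"
  proof
    fix i
    have "axis i 1 \<bullet> (diag_mat d *v axis i 1) > 0"
      using p by (auto simp: posdef_def axis_eq_0_iff)
    then show "d $ i > 0" by (simp add: diag_mat_vec inner_axis')
  qed
next
  assume d: "\<forall>i. d $ i > 0"
  have "0 < x \<bullet> (diag_mat d *v x)" if x: "x \<noteq> 0" for x
  proof -
    obtain i where "x $ i \<noteq> 0" using x by (auto simp: vec_eq_iff)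
    then have "0 < d $ i * (x $ i)\<^sup>2" using d by simp
    also have "\<dots> \<le> (\<Sum>i\<in>UNIV. d $ i * (x $ i)\<^sup>2)"
      using d by (intro member_le_sum) (auto intro!: mult_nonneg_nonneg simp: less_imp_le)
    finally show ?thesis
      by (simp add: diag_mat_vec inner_vec_def power2_eq_square algebra_simps)
  qed
  then show "posdef (diag_mat d)" by (simp add: posdef_def)
qed

lemma posdef_spectral:
  fixes A :: "real^'n^'n"
  assumes A: "posdef A"
  obtains Q d where "orthogonal_matrix Q" "A = Q ** diag_mat d ** transpose Q" "\<And>i. d $ i > 0"
proof -
  obtain Q d where Q: "orthogonal_matrix Q" and e: "A = Q ** diag_mat d ** transpose Q"
    using symmetric_spectral A posdef_def by blast
  have "transpose Q ** A ** transpose (transpose Q) = diag_mat d"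
    by (simp add: e matrix_mul_assoc[symmetric] orthogonal_matrix_cancel[OF Q])
  then have "posdef (diag_mat d)"
    using posdef_congruence[OF A invertible_orthogonal[OF orthogonal_transpose[OF Q]]] by simp
  then show ?thesis using that[OF Q e] by (simp add: posdef_diag_mat)
qed

lemma posdef_sqrt:
  fixes A :: "real^'n^'n"
  assumes A: "posdef A"
  obtains h where "posdef h" "h ** h = A"
proof -
  obtain Q d where Q: "orthogonal_matrix Q" and e: "A = Q ** diag_mat d ** transpose Q" and d: "\<And>i. d $ i > 0"
    using posdef_spectral[OF A] by metis
  let ?h = "Q ** diag_mat (\<chi> i. sqrt (d $ i)) ** transpose Q"
  have "posdef ?h" using d by (intro posdef_congruence invertible_orthogonal Q) (simp add: posdef_diag_mat)
  moreover have "?h ** ?h = Q ** (diag_mat (\<chi> i. sqrt (d $ i)) ** diag_mat (\<chi> i. sqrt (d $ i))) ** transpose Q"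
    by (simp add: matrix_mul_assoc[symmetric] orthogonal_matrix_cancel[OF Q])
  then have "?h ** ?h = A" using d by (simp add: diag_mat_mult e less_imp_le)
  ultimately show ?thesis using that by blast
qed

lemma posdef_det_pos: "posdef A \<Longrightarrow> 0 < det A"
  by (erule posdef_spectral) (simp add: det_orthogonal_conj det_diag_mat prod_pos)

lemma posdef_invertible: "posdef A \<Longrightarrow> invertible A"
  using posdef_det_pos invertible_det_nz by fastforce

lemma posdef_symmetric: "posdef A \<Longrightarrow> transpose A = A"
  by (simp add: posdef_def)

lemma posdef_mat1: "posdef (mat 1)"
  by (simp add: posdef_def transpose_mat)

lemma matrix_inv_cancel:
  fixes A :: "real^'n^'n"
  assumes "invertible A"
  shows "A ** matrix_inv A = mat 1" "matrix_inv A ** A = mat 1"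
    "A ** (matrix_inv A ** X) = X" "matrix_inv A ** (A ** X) = X"
proof -
  show *: "A ** matrix_inv A = mat 1" "matrix_inv A ** A = mat 1"
    using assms unfolding invertible_def matrix_inv_def by (metis (mono_tags, lifting) someI_ex)+
  show "A ** (matrix_inv A ** X) = X" "matrix_inv A ** (A ** X) = X"
    by (simp_all add: matrix_mul_assoc *)
qed

lemma matrix_inv_eqI:
  fixes A :: "real^'n^'n"
  assumes "A ** B = mat 1"
  shows "matrix_inv A = B"
proof -
  have i: "invertible A" using assms by (metis invertible_right_inverse)
  then show ?thesis by (metis assms matrix_inv_cancel(4) matrix_mul_rid)
qed

lemma invertible_matrix_inv: "invertible (A::real^'n^'n) \<Longrightarrow> invertible (matrix_inv A)"
  using matrix_inv_cancel invertible_def by blast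

lemma matrix_inv_matrix_inv: "invertible (A::real^'n^'n) \<Longrightarrow> matrix_inv (matrix_inv A) = A"
  by (rule matrix_inv_eqI) (rule matrix_inv_cancel)

lemma det_matrix_inv: "invertible (A::real^'n^'n) \<Longrightarrow> det (matrix_inv A) = 1 / det A"
  using matrix_inv_cancel(1)[of A] invertible_det_nz[of A]
  by (metis det_I det_mul nonzero_eq_divide_eq mult.commute)

lemma transpose_matrix_inv: "invertible (A::real^'n^'n) \<Longrightarrow> transpose (matrix_inv A) = matrix_inv (transpose A)"
  by (rule matrix_inv_eqI[symmetric]) (simp add: matrix_transpose_mul[symmetric] matrix_inv_cancel transpose_mat)

lemma matrix_inv_mult:
  assumes "invertible (A::real^'n^'n)" "invertible (B::real^'n^'n)"
  shows "matrix_inv (A ** B) = matrix_inv B ** matrix_inv A"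
  by (rule matrix_inv_eqI)
    (simp add: matrix_mul_assoc[symmetric] matrix_inv_cancel(3)[OF assms(2)] matrix_inv_cancel(1)[OF assms(1)])

lemma posdef_matrix_inv:
  assumes A: "posdef A"
  shows "posdef (matrix_inv A)"
proof -
  have i: "invertible A" using A posdef_invertible by blast
  have t: "transpose (matrix_inv A) = matrix_inv A"
    using A transpose_matrix_inv[OF i] by (simp add: posdef_def)
  have "posdef (matrix_inv A ** A ** transpose (matrix_inv A))"
    by (intro posdef_congruence A invertible_matrix_inv i)
  then show ?thesis using t by (simp add: matrix_inv_cancel[OF i])
qed

lemma posdef_add: "posdef A \<Longrightarrow> posdef B \<Longrightarrow> posdef (A + B)"
  unfolding posdef_def
  by (simp add: matrix_vector_mult_add_rdistrib inner_add_right add_pos_pos transpose_def vec_eq_iff)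

lemma posdef_scaleR: "posdef A \<Longrightarrow> c > 0 \<Longrightarrow> posdef (c *\<^sub>R A)"
  by (auto simp: posdef_def transpose_def vec_eq_iff scaleR_matrix_vector_assoc[symmetric])

text \<open>In terms of the eigenvalues \<open>d_i\<close> the difference of the two sides is the
  sum of \<open>ln d_i - (d_i - 1)\<close>, where every term is nonpositive and vanishes only at
  \<open>d_i = 1\<close>. Uniqueness of the completion, the derivative of the log-determinant and
  the maximum likelihood estimates all rest on this inequality.\<close>

lemma posdef_ln_det_le_trace:
  fixes B :: "real^'n^'n"
  assumes B: "posdef B"
  shows "ln (det B) - trace B \<le> - real CARD('n)"
    and "ln (det B) - trace B = - real CARD('n) \<Longrightarrow> B = mat 1"
proof -
  obtain Q d where Q: "orthogonal_matrix Q" and e: "B = Q ** diag_mat d ** transpose Q" and d: "\<And>i. d $ i > 0"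
    using posdef_spectral[OF B] by metis
  have eq: "ln (det B) - trace B + real CARD('n) = (\<Sum>i\<in>UNIV. ln (d $ i) - (d $ i - 1))"
    unfolding e det_orthogonal_conj[OF Q] trace_orthogonal_conj[OF Q] det_diag_mat
    using d by (subst ln_prod) (auto simp: trace_def sum_subtractf less_imp_neq[THEN not_sym])
  have le: "ln (d $ i) - (d $ i - 1) \<le> 0" for i using ln_le_minus_one[OF d[of i]] by simp
  show "ln (det B) - trace B \<le> - real CARD('n)"
    using eq sum_nonpos[of UNIV "\<lambda>i. ln (d $ i) - (d $ i - 1)"] le by simp
  assume "ln (det B) - trace B = - real CARD('n)"
  then have "(\<Sum>i\<in>UNIV. (d $ i - 1) - ln (d $ i)) = 0" using eq by (simp add: sum_subtractf)
  moreover have "\<And>i. 0 \<le> (d $ i - 1) - ln (d $ i)" using le by (simp add: algebra_simps)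
  ultimately have "\<forall>i. (d $ i - 1) - ln (d $ i) = 0"
    using sum_nonneg_eq_0_iff[of UNIV "\<lambda>i. (d $ i - 1) - ln (d $ i)"] by simp
  then have "d $ i = 1" for i using ln_eq_minus_one[OF d[of i]] by simp
  then have "diag_mat d = mat 1" by (simp add: vec_eq_iff mat_def)
  then show "B = mat 1" using e Q by (simp add: orthogonal_matrix_cancel)
qed

text \<open>The one-matrix inequality applied to \<open>h ** B ** h\<close>, where \<open>h\<close>
  is the square root of \<open>A\<close>; its trace is that of \<open>A ** B\<close>. Up to a factor
  this is nonnegativity of the Kullback-Leibler divergence between centred normal laws.\<close>

lemma posdef_pair_ln_det_le_trace:
  fixes A B :: "real^'n^'n"
  assumes A: "posdef A" and B: "posdef B"
  shows "ln (det A) + ln (det B) - trace (A ** B) \<le> - real CARD('n)"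
    and "ln (det A) + ln (det B) - trace (A ** B) = - real CARD('n) \<Longrightarrow> A = matrix_inv B"
proof -
  obtain h where h: "posdef h" "h ** h = A" using posdef_sqrt[OF A] by metis
  let ?C = "h ** B ** h"
  have ih: "invertible h" using h posdef_invertible by blast
  have C: "posdef ?C"
    using posdef_congruence[OF B ih] posdef_symmetric[OF h(1)] by simp
  have t: "trace ?C = trace (A ** B)"
    using trace_mul_sym[of "h ** B" h] by (simp add: h matrix_mul_assoc)
  have "ln (det ?C) = ln (det A) + ln (det B)"
    using posdef_det_pos[OF h(1)] posdef_det_pos[OF B]
    by (simp add: h(2)[symmetric] det_mul ln_mult)
  then have eq: "ln (det A) + ln (det B) - trace (A ** B) = ln (det ?C) - trace ?C"
    using t by simp
  show "ln (det A) + ln (det B) - trace (A ** B) \<le> - real CARD('n)"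
    unfolding eq by (rule posdef_ln_det_le_trace(1)[OF C])
  assume "ln (det A) + ln (det B) - trace (A ** B) = - real CARD('n)"
  then have e: "?C = mat 1" unfolding eq by (rule posdef_ln_det_le_trace(2)[OF C])
  have "B ** A = matrix_inv h ** (?C ** h)"
    by (simp add: h(2)[symmetric] matrix_mul_assoc[symmetric] matrix_inv_cancel[OF ih])
  also have "\<dots> = mat 1" by (simp add: e matrix_inv_cancel[OF ih])
  finally show "A = matrix_inv B" using matrix_inv_eqI by metis
qed

text \<open>\<open>h\<close> is the square root of \<open>g ** transpose g\<close>. Together with
  the spectral theorem this reduces multiplicative statements about \<open>g\<close> to orthogonal
  and diagonal matrices.\<close>

lemma polar_decomposition:
  fixes g :: "real^'n^'n"
  assumes g: "invertible g"
  obtains h R where "posdef h" "orthogonal_matrix R" "g = h ** R"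
proof -
  have "posdef (g ** mat 1 ** transpose g)" by (intro posdef_congruence posdef_mat1 g)
  then obtain h where h: "posdef h" "h ** h = g ** transpose g" using posdef_sqrt by (metis matrix_mul_rid)
  have ih: "invertible h" using h posdef_invertible by blast
  have th: "transpose (matrix_inv h) = matrix_inv h"
    using h(1) transpose_matrix_inv[OF ih] by (simp add: posdef_def)
  let ?R = "matrix_inv h ** g"
  have "?R ** transpose ?R = matrix_inv h ** (g ** transpose g) ** matrix_inv h"
    by (simp add: matrix_transpose_mul th matrix_mul_assoc)
  also have "\<dots> = mat 1" by (simp add: h(2)[symmetric] matrix_mul_assoc[symmetric] matrix_inv_cancel[OF ih])
  finally have "orthogonal_matrix (transpose ?R)" by (simp add: orthogonal_matrix)
  then have "orthogonal_matrix ?R" using orthogonal_transpose by fastforce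
  moreover have "g = h ** ?R" by (simp add: matrix_inv_cancel[OF ih])
  ultimately show ?thesis using that h by blast
qed

subsection \<open>Symmetric matrices as coordinate vectors\<close>

text \<open>Indexing by unordered pairs gives every distinct entry one coordinate, so
  \<open>lborel\<close> on the coordinate vectors is Lebesgue measure on symmetric matrices.\<close>

definition smat :: "real^('p::finite) uprod \<Rightarrow> real^'p^'p" where
  "smat x = (\<chi> i j. x $ Upair i j)"

text \<open>Only meaningful on symmetric matrices: on others the entry is read off at an arbitrary
  ordering of the pair.\<close>
definition svec :: "real^'p^'p \<Rightarrow> real^('p::finite) uprod" where
  "svec A = (\<chi> e. case (SOME (i, j). Upair i j = e) of (i, j) \<Rightarrow> A $ i $ j)"

lemma smat_nth [simp]: "smat x $ i $ j = x $ Upair i j"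
  by (simp add: smat_def)

lemma Upair_commute: "Upair i j = Upair j i"
  by simp

lemma transpose_smat [simp]: "transpose (smat x) = smat x"
  by (simp add: transpose_def vec_eq_iff Upair_commute)

lemma svec_nth: 
  assumes "transpose A = A"
  shows "svec A $ Upair i j = A $ i $ j"
proof -
  obtain a b where ab: "(SOME (a, b). Upair a b = Upair i j) = (a, b)" by (metis surj_pair)
  have "case (SOME (a, b). Upair a b = Upair i j) of (a, b) \<Rightarrow> Upair a b = Upair i j"
    by (rule someI[of "\<lambda>(a, b). Upair a b = Upair i j" "(i, j)"]) simp
  then have "Upair a b = Upair i j" unfolding ab by simp
  then have "a = i \<and> b = j \<or> a = j \<and> b = i" by simp
  moreover have "A $ j $ i = A $ i $ j" using assms by (metis transpose_def vec_lambda_beta)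
  ultimately show ?thesis by (auto simp: svec_def ab simp del: Upair_inject)
qed

lemma smat_svec: "transpose A = A \<Longrightarrow> smat (svec A) = A"
  by (simp add: vec_eq_iff svec_nth)

lemma svec_smat [simp]: "svec (smat x) = x"
proof -
  have "svec (smat x) $ e = x $ e" for e
    by (cases e) (simp add: svec_nth)
  then show ?thesis by (simp add: vec_eq_iff)
qed

lemma inj_smat: "inj smat"
  by (rule inj_on_inverseI[of _ svec]) simp

lemma smat_eq_iff [simp]: "smat x = smat y \<longleftrightarrow> x = y"
  using inj_smat by (auto simp: inj_def)

lemma linear_smat: "linear smat"
  by (rule linearI) (simp_all add: vec_eq_iff)

lemma linear_svec: "linear svec"
  by (rule linearI) (simp_all add: vec_eq_iff svec_def split: prod.split)

lemmas smat_add = linear_add[OF linear_smat] and smat_diff = linear_diff[OF linear_smat]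
  and smat_scaleR = linear_scale[OF linear_smat]

text \<open>The multiplicity of an entry in the trace form: 1 on the diagonal and 2 off it.\<close>

definition upair_weight :: "('p::finite) uprod \<Rightarrow> real" where
  "upair_weight e = real (card {(i, j). Upair i j = e})"

lemma upair_weight_pos: "upair_weight e > 0"
proof (cases e)
  case (Upair i j)
  then have "(i, j) \<in> {(i, j). Upair i j = e}" by simp
  then have "card {(i, j). Upair i j = e} > 0" using card_gt_0_iff finite by blast
  then show ?thesis by (simp add: upair_weight_def)
qed

lemma sum_Upair:
  "(\<Sum>i\<in>UNIV. \<Sum>j\<in>UNIV. f (Upair i j)) = (\<Sum>e\<in>UNIV. upair_weight e * f e)"
  for f :: "('p::finite) uprod \<Rightarrow> real"
proof -
  have "(\<Sum>i\<in>UNIV. \<Sum>j\<in>UNIV. f (Upair i j)) = (\<Sum>z\<in>UNIV. f (case z of (i, j) \<Rightarrow> Upair i j))"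
    by (simp add: sum.cartesian_product split_def)
  also have "\<dots> = (\<Sum>e\<in>UNIV. \<Sum>z\<in>{z \<in> UNIV. (case z of (i, j) \<Rightarrow> Upair i j) = e}. f (case z of (i, j) \<Rightarrow> Upair i j))"
    by (rule sum.group[symmetric]) auto
  also have "\<dots> = (\<Sum>e\<in>UNIV. upair_weight e * f e)"
  proof (rule sum.cong[OF refl])
    fix e
    have "(\<Sum>z\<in>{z \<in> UNIV. (case z of (i, j) \<Rightarrow> Upair i j) = e}. f (case z of (i, j) \<Rightarrow> Upair i j))
      = (\<Sum>z\<in>{z \<in> UNIV. (case z of (i, j) \<Rightarrow> Upair i j) = e}. f e)"
      by (rule sum.cong) auto
    then show "(\<Sum>z\<in>{z \<in> UNIV. (case z of (i, j) \<Rightarrow> Upair i j) = e}. f (case z of (i, j) \<Rightarrow> Upair i j))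
      = upair_weight e * f e"
      by (simp add: upair_weight_def split_def)
  qed
  finally show ?thesis .
qed

lemma trace_smat_mult: "trace (smat x ** smat y) = (\<Sum>e\<in>UNIV. upair_weight e * (x $ e * y $ e))"
proof -
  have "trace (smat x ** smat y) = (\<Sum>i\<in>UNIV. \<Sum>j\<in>UNIV. x $ Upair i j * y $ Upair i j)"
    by (simp add: trace_def matrix_matrix_mult_def Upair_commute)
  then show ?thesis using sum_Upair[of "\<lambda>e. x $ e * y $ e"] by simp
qed

lemma trace_smat_axis: "trace (smat x ** smat (axis e 1)) = upair_weight e * x $ e"
proof -
  have "(\<Sum>a\<in>UNIV. upair_weight a * (x $ a * axis e 1 $ a)) = (\<Sum>a\<in>UNIV. if a = e then upair_weight e * x $ e else 0)"
    by (intro sum.cong) (auto simp: axis_def)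
  then show ?thesis by (simp add: trace_smat_mult)
qed

lemma prod_uprod_eq:
  fixes d :: "'p::finite \<Rightarrow> real" and f :: "'p uprod \<Rightarrow> real"
  assumes "\<And>i j. f (Upair i j) = d i * d j"
  shows "\<bar>\<Prod>e\<in>UNIV. f e\<bar> = \<bar>\<Prod>i\<in>UNIV. d i\<bar> ^ (CARD('p) + 1)"
proof -
  \<comment> \<open>An off-diagonal pair arises from two ordered pairs, a diagonal one from a single
    ordered pair. The extra diagonal factor in \<open>h\<close> makes every unordered pair
    contribute a square; the total power of each \<open>d i\<close> is then
    \<open>2 * (CARD('p) + 1)\<close>.\<close>
  define h where "h = (\<lambda>(i, j). f (Upair i j) * (if i = j then f (Upair i j) else 1))"
  have "(\<Prod>z\<in>UNIV. h z) = (\<Prod>e\<in>UNIV. \<Prod>z\<in>{z \<in> UNIV. (case z of (i, j) \<Rightarrow> Upair i j) = e}. h z)"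
    by (rule prod.group[symmetric]) auto
  also have "\<dots> = (\<Prod>e\<in>UNIV. (f e)\<^sup>2)"
  proof (rule prod.cong[OF refl])
    fix e :: "'p uprod"
    obtain a b where e: "e = Upair a b" by (cases e)
    have "{z \<in> UNIV. (case z of (i, j) \<Rightarrow> Upair i j) = e} = {(a, b), (b, a)}"
      by (auto simp: e)
    then show "(\<Prod>z\<in>{z \<in> UNIV. (case z of (i, j) \<Rightarrow> Upair i j) = e}. h z) = (f e)\<^sup>2"
      using assms by (cases "a = b") (auto simp: h_def e power2_eq_square)
  qed
  finally have 1: "(\<Prod>z\<in>UNIV. h z) = (\<Prod>e\<in>UNIV. f e)\<^sup>2" by (simp add: prod_power_distrib)
  have "(\<Prod>z\<in>UNIV. h z) = (\<Prod>i\<in>UNIV. \<Prod>j\<in>UNIV. d i * d j * (if i = j then d i * d j else 1))"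
    by (simp add: h_def assms prod.cartesian_product split_def cong: if_cong)
  also have "\<dots> = (\<Prod>i\<in>UNIV. d i ^ CARD('p) * (\<Prod>j\<in>UNIV. d j) * (d i * d i))"
  proof (rule prod.cong[OF refl])
    fix i
    have "(\<Prod>j\<in>UNIV. if i = j then d i * d j else 1) = (\<Prod>j\<in>UNIV. if j = i then d i * d i else 1)"
      by (intro prod.cong) auto
    then have "(\<Prod>j\<in>UNIV. if i = j then d i * d j else 1) = d i * d i" by simp
    then show "(\<Prod>j\<in>UNIV. d i * d j * (if i = j then d i * d j else 1)) = d i ^ CARD('p) * (\<Prod>j\<in>UNIV. d j) * (d i * d i)"
      by (simp add: prod.distrib)
  qed
  also have "\<dots> = ((\<Prod>i\<in>UNIV. d i) ^ (CARD('p) + 1))\<^sup>2"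
    by (simp add: prod.distrib prod_power_distrib power2_eq_square)
  finally have "(\<Prod>e\<in>UNIV. f e)\<^sup>2 = ((\<Prod>i\<in>UNIV. d i) ^ (CARD('p) + 1))\<^sup>2" using 1 by simp
  then have "\<bar>\<Prod>e\<in>UNIV. f e\<bar> = \<bar>(\<Prod>i\<in>UNIV. d i) ^ (CARD('p) + 1)\<bar>" by (simp only: power2_eq_iff abs_eq_iff)
  then show ?thesis by (simp add: power_abs del: power_Suc)
qed

text \<open>With \<open>W\<close> the invertible diagonal matrix of weights,
  \<open>W ** matrix f = transpose (matrix f') ** W\<close>. Weights are needed because the trace
  form counts off-diagonal coordinates twice, so that \<open>congr (transpose g)\<close> is adjoint
  to \<open>congr g\<close> only in the weighted sense.\<close>

lemma det_weighted_adjoint: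
  fixes f f' :: "real^'k \<Rightarrow> real^'k"
  assumes w: "\<And>e. w e > (0::real)"
    and adj: "\<And>x y. (\<Sum>e\<in>UNIV. w e * (f x $ e * y $ e)) = (\<Sum>e\<in>UNIV. w e * (x $ e * f' y $ e))"
  shows "det (matrix f) = det (matrix f')"
proof -
  have key: "w a * f (axis b 1) $ a = w b * f' (axis a 1) $ b" for a b
  proof -
    have "(\<Sum>e\<in>UNIV. w e * (f (axis b 1) $ e * axis a 1 $ e)) = (\<Sum>e\<in>UNIV. if e = a then w a * f (axis b 1) $ a else 0)"
      by (intro sum.cong) (auto simp: axis_def)
    moreover have "(\<Sum>e\<in>UNIV. w e * (axis b 1 $ e * f' (axis a 1) $ e)) = (\<Sum>e\<in>UNIV. if e = b then w b * f' (axis a 1) $ b else 0)"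
      by (intro sum.cong) (auto simp: axis_def)
    ultimately show ?thesis using adj[of "axis b 1" "axis a 1"] by simp
  qed
  let ?W = "diag_mat (\<chi> e. w e)"
  have "(?W ** matrix f) $ a $ b = (transpose (matrix f') ** ?W) $ a $ b" for a b
  proof -
    have "(?W ** matrix f) $ a $ b = (\<Sum>k\<in>UNIV. if k = a then w a * f (axis b 1) $ a else 0)"
      unfolding matrix_matrix_mult_def vec_lambda_beta by (intro sum.cong) (auto simp: matrix_def)
    moreover have "(transpose (matrix f') ** ?W) $ a $ b = (\<Sum>k\<in>UNIV. if k = b then w b * f' (axis a 1) $ b else 0)"
      unfolding matrix_matrix_mult_def vec_lambda_beta by (intro sum.cong) (auto simp: matrix_def transpose_def)
    ultimately show ?thesis using key by simp
  qed
  then have "?W ** matrix f = transpose (matrix f') ** ?W" by (simp add: vec_eq_iff)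
  then have "det ?W * det (matrix f) = det (matrix f') * det ?W" by (metis det_mul det_transpose)
  moreover have "det ?W \<noteq> 0" using w by (simp add: det_diag_mat less_imp_neq[THEN not_sym])
  ultimately show ?thesis by simp
qed

text \<open>Orthogonal matrices act with determinant of absolute value 1, since
  \<open>Q ** transpose Q\<close> acts as the identity and transposing does not change the
  determinant. The factorization \<open>g = Q ** diag_mat d ** transpose Q ** R\<close> therefore
  leaves only the diagonal part.\<close>

lemma abs_det_representation:
  fixes \<rho> :: "real^'p^'p \<Rightarrow> real^'k \<Rightarrow> real^'k"
  assumes lin: "\<And>g. linear (\<rho> g)"
    and mult: "\<And>g h. \<rho> (g ** h) = \<rho> g \<circ> \<rho> h"
    and one: "\<rho> (mat 1) = id"
    and adj: "\<And>g. det (matrix (\<rho> (transpose g))) = det (matrix (\<rho> g))"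
    and diag: "\<And>d. \<bar>det (matrix (\<rho> (diag_mat d)))\<bar> = \<bar>\<Prod>i\<in>UNIV. d $ i\<bar> ^ m"
    and g: "invertible g"
  shows "\<bar>det (matrix (\<rho> g))\<bar> = \<bar>det g\<bar> ^ m"
proof -
  have D: "det (matrix (\<rho> (g ** h))) = det (matrix (\<rho> g)) * det (matrix (\<rho> h))" for g h
    by (simp add: mult matrix_compose lin det_mul)
  have one': "det (matrix (\<rho> (mat 1))) = 1" by (simp add: one matrix_id)
  have orth: "\<bar>det (matrix (\<rho> Q))\<bar> = 1" if "orthogonal_matrix Q" for Q
  proof -
    have "det (matrix (\<rho> Q)) * det (matrix (\<rho> Q)) = 1"
      using D[of Q "transpose Q"] orthogonal_matrix_cancel(2)[OF that] one' adj by simp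
    then show ?thesis by (metis abs_mult_self_eq abs_1 abs_mult power2_eq_square abs_square_eq_1 power2_eq_1_iff)
  qed
  obtain h R where h: "posdef h" and R: "orthogonal_matrix R" and gR: "g = h ** R"
    using polar_decomposition[OF g] by metis
  obtain Q d where Q: "orthogonal_matrix Q" and e: "h = Q ** diag_mat d ** transpose Q" and d: "\<And>i. d $ i > 0"
    using posdef_spectral[OF h] by metis
  have *: "\<bar>det (matrix (\<rho> g))\<bar> = \<bar>\<Prod>i\<in>UNIV. d $ i\<bar> ^ m"
    by (simp add: gR e D abs_mult orth R Q orthogonal_transpose diag)
  have "\<bar>det R\<bar> = 1" using det_orthogonal_matrix[OF R] by auto
  moreover have "det h = (\<Prod>i\<in>UNIV. d $ i)"
    unfolding e det_orthogonal_conj[OF Q] det_diag_mat ..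
  ultimately have "\<bar>det g\<bar> = \<bar>\<Prod>i\<in>UNIV. d $ i\<bar>"
    by (simp add: gR det_mul abs_mult)
  then show ?thesis by (simp add: *)
qed

definition congr :: "real^'p^'p \<Rightarrow> real^('p::finite) uprod \<Rightarrow> real^'p uprod" where
  "congr g x = svec (g ** smat x ** transpose g)"

lemma smat_congr: "smat (congr g x) = g ** smat x ** transpose g"
  unfolding congr_def by (rule smat_svec) (simp add: matrix_transpose_mul matrix_mul_assoc)

lemma linear_congr: "linear (congr g)" for g :: "real^('p::finite)^'p"
proof -
  have "linear (\<lambda>X::real^'p^'p. g ** X ** transpose g)"
    by (rule linearI) (simp_all add: matrix_matrix_mult_def vec_eq_iff sum_distrib_left sum_distrib_right
        sum.distrib algebra_simps)
  then have "linear (svec \<circ> (\<lambda>X. g ** X ** transpose g) \<circ> smat)"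
    by (intro linear_compose linear_svec linear_smat)
  then show ?thesis by (simp add: congr_def[abs_def] comp_def)
qed

lemma congr_mult: "congr (g ** h) = congr g \<circ> congr h"
proof
  fix x
  have "smat (congr (g ** h) x) = smat ((congr g \<circ> congr h) x)"
    by (simp add: smat_congr matrix_transpose_mul matrix_mul_assoc)
  then show "congr (g ** h) x = (congr g \<circ> congr h) x" by simp
qed

lemma congr_mat1: "congr (mat 1) = id"
proof
  show "congr (mat 1) x = id x" for x :: "real^('p::finite) uprod" by (simp add: congr_def transpose_mat)
qed

lemma trace_congr: "trace (smat (congr g x) ** smat y) = trace (smat x ** smat (congr (transpose g) y))"
proof -
  have "trace (smat (congr g x) ** smat y) = trace (g ** (smat x ** transpose g ** smat y))"
    by (simp add: smat_congr matrix_mul_assoc)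
  also have "\<dots> = trace (smat x ** transpose g ** smat y ** g)" by (rule trace_mul_sym)
  finally show ?thesis by (simp add: smat_congr matrix_mul_assoc)
qed

lemma congr_diag_nth: "congr (diag_mat d) x $ Upair i j = d $ i * d $ j * x $ Upair i j"
proof -
  have "congr (diag_mat d) x $ Upair i j = smat (congr (diag_mat d) x) $ i $ j" by simp
  also have "\<dots> = (\<Sum>k\<in>UNIV. (\<Sum>l\<in>UNIV. (if i = l then d $ i else 0) * x $ Upair l k) * (if k = j then d $ k else 0))"
    by (simp add: smat_congr matrix_matrix_mult_def del: smat_nth) simp
  also have "\<dots> = (\<Sum>k\<in>UNIV. if k = j then (\<Sum>l\<in>UNIV. if l = i then d $ i * d $ j * x $ Upair i j else 0) else 0)"
  proof (intro sum.cong refl)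
    fix k
    have "(\<Sum>l\<in>UNIV. (if i = l then d $ i else 0) * x $ Upair l k) * (if k = j then d $ k else 0)
      = (if k = j then (\<Sum>l\<in>UNIV. (if i = l then d $ i else 0) * x $ Upair l j * d $ j) else 0)"
      by (simp add: sum_distrib_right)
    also have "\<dots> = (if k = j then (\<Sum>l\<in>UNIV. if l = i then d $ i * d $ j * x $ Upair i j else 0) else 0)"
      by (intro if_cong refl sum.cong) auto
    finally show "(\<Sum>l\<in>UNIV. (if i = l then d $ i else 0) * x $ Upair l k) * (if k = j then d $ k else 0)
      = (if k = j then (\<Sum>l\<in>UNIV. if l = i then d $ i * d $ j * x $ Upair i j else 0) else 0)" .
  qed
  finally show ?thesis by simp
qed

lemma abs_det_diagonal_map:
  fixes f :: "real^'k \<Rightarrow> real^'k"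
  assumes "\<And>x e. f x $ e = c e * x $ e"
  shows "det (matrix f) = (\<Prod>e\<in>UNIV. c e)"
  by (subst det_diagonal) (simp_all add: matrix_def assms axis_def)

text \<open>The eigenvalue of \<open>congr (diag_mat d)\<close> at the coordinate \<open>e\<close>.
  Reading it off on the all-ones vector gives a product over an unordered pair without choosing an
  ordering of the pair.\<close>

definition pair_scale :: "real^'p \<Rightarrow> ('p::finite) uprod \<Rightarrow> real" where
  "pair_scale d e = congr (diag_mat d) (\<chi> e. 1) $ e"

lemma pair_scale_Upair [simp]: "pair_scale d (Upair i j) = d $ i * d $ j"
  by (simp add: pair_scale_def congr_diag_nth)

lemma congr_diag: "congr (diag_mat d) x $ e = pair_scale d e * x $ e"
  by (cases e) (simp add: congr_diag_nth)

text \<open>For diagonal \<open>g\<close> the eigenvalues are \<open>d_i * d_j\<close> over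
  unordered pairs, and each \<open>d_i\<close> occurs in them \<open>p - 1\<close> times off the
  diagonal and twice on it.\<close>

lemma abs_det_congr:
  fixes g :: "real^'p^'p"
  assumes "invertible g"
  shows "\<bar>det (matrix (congr g))\<bar> = \<bar>det g\<bar> ^ (CARD('p) + 1)"
proof (rule abs_det_representation[OF linear_congr congr_mult congr_mat1 _ _ assms])
  show "det (matrix (congr (transpose g))) = det (matrix (congr g))" for g :: "real^'p^'p"
    by (rule det_weighted_adjoint[of upair_weight])
      (use upair_weight_pos trace_congr[of "transpose g"] in \<open>simp_all add: trace_smat_mult[symmetric]\<close>)
  show "\<bar>det (matrix (congr (diag_mat d)))\<bar> = \<bar>\<Prod>i\<in>UNIV. d $ i\<bar> ^ (CARD('p) + 1)" for d :: "real^'p"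
    unfolding abs_det_diagonal_map[OF congr_diag] by (rule prod_uprod_eq) simp
qed

section \<open>Canonical parameters and the linear group acting on them\<close>

definition sigma_of :: "('p::finite) canonical \<Rightarrow> real^'p uprod" where
  "sigma_of \<phi> = (\<chi> e. \<phi> $ Inr e)"

definition pack :: "real^'p \<Rightarrow> real^'p uprod \<Rightarrow> ('p::finite) canonical" where
  "pack b x = (\<chi> k. case k of Inl i \<Rightarrow> b $ i | Inr e \<Rightarrow> x $ e)"

lemma pack_simps [simp]: "xi_of (pack b x) = b" "sigma_of (pack b x) = x"
  "pack (xi_of \<phi>) (sigma_of \<phi>) = \<phi>" "pack b x $ Inl i = b $ i" "pack b x $ Inr e = x $ e"
  "xi_of \<phi> $ i = \<phi> $ Inl i" "sigma_of \<phi> $ e = \<phi> $ Inr e"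
  by (simp_all add: pack_def xi_of_def sigma_of_def vec_eq_iff split: sum.split)

lemma Lambda_of_smat: "Lambda_of \<phi> = smat (sigma_of \<phi>)"
  by (simp add: Lambda_of_def vec_eq_iff)

lemma linear_xi_of: "linear xi_of" and linear_sigma_of: "linear sigma_of"
  by (rule linearI; simp add: vec_eq_iff)+

lemma pack_add: "pack (a + b) (x + y) = pack a x + pack b y"
  and pack_scaleR: "pack (c *\<^sub>R a) (c *\<^sub>R x) = c *\<^sub>R pack a x"
  by (simp_all add: pack_def vec_eq_iff split: sum.split)

lemma linear_pack: "linear f \<Longrightarrow> linear h \<Longrightarrow> linear (\<lambda>\<phi>. pack (f \<phi>) (h \<phi>))"
  by (rule linearI) (simp_all add: linear_add linear_scale pack_add pack_scaleR)

lemma canonical_eq_iff: "\<phi> = \<psi> \<longleftrightarrow> xi_of \<phi> = xi_of \<psi> \<and> sigma_of \<phi> = sigma_of \<psi>"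
  by (metis pack_simps(3))

definition canon_congr :: "real^'p^'p \<Rightarrow> ('p::finite) canonical \<Rightarrow> 'p canonical" where
  "canon_congr g \<phi> = pack (g *v xi_of \<phi>) (congr g (sigma_of \<phi>))"

lemma linear_canon_congr: "linear (canon_congr g)"
proof -
  have "linear (\<lambda>\<phi>. g *v xi_of \<phi>)" "linear (\<lambda>\<phi>. congr g (sigma_of \<phi>))"
    using linear_compose[OF linear_xi_of matrix_vector_mul_linear[of g]]
      linear_compose[OF linear_sigma_of linear_congr[of g]] by (simp_all add: comp_def)
  then show ?thesis using linear_pack by (simp add: canon_congr_def[abs_def])
qed

lemma sum_UNIV_Plus: "(\<Sum>k\<in>UNIV. f k) = (\<Sum>i\<in>UNIV. f (Inl i)) + (\<Sum>e\<in>UNIV. f (Inr e))"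
  for f :: "'a::finite + 'b::finite \<Rightarrow> real"
  by (simp flip: UNIV_Plus_UNIV add: sum.Plus)

lemma prod_UNIV_Plus: "(\<Prod>k\<in>UNIV. f k) = (\<Prod>i\<in>UNIV. f (Inl i)) * (\<Prod>e\<in>UNIV. f (Inr e))"
  for f :: "'a::finite + 'b::finite \<Rightarrow> real"
  by (simp flip: UNIV_Plus_UNIV add: prod.Plus)

text \<open>The component \<open>xi\<close> contributes one factor \<open>det g\<close> to the
  \<open>p + 1\<close> factors of the symmetric matrices. This is the origin of the exponent
  \<open>p + 2\<close> in the determinant of the information.\<close>

lemma abs_det_canon_congr:
  fixes g :: "real^'p^'p"
  assumes "invertible g"
  shows "\<bar>det (matrix (canon_congr g))\<bar> = \<bar>det g\<bar> ^ (CARD('p) + 2)"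
proof (rule abs_det_representation[OF linear_canon_congr _ _ _ _ assms])
  show "canon_congr (g ** h) = canon_congr g \<circ> canon_congr h" for g h :: "real^'p^'p"
    by (simp add: canon_congr_def fun_eq_iff congr_mult matrix_vector_mul_assoc)
  show "canon_congr (mat 1 :: real^'p^'p) = id"
    by (simp add: canon_congr_def fun_eq_iff congr_mat1)
  show "det (matrix (canon_congr (transpose g))) = det (matrix (canon_congr g))" for g :: "real^'p^'p"
  proof (rule det_weighted_adjoint[of "case_sum (\<lambda>_. 1) upair_weight"])
    show "0 < case_sum (\<lambda>_. 1) upair_weight e" for e :: "'p + 'p uprod"
      by (cases e) (simp_all add: upair_weight_pos)
    fix x y :: "'p canonical"
    have "(transpose g *v xi_of x) \<bullet> xi_of y = xi_of x \<bullet> (g *v xi_of y)"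
      by (simp add: inner_matrix_vector)
    moreover have "trace (smat (congr (transpose g) (sigma_of x)) ** smat (sigma_of y)) 
      = trace (smat (sigma_of x) ** smat (congr g (sigma_of y)))"
      by (simp add: trace_congr)
    ultimately show "(\<Sum>e\<in>UNIV. case_sum (\<lambda>_. 1) upair_weight e * (canon_congr (transpose g) x $ e * y $ e)) =
           (\<Sum>e\<in>UNIV. case_sum (\<lambda>_. 1) upair_weight e * (x $ e * canon_congr g y $ e))"
      by (simp add: sum_UNIV_Plus canon_congr_def trace_smat_mult inner_vec_def)
  qed
  show "\<bar>det (matrix (canon_congr (diag_mat d)))\<bar> = \<bar>\<Prod>i\<in>UNIV. d $ i\<bar> ^ (CARD('p) + 2)" for d :: "real^'p"
  proof -
    have "canon_congr (diag_mat d) x $ k = case_sum (\<lambda>i. d $ i) (pair_scale d) k * x $ k" for x k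
      by (cases k) (simp_all add: canon_congr_def diag_mat_vec congr_diag)
    then have "det (matrix (canon_congr (diag_mat d))) = (\<Prod>k\<in>UNIV. case_sum (\<lambda>i. d $ i) (pair_scale d) k)"
      by (rule abs_det_diagonal_map)
    also have "\<bar>\<dots>\<bar> = \<bar>\<Prod>i\<in>UNIV. d $ i\<bar> * \<bar>\<Prod>e\<in>UNIV. pair_scale d e\<bar>"
      by (simp add: prod_UNIV_Plus abs_mult)
    also have "\<bar>\<Prod>e\<in>UNIV. pair_scale d e\<bar> = \<bar>\<Prod>i\<in>UNIV. d $ i\<bar> ^ (CARD('p) + 1)"
      by (rule prod_uprod_eq) simp
    finally show ?thesis by simp
  qed
qed

subsection \<open>Positive definite completion\<close>

lemma has_derivative_vecI:
  fixes f :: "'a::real_normed_vector \<Rightarrow> 'b::euclidean_space^'n"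
  assumes "\<And>i. ((\<lambda>x. f x $ i) has_derivative (\<lambda>v. f' v $ i)) (at x within S)"
  shows "(f has_derivative f') (at x within S)"
proof (subst has_derivative_componentwise_within, intro ballI)
  fix b :: "'b^'n" assume "b \<in> Basis"
  then obtain i u where b: "b = axis i u" by (auto simp: Basis_vec_def)
  show "((\<lambda>x. f x \<bullet> b) has_derivative (\<lambda>v. f' v \<bullet> b)) (at x within S)"
    unfolding b inner_axis by (intro has_derivative_inner_left assms)
qed

lemma differentiable_prod:
  fixes f :: "'i \<Rightarrow> 'a::real_normed_vector \<Rightarrow> real"
  assumes "\<And>i. i \<in> I \<Longrightarrow> f i differentiable (at x within S)"
  shows "(\<lambda>x. \<Prod>i\<in>I. f i x) differentiable (at x within S)"
proof -
  obtain f' where "\<And>i. i \<in> I \<Longrightarrow> (f i has_derivative f' i) (at x within S)"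
    using assms unfolding differentiable_def by metis
  then show ?thesis unfolding differentiable_def by (blast intro: has_derivative_prod)
qed

lemma differentiable_det:
  fixes A :: "'a::real_normed_vector \<Rightarrow> real^'n^'n"
  assumes "\<And>i j. (\<lambda>x. A x $ i $ j) differentiable (at x within S)"
  shows "(\<lambda>x. det (A x)) differentiable (at x within S)"
  unfolding det_def by (intro differentiable_sum differentiable_mult differentiable_const differentiable_prod assms ballI finite_permutations finite)

text \<open>Cramer's rule for a column of the inverse. It shows the entries to be quotients of
  determinants, hence differentiable; the value of the derivative is found by other means.\<close>

lemma matrix_inv_cofactor:
  fixes A :: "real^'n^'n"
  assumes "invertible A"
  shows "matrix_inv A $ k $ l = det (\<chi> i j. if j = k then axis l 1 $ i else A $ i $ j) / det A"
proof -
  have d: "det A \<noteq> 0" using assms invertible_det_nz by blast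
  have "A *v (matrix_inv A *v axis l 1) = axis l 1"
    by (simp add: matrix_vector_mul_assoc matrix_inv_cancel[OF assms])
  then have "matrix_inv A *v axis l 1 = (\<chi> k. det (\<chi> i j. if j = k then axis l 1 $ i else A $ i $ j) / det A)"
    using cramer[OF d] by blast
  then have "(matrix_inv A *v axis l 1) $ k = det (\<chi> i j. if j = k then axis l 1 $ i else A $ i $ j) / det A"
    by simp
  then show ?thesis by (simp add: matrix_vector_mul_component row_def inner_axis)
qed

definition pd_cone :: "(real^('p::finite) uprod) set" where
  "pd_cone = {x. posdef (smat x)}"

lemma posdef_smat_iff: "posdef (smat x) \<longleftrightarrow> (\<forall>u. norm u = 1 \<longrightarrow> 0 < u \<bullet> (smat x *v u))"
proof
  assume "posdef (smat x)"
  then show "\<forall>u. norm u = 1 \<longrightarrow> 0 < u \<bullet> (smat x *v u)" by (metis norm_zero zero_neq_one posdef_def)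
next
  assume *: "\<forall>u. norm u = 1 \<longrightarrow> 0 < u \<bullet> (smat x *v u)"
  have "0 < u \<bullet> (smat x *v u)" if "u \<noteq> 0" for u
  proof -
    have "0 < ((1 / norm u) *\<^sub>R u) \<bullet> (smat x *v ((1 / norm u) *\<^sub>R u))"
      using that by (intro *[rule_format]) simp
    moreover have "smat x *v ((1 / norm u) *\<^sub>R u) = (1 / norm u) *\<^sub>R (smat x *v u)"
      by (simp add: matrix_vector_mult_def vec_eq_iff sum_distrib_left sum_divide_distrib)
    ultimately show ?thesis using that by (simp add: zero_less_divide_iff)
  qed
  then show "posdef (smat x)" by (simp add: posdef_def)
qed

lemma continuous_on_quadratic:
  "continuous_on S (\<lambda>z. fst z \<bullet> (smat (snd z) *v fst z))"
  unfolding inner_vec_def matrix_vector_mult_def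
  by (simp, intro continuous_intros)

text \<open>The complement is the projection, along the compact unit sphere, of the closed set of
  pairs of a direction and a matrix with nonpositive quadratic form.\<close>

lemma open_pd_cone: "open (pd_cone :: (real^('p::finite) uprod) set)"
proof -
  let ?T = "{z :: (real^'p) \<times> (real^'p uprod). fst z \<bullet> (smat (snd z) *v fst z) \<le> 0}"
  have "closed ?T"
    by (intro closed_Collect_le continuous_on_quadratic continuous_on_const)
  then have "closed {y. \<exists>x. x \<in> sphere (0::real^'p) 1 \<and> (x, y) \<in> ?T}"
    by (intro closed_compact_projection) auto
  moreover have "{y. \<exists>x. x \<in> sphere (0::real^'p) 1 \<and> (x, y) \<in> ?T} = - pd_cone"
    by (auto simp: pd_cone_def posdef_smat_iff not_less)
  ultimately show ?thesis by (simp add: closed_def)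
qed

lemma pd_cone_invertible: "x \<in> pd_cone \<Longrightarrow> invertible (smat x)"
  by (simp add: pd_cone_def posdef_invertible)

lemma pd_cone_det_pos: "x \<in> pd_cone \<Longrightarrow> 0 < det (smat x)"
  by (simp add: pd_cone_def posdef_det_pos)

lemma differentiable_smat_nth: "(\<lambda>x. smat x $ i $ j) differentiable (at x within S)"
  by (auto simp: differentiable_def intro!: exI has_derivative_bounded_linear bounded_linear_imp_has_derivative bounded_linear_vec_nth)

lemma differentiable_det_smat: "(\<lambda>x. det (smat x)) differentiable (at x within S)"
  by (intro differentiable_det differentiable_smat_nth)

lemma differentiable_matrix_inv_smat:
  assumes "invertible (smat x)"
  shows "(\<lambda>x. matrix_inv (smat x) $ k $ l) differentiable (at x)"
proof -
  let ?g = "\<lambda>x. det (\<chi> i j. if j = k then axis l 1 $ i else smat x $ i $ j) / det (smat x)"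
  have nz: "det (smat x) \<noteq> 0" using assms invertible_det_nz by blast
  have "?g differentiable (at x)"
  proof (intro differentiable_divide differentiable_det_smat differentiable_det nz)
    fix i j
    show "(\<lambda>x. (\<chi> i j. if j = k then axis l 1 $ i else smat x $ i $ j) $ i $ j) differentiable (at x)"
      using differentiable_smat_nth[of i j x UNIV] by (cases "j = k") simp_all
  qed
  then obtain D where D: "(?g has_derivative D) (at x)" by (auto simp: differentiable_def)
  let ?S = "{y. det (smat y) \<noteq> 0}"
  have "open ?S"
    by (intro open_Collect_neq continuous_on_const differentiable_imp_continuous_on)
      (simp add: differentiable_on_def differentiable_det_smat)
  moreover have "?g y = matrix_inv (smat y) $ k $ l" if "y \<in> ?S" for y
    using that by (subst matrix_inv_cofactor) (auto simp: invertible_det_nz)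
  ultimately have "((\<lambda>x. matrix_inv (smat x) $ k $ l) has_derivative D) (at x)"
    using nz by (intro has_derivative_transform_within_open[OF D]) auto
  then show ?thesis by (auto simp: differentiable_def)
qed

text \<open>Differentiability being known from Cramer's rule, the formula follows by differentiating
  \<open>smat y ** matrix_inv (smat y) = mat 1\<close> entry by entry and solving for the derivative
  of the inverse.\<close>

lemma has_derivative_matrix_inv_smat:
  fixes x :: "real^('p::finite) uprod"
  assumes x: "invertible (smat x)"
  shows "((\<lambda>x. matrix_inv (smat x)) has_derivative
    (\<lambda>v. - (matrix_inv (smat x) ** smat v ** matrix_inv (smat x)))) (at x)"
proof -
  have "\<forall>k l. \<exists>D. ((\<lambda>x. matrix_inv (smat x) $ k $ l) has_derivative D) (at x)"
    using differentiable_matrix_inv_smat[OF x] by (simp add: differentiable_def)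
  then obtain D where D: "\<And>k l. ((\<lambda>x. matrix_inv (smat x) $ k $ l) has_derivative D k l) (at x)"
    by metis
  have smat': "((\<lambda>x. smat x $ i $ j) has_derivative (\<lambda>v. smat v $ i $ j)) (at x)" for i j
    by (auto intro!: bounded_linear_imp_has_derivative bounded_linear_vec_nth)
  let ?S = "{y. det (smat y) \<noteq> 0}"
  have oS: "open ?S"
    by (intro open_Collect_neq continuous_on_const differentiable_imp_continuous_on)
      (simp add: differentiable_on_def differentiable_det_smat)
  have xS: "x \<in> ?S" using x by (simp add: invertible_det_nz)
  define DM where "DM v = (\<chi> k l. D k l v)" for v
  have "smat v ** matrix_inv (smat x) + smat x ** DM v = 0" for v
  proof -
    have "(smat v ** matrix_inv (smat x) + smat x ** DM v) $ i $ k = 0" for i k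
    proof -
      have "((\<lambda>y. (smat y ** matrix_inv (smat y)) $ i $ k) has_derivative
        (\<lambda>v. \<Sum>j\<in>UNIV. smat x $ i $ j * D j k v + smat v $ i $ j * matrix_inv (smat x) $ j $ k)) (at x)"
        unfolding matrix_matrix_mult_def vec_lambda_beta
        by (intro has_derivative_sum has_derivative_mult smat' D)
      moreover have "((\<lambda>y. (mat 1 :: real^'p^'p) $ i $ k) has_derivative (\<lambda>v. 0)) (at x)" by simp
      then have "((\<lambda>y. (smat y ** matrix_inv (smat y)) $ i $ k) has_derivative (\<lambda>v. 0)) (at x)"
        by (rule has_derivative_transform_within_open[OF _ oS xS])
          (simp add: matrix_inv_cancel invertible_det_nz)
      ultimately have "(\<lambda>v. \<Sum>j\<in>UNIV. smat x $ i $ j * D j k v + smat v $ i $ j * matrix_inv (smat x) $ j $ k) = (\<lambda>v. 0)"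
        by (rule has_derivative_unique)
      from fun_cong[OF this, of v] show ?thesis
        by (simp add: matrix_matrix_mult_def DM_def sum.distrib)
    qed
    then show ?thesis by (simp add: vec_eq_iff)
  qed
  then have "smat x ** DM v = - (smat v ** matrix_inv (smat x))" for v
    by (simp add: add_eq_0_iff)
  then have "matrix_inv (smat x) ** (smat x ** DM v) = matrix_inv (smat x) ** - (smat v ** matrix_inv (smat x))" for v
    by simp
  moreover have "A ** - B = - (A ** B)" for A B :: "real^'p^'p"
    by (simp add: matrix_matrix_mult_def vec_eq_iff sum_negf)
  ultimately have DM: "DM v = - (matrix_inv (smat x) ** smat v ** matrix_inv (smat x))" for v
    by (simp add: matrix_inv_cancel[OF x] matrix_mul_assoc)
  show ?thesis unfolding DM[symmetric]
    by (intro has_derivative_vecI) (simp add: DM_def D)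
qed

lemma linear_trace_smat: "linear (\<lambda>v. trace (A ** smat v))"
  by (rule linearI) (simp_all add: trace_def matrix_matrix_mult_def sum.distrib sum_distrib_left algebra_simps)

text \<open>By the inequality between log-determinant and trace, the function
  \<open>trace (A\<inverse> ** X) - ln (det X)\<close> has its minimum at \<open>X = A\<close>; this identifies the derivative
  of the log-determinant without expanding the determinant.\<close>
lemma has_derivative_ln_det_smat:
  fixes x :: "real^('p::finite) uprod"
  assumes x: "x \<in> pd_cone"
  shows "((\<lambda>x. ln (det (smat x))) has_derivative (\<lambda>v. trace (matrix_inv (smat x) ** smat v))) (at x)"
proof -
  have pos: "det (smat x) > 0" by (rule pd_cone_det_pos[OF x])
  obtain D0 where "((\<lambda>x. det (smat x)) has_derivative D0) (at x)"
    using differentiable_det_smat by (auto simp: differentiable_def)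
  then obtain D where D: "((\<lambda>x. ln (det (smat x))) has_derivative D) (at x)"
    using has_derivative_ln[of "\<lambda>x. det (smat x)"] pos by blast
  let ?t = "\<lambda>v. trace (matrix_inv (smat x) ** smat v)"
  have t: "(?t has_derivative ?t) (at x)"
    by (intro bounded_linear_imp_has_derivative linear_conv_bounded_linear[THEN iffD1] linear_trace_smat)
  let ?g = "\<lambda>y. ln (det (smat y)) - ?t y"
  have "(?g has_derivative (\<lambda>v. D v - ?t v)) (at x)"
    by (intro has_derivative_diff D t)
  moreover have "\<forall>y\<in>pd_cone. ?g y \<le> ?g x"
  proof
    fix y :: "real^'p uprod" assume y: "y \<in> pd_cone"
    have ix: "invertible (smat x)" by (rule pd_cone_invertible[OF x])
    have px: "posdef (matrix_inv (smat x))" using x by (simp add: pd_cone_def posdef_matrix_inv)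
    have "ln (det (matrix_inv (smat x))) + ln (det (smat y)) - ?t y \<le> - real CARD('p)"
      using posdef_pair_ln_det_le_trace(1)[OF px] y by (simp add: pd_cone_def)
    moreover have "ln (det (matrix_inv (smat x))) = - ln (det (smat x))"
      using pos by (simp add: det_matrix_inv[OF ix] ln_div)
    moreover have "?t x = real CARD('p)" by (simp add: matrix_inv_cancel[OF ix] trace_I)
    ultimately show "?g y \<le> ?g x" by simp
  qed
  ultimately have "(\<lambda>v. D v - ?t v) = (\<lambda>v. 0)"
    using differential_zero_maxmin[OF x open_pd_cone] by blast
  then have "D = ?t" by (simp add: fun_eq_iff)
  then show ?thesis using D by simp
qed

section \<open>Mixed coordinates and the completion\<close>

definition vinv :: "real^('p::finite) uprod \<Rightarrow> real^'p uprod" where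
  "vinv x = svec (matrix_inv (smat x))"

lemma smat_vinv: "invertible (smat x) \<Longrightarrow> smat (vinv x) = matrix_inv (smat x)"
  unfolding vinv_def by (rule smat_svec) (simp add: transpose_matrix_inv)

lemma vinv_pd_cone: "x \<in> pd_cone \<Longrightarrow> vinv x \<in> pd_cone"
  using posdef_matrix_inv by (auto simp: pd_cone_def smat_vinv posdef_invertible)

lemma vinv_vinv: "x \<in> pd_cone \<Longrightarrow> vinv (vinv x) = x"
proof -
  assume x: "x \<in> pd_cone"
  then have "smat (vinv (vinv x)) = smat x"
    by (simp add: smat_vinv pd_cone_invertible invertible_matrix_inv matrix_inv_matrix_inv)
  then show "vinv (vinv x) = x" by simp
qed

lemma continuous_on_vinv: "continuous_on pd_cone vinv"
proof -
  have "continuous_on pd_cone (\<lambda>x. matrix_inv (smat x))"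
    using has_derivative_continuous[OF has_derivative_matrix_inv_smat[OF pd_cone_invertible]]
    by (auto simp: continuous_on_eq_continuous_at open_pd_cone)
  moreover have "continuous_on UNIV svec"
    by (intro linear_continuous_on linear_conv_bounded_linear[THEN iffD1] linear_svec)
  ultimately show ?thesis unfolding vinv_def
    using continuous_on_compose2[of UNIV svec] by blast
qed

definition off :: "('p::finite) uprod set \<Rightarrow> real^'p uprod \<Rightarrow> real^'p uprod" where
  "off E x = (\<chi> e. if e \<in> E then 0 else x $ e)"

text \<open>The mixed parametrization of the normal family: covariances outside \<open>E\<close>,
  concentrations on \<open>E\<close>. The completion of \<open>x\<close> is the matrix whose mixed
  coordinates are those of \<open>x\<close> outside \<open>E\<close> and zero on
  \<open>E\<close>.\<close>

definition mixed_coords :: "('p::finite) uprod set \<Rightarrow> real^'p uprod \<Rightarrow> real^'p uprod" where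
  "mixed_coords E x = (\<chi> e. if e \<in> E then vinv x $ e else x $ e)"

text \<open>The trace expands to \<open>2 p - trace (X Y^-1) - trace (Y X^-1)\<close>. The
  inequality for the pairs \<open>X, Y^-1\<close> and \<open>Y, X^-1\<close> bounds the sum of these
  two traces from below by \<open>2 p\<close>, so a vanishing trace forces equality in both.\<close>

lemma trace_mult_vinv_eq:
  fixes x y :: "real^('p::finite) uprod"
  assumes x: "x \<in> pd_cone" and y: "y \<in> pd_cone"
    and 0: "trace (smat (x - y) ** smat (vinv x - vinv y)) = 0"
  shows "x = y"
proof -
  have ix: "invertible (smat x)" and iy: "invertible (smat y)" by (simp_all add: pd_cone_invertible x y)
  let ?X = "smat x" and ?Y = "smat y"
  have e: "(A - B) ** (C - D) = A ** C + B ** D - (A ** D + B ** C)" for A B C D :: "real^'p^'p"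
    by (simp add: matrix_matrix_mult_def vec_eq_iff algebra_simps sum.distrib sum_subtractf)
  have t: "trace (?X ** matrix_inv ?Y) + trace (?Y ** matrix_inv ?X) = 2 * real CARD('p)"
    using 0 unfolding smat_diff smat_vinv[OF ix] smat_vinv[OF iy] e trace_sub trace_add
      matrix_inv_cancel[OF ix] matrix_inv_cancel[OF iy] trace_I by simp
  have px: "posdef ?X" "posdef (matrix_inv ?X)" and py: "posdef ?Y" "posdef (matrix_inv ?Y)"
    using x y by (simp_all add: pd_cone_def posdef_matrix_inv)
  have l: "ln (det (matrix_inv ?X)) = - ln (det ?X)" "ln (det (matrix_inv ?Y)) = - ln (det ?Y)"
    using posdef_det_pos[OF px(1)] posdef_det_pos[OF py(1)] by (simp_all add: det_matrix_inv ix iy ln_div)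
  have "ln (det ?X) + ln (det (matrix_inv ?Y)) - trace (?X ** matrix_inv ?Y) = - real CARD('p)"
    using posdef_pair_ln_det_le_trace(1)[OF px(1) py(2)] posdef_pair_ln_det_le_trace(1)[OF py(1) px(2)] t l by linarith
  then have "?X = matrix_inv (matrix_inv ?Y)" by (rule posdef_pair_ln_det_le_trace(2)[OF px(1) py(2)])
  then show ?thesis by (simp add: matrix_inv_matrix_inv iy)
qed

text \<open>If the mixed coordinates agree, \<open>x - y\<close> is supported on \<open>E\<close>
  and \<open>vinv x - vinv y\<close> outside \<open>E\<close>, so the trace form of the two vanishes
  term by term.\<close>

lemma inj_on_mixed_coords: "inj_on (mixed_coords E) pd_cone"
proof (rule inj_onI)
  fix x y assume x: "x \<in> pd_cone" and y: "y \<in> pd_cone" and eq: "mixed_coords E x = mixed_coords E y"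
  have "(x - y) $ e * (vinv x - vinv y) $ e = 0" for e
    using arg_cong[OF eq, of "\<lambda>v. v $ e"] by (cases "e \<in> E") (simp_all add: mixed_coords_def)
  then have "trace (smat (x - y) ** smat (vinv x - vinv y)) = 0"
    by (simp only: trace_smat_mult) simp
  then show "x = y" by (rule trace_mult_vinv_eq[OF x y])
qed

lemma continuous_on_mixed_coords: "continuous_on pd_cone (mixed_coords E)"
  unfolding mixed_coords_def
proof (intro continuous_on_vec_lambda)
  fix e show "continuous_on pd_cone (\<lambda>x. if e \<in> E then vinv x $ e else x $ e)"
    by (cases "e \<in> E") (auto intro!: continuous_intros continuous_on_vinv)
qed

lemma psd_det_pos_imp_pd_cone:
  assumes psd: "\<And>u. 0 \<le> u \<bullet> (smat x *v u)" and d: "det (smat x) > 0"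
  shows "x \<in> pd_cone"
proof -
  obtain Q c where Q: "orthogonal_matrix Q" and e: "smat x = Q ** diag_mat c ** transpose Q"
    using symmetric_spectral[OF transpose_smat] by metis
  have "c $ i \<ge> 0" for i
  proof -
    let ?u = "Q *v axis i 1"
    have "?u \<bullet> (smat x *v ?u) = axis i 1 \<bullet> (transpose Q *v (smat x *v ?u))"
      using inner_matrix_vector[of "axis i 1" "transpose Q" "smat x *v ?u"]
      by (simp only: transpose_transpose)
    also have "\<dots> = axis i 1 \<bullet> ((transpose Q ** Q) ** diag_mat c ** (transpose Q ** Q) *v axis i 1)"
      unfolding e by (simp only: matrix_vector_mul_assoc matrix_mul_assoc)
    also have "\<dots> = c $ i"
      by (simp add: orthogonal_matrix_cancel[OF Q] diag_mat_vec inner_axis')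
    finally show ?thesis using psd[of ?u] by simp
  qed
  moreover have "(\<Prod>i\<in>UNIV. c $ i) > 0" using d unfolding e det_orthogonal_conj[OF Q] det_diag_mat .
  then have "c $ i \<noteq> 0" for i by (metis finite iso_tuple_UNIV_I less_irrefl prod_zero_iff)
  ultimately have "posdef (diag_mat c)" by (simp add: posdef_diag_mat less_le)
  then show ?thesis unfolding pd_cone_def mem_Collect_eq e by (rule posdef_congruence[OF _ invertible_orthogonal[OF Q]])
qed

lemma quadratic_axis_pair:
  assumes "i \<noteq> j"
  shows "(axis i 1 + c *\<^sub>R axis j 1) \<bullet> (smat x *v (axis i 1 + c *\<^sub>R axis j 1))
    = x $ Upair i i + 2 * c * x $ Upair i j + c\<^sup>2 * x $ Upair j j"
proof -
  have a: "axis k 1 \<bullet> (smat x *v axis l 1) = x $ Upair k l" for k l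
    by (simp add: inner_axis' matrix_vector_mul_component inner_axis row_def)
  show ?thesis
    by (simp add: matrix_vector_right_distrib matrix_vector_mult_scaleR inner_add_left inner_add_right a
        power2_eq_square algebra_simps Upair_commute[of j i])
qed

text \<open>The quadratic form is nonnegative at the sum and at the difference of two basis vectors.
  Bounding entries by the diagonal gives compactness as soon as the diagonal is bounded.\<close>

lemma psd_entry_bound:
  assumes psd: "\<And>u. 0 \<le> u \<bullet> (smat x *v u)"
  shows "2 * \<bar>x $ Upair i j\<bar> \<le> x $ Upair i i + x $ Upair j j"
proof (cases "i = j")
  case True
  have "0 \<le> axis i 1 \<bullet> (smat x *v axis i 1)" by (rule psd)
  then have "0 \<le> x $ Upair i i"
    by (simp add: inner_axis' matrix_vector_mul_component inner_axis row_def)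
  then show ?thesis using True by simp
next
  case False
  show ?thesis
    using psd[of "axis i 1 + 1 *\<^sub>R axis j 1"] psd[of "axis i 1 + (-1) *\<^sub>R axis j 1"]
    unfolding quadratic_axis_pair[OF False] by (simp add: abs_le_iff)
qed

text \<open>The completion is the maximizer of the determinant over the compact set of positive
  semidefinite matrices agreeing with \<open>x\<close> outside \<open>E\<close>.\<close>
lemma pd_completion_exists:
  fixes x :: "real^('p::finite) uprod"
  assumes E: "\<forall>e\<in>E. proper_uprod e" and x: "x \<in> pd_cone"
  shows "off E x \<in> mixed_coords E ` pd_cone"
proof -
  define K where "K = {z. (\<forall>u. 0 \<le> u \<bullet> (smat z *v u)) \<and> (\<forall>e. e \<notin> E \<longrightarrow> z $ e = x $ e)}"
  \<comment> \<open>\<open>E\<close> contains only pairs of distinct indices, so the diagonal of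
    every matrix in \<open>K\<close> is that of \<open>x\<close>; this bounds
    \<open>K\<close>.\<close>
  have diag: "Upair i i \<notin> E" for i using E by (metis proper_uprod_simps)
  have "closed K"
    unfolding K_def
    by (intro closed_Collect_conj closed_Collect_all closed_Collect_imp closed_Collect_le closed_Collect_eq continuous_on_const open_Collect_const)
      (auto simp: inner_vec_def matrix_vector_mult_def intro!: continuous_intros)
  moreover have "bounded K"
  proof -
    define b where "b = (\<Sum>i\<in>UNIV. \<bar>x $ Upair i i\<bar>)"
    have bi: "\<bar>x $ Upair i i\<bar> \<le> b" for i unfolding b_def by (rule member_le_sum) auto
    have "\<bar>z $ e\<bar> \<le> b" if z: "z \<in> K" for z e
    proof (cases e)
      case (Upair i j)
      have "2 * \<bar>z $ Upair i j\<bar> \<le> z $ Upair i i + z $ Upair j j"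
        using z by (intro psd_entry_bound) (auto simp: K_def)
      also have "\<dots> = x $ Upair i i + x $ Upair j j" using z diag by (simp add: K_def)
      finally show ?thesis using bi[of i] bi[of j] Upair by simp
    qed
    then have "K \<subseteq> cbox (\<chi> e. - b) (\<chi> e. b)" by (auto simp: mem_box_cart abs_le_iff) (smt (verit))
    then show ?thesis using bounded_cbox bounded_subset by blast
  qed
  ultimately have "compact K" by (simp add: compact_eq_bounded_closed)
  moreover have xK: "x \<in> K" using x by (auto simp: K_def pd_cone_def posdef_def) (metis inner_zero_left less_imp_le order_refl)
  then have "K \<noteq> {}" by blast
  moreover have "continuous_on K (\<lambda>z. det (smat z))"
    by (intro differentiable_imp_continuous_on) (simp add: differentiable_on_def differentiable_det_smat)
  ultimately obtain z where z: "z \<in> K" and zmax: "\<And>y. y \<in> K \<Longrightarrow> det (smat y) \<le> det (smat z)"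
    using continuous_attains_sup by metis
  have "det (smat z) > 0" using zmax[OF xK] pd_cone_det_pos[OF x] by simp
  then have zp: "z \<in> pd_cone" using z by (intro psd_det_pos_imp_pd_cone) (auto simp: K_def)
  have iz: "invertible (smat z)" by (rule pd_cone_invertible[OF zp])
  \<comment> \<open>For small \<open>s\<close>, changing the entry \<open>e\<close> of
    \<open>z\<close> by \<open>s\<close> stays in \<open>K\<close>. The derivative of the
    log-determinant in this direction is a positive multiple of \<open>vinv z $ e\<close> and
    vanishes at the maximizer.\<close>
  have "vinv z $ e = 0" if e: "e \<in> E" for e
  proof -
    let ?l = "\<lambda>s::real. z + s *\<^sub>R axis e 1"
    let ?S = "?l -` pd_cone"
    have "open ?S" by (intro open_vimage open_pd_cone continuous_intros)
    have l': "(?l has_derivative (\<lambda>s. s *\<^sub>R axis e 1)) (at 0)" by (auto intro!: derivative_eq_intros)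
    have "((\<lambda>s. ln (det (smat (?l s)))) has_derivative (\<lambda>s. trace (matrix_inv (smat z) ** smat (s *\<^sub>R axis e 1)))) (at 0)"
      using has_derivative_compose[OF l', of "\<lambda>x. ln (det (smat x))"] has_derivative_ln_det_smat[OF zp] by simp
    moreover have "\<forall>s\<in>?S. ln (det (smat (?l s))) \<le> ln (det (smat (?l 0)))"
    proof
      fix s assume s: "s \<in> ?S"
      then have "?l s \<in> pd_cone" by simp
      moreover from this have "?l s \<in> K" using z e unfolding K_def pd_cone_def posdef_def
        by (auto simp: axis_def) (metis inner_zero_left less_imp_le order_refl)
      ultimately show "ln (det (smat (?l s))) \<le> ln (det (smat (?l 0)))"
        using zmax[of "?l s"] pd_cone_det_pos[of "?l s"] by (simp add: ln_mono)
    qed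
    ultimately have "(\<lambda>s. trace (matrix_inv (smat z) ** smat (s *\<^sub>R axis e 1))) = (\<lambda>s. 0)"
      using zp by (intro differential_zero_maxmin[OF _ \<open>open ?S\<close>]) auto
    from fun_cong[OF this, of 1] have "trace (smat (vinv z) ** smat (axis e 1)) = 0" by (simp add: smat_vinv iz)
    then show ?thesis using upair_weight_pos[of e] unfolding trace_smat_axis by simp
  qed
  then have "mixed_coords E z = off E x"
    using z by (auto simp: mixed_coords_def off_def K_def vec_eq_iff)
  then show ?thesis using zp by (metis image_eqI)
qed

text \<open>The value chosen when no completion exists still agrees with \<open>x\<close> outside
  \<open>E\<close> and depends only on \<open>off E x\<close>. Hence
  \<open>pd_completion_nth\<close> and \<open>pd_completion_cong\<close>, and with them the algebra
  of \<open>slide\<close>, hold for every \<open>x\<close>.\<close>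

definition pd_completion :: "('p::finite) uprod set \<Rightarrow> real^'p uprod \<Rightarrow> real^'p uprod" where
  "pd_completion E x = (if off E x \<in> mixed_coords E ` pd_cone
     then inv_into pd_cone (mixed_coords E) (off E x) else off E x)"

lemma pd_completion_cong: "off E x = off E y \<Longrightarrow> pd_completion E x = pd_completion E y"
  by (simp add: pd_completion_def)

lemma pd_completion_nth: "e \<notin> E \<Longrightarrow> pd_completion E x $ e = x $ e"
proof -
  assume e: "e \<notin> E"
  show ?thesis
  proof (cases "off E x \<in> mixed_coords E ` pd_cone")
    case True
    then have "mixed_coords E (pd_completion E x) $ e = off E x $ e"
      by (simp add: pd_completion_def f_inv_into_f)
    then show ?thesis using e by (simp add: mixed_coords_def off_def)
  next
    case False
    then show ?thesis using e by (simp add: pd_completion_def off_def)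
  qed
qed

lemma
  assumes E: "\<forall>e\<in>E. proper_uprod e" and x: "x \<in> pd_cone"
  shows pd_completion_pd_cone: "pd_completion E x \<in> pd_cone"
    and vinv_completion_nth: "e \<in> E \<Longrightarrow> vinv (pd_completion E x) $ e = 0"
proof -
  have *: "off E x \<in> mixed_coords E ` pd_cone" by (rule pd_completion_exists[OF E x])
  then show "pd_completion E x \<in> pd_cone" by (simp add: pd_completion_def inv_into_into)
  from * have "mixed_coords E (pd_completion E x) = off E x" by (simp add: pd_completion_def f_inv_into_f)
  then show "e \<in> E \<Longrightarrow> vinv (pd_completion E x) $ e = 0"
    by (auto simp: mixed_coords_def off_def vec_eq_iff dest: spec[of _ e])
qed

text \<open>\<open>mixed_coords E\<close> is continuous and injective on the open cone, between
  spaces of the same dimension; by invariance of domain its image is open and its inverse continuous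
  there. The completion is this inverse after the linear map \<open>off E\<close>.\<close>

lemma measurable_pd_completion [measurable]: "pd_completion E \<in> borel_measurable borel"
proof -
  let ?U = "mixed_coords E ` pd_cone"
  have "open ?U"
    by (rule invariance_of_domain_gen[OF open_pd_cone continuous_on_mixed_coords inj_on_mixed_coords]) simp
  have off: "off E \<in> borel_measurable borel"
    unfolding off_def
  proof (intro borel_measurable_continuous_onI continuous_on_vec_lambda)
    fix e show "continuous_on UNIV (\<lambda>x. if e \<in> E then 0 else x $ e)"
      by (cases "e \<in> E") (auto intro!: continuous_intros)
  qed
  have "continuous_on ?U (inv_into pd_cone (mixed_coords E))"
    by (rule continuous_on_inverse_open[OF open_pd_cone continuous_on_mixed_coords])
      (simp_all add: inj_on_mixed_coords)
  then have "(\<lambda>z. if z \<in> ?U then inv_into pd_cone (mixed_coords E) z else z) \<in> borel_measurable borel"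
    using \<open>open ?U\<close> by (intro borel_measurable_continuous_on_if continuous_on_id) auto
  from measurable_compose[OF off this] show ?thesis by (simp add: pd_completion_def[abs_def])
qed

subsection \<open>Linear changes of variables\<close>

lemma nn_integral_lborel_translate:
  fixes F :: "'a::euclidean_space \<Rightarrow> ennreal"
  assumes [measurable]: "F \<in> borel_measurable borel"
  shows "(\<integral>\<^sup>+x. F (a + x) \<partial>lborel) = (\<integral>\<^sup>+x. F x \<partial>lborel)"
  by (subst (2) lborel_distr_plus[of a, symmetric]) (simp add: nn_integral_distr)

lemma measurable_matrix_vector [measurable]: "(*v) A \<in> borel_measurable borel"
  for A :: "real^'n^'m"
  by (intro borel_measurable_continuous_onI linear_continuous_on linear_conv_bounded_linear[THEN iffD1]
      matrix_vector_mul_linear)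

lemma norm_orthogonal_matrix:
  fixes Q :: "real^'n^'n"
  assumes "orthogonal_matrix Q"
  shows "norm (Q *v x) = norm x"
  by (simp add: norm_eq inner_matrix_vector[of _ Q] matrix_vector_mul_assoc orthogonal_matrix_cancel[OF assms])

text \<open>The image of Lebesgue measure is translation invariant, hence a multiple of Lebesgue
  measure; the factor is read off on the unit ball, which is preserved.\<close>
lemma nn_integral_orthogonal:
  fixes Q :: "real^'n^'n" and F :: "real^'n \<Rightarrow> ennreal"
  assumes Q: "orthogonal_matrix Q" and F [measurable]: "F \<in> borel_measurable borel"
  shows "(\<integral>\<^sup>+x. F (Q *v x) \<partial>lborel) = (\<integral>\<^sup>+x. F x \<partial>lborel)"
proof -
  \<comment> \<open>As a function of \<open>y\<close>, \<open>?k (a - y)\<close> has integral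
    \<open>V\<close> for every \<open>a\<close>. Inserting it as a factor and exchanging the
    integrals carries out the uniqueness argument for translation invariant measures directly on
    \<open>F\<close>.\<close>
  let ?k = "\<lambda>x::real^'n. indicator {..1} (norm x) :: ennreal"
  define V where "V = emeasure lborel (cball (0::real^'n) 1)"
  have V: "V \<noteq> 0" "V \<noteq> \<infinity>"
    unfolding V_def using emeasure_lborel_cball_finite[of "0::real^'n" 1]
    by (auto simp: emeasure_cball ennreal_eq_0_iff)
      (metis less_le unit_ball_vol_pos of_nat_0_le_iff not_le)
  have kV: "(\<integral>\<^sup>+y. ?k (a - y) \<partial>lborel) = V" for a
  proof -
    have "(\<integral>\<^sup>+y. ?k (a - y) \<partial>lborel) = (\<integral>\<^sup>+y. indicator (cball a 1) y \<partial>lborel)"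
      by (intro nn_integral_cong) (simp add: indicator_def dist_norm norm_minus_commute)
    then show ?thesis by (simp add: V_def emeasure_cball)
  qed
  have "V * (\<integral>\<^sup>+x. F (Q *v x) \<partial>lborel) = (\<integral>\<^sup>+x. F (Q *v x) * (\<integral>\<^sup>+y. ?k (Q *v x - y) \<partial>lborel) \<partial>lborel)"
    unfolding kV by (simp add: nn_integral_cmult[symmetric] mult.commute)
  also have "\<dots> = (\<integral>\<^sup>+x. (\<integral>\<^sup>+y. F (Q *v x) * ?k (Q *v x - y) \<partial>lborel) \<partial>lborel)"
    by (intro nn_integral_cong nn_integral_cmult[symmetric]) measurable
  also have "\<dots> = (\<integral>\<^sup>+y. (\<integral>\<^sup>+x. F (Q *v x) * ?k (Q *v x - y) \<partial>lborel) \<partial>lborel)"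
    by (rule lborel_pair.Fubini') measurable
  also have "\<dots> = (\<integral>\<^sup>+y. (\<integral>\<^sup>+x. F (y + Q *v x) * ?k (Q *v x) \<partial>lborel) \<partial>lborel)"
  proof (rule nn_integral_cong)
    fix y
    have "(\<integral>\<^sup>+x. F (Q *v x) * ?k (Q *v x - y) \<partial>lborel) = 
       (\<integral>\<^sup>+x. F (Q *v (transpose Q *v y + x)) * ?k (Q *v (transpose Q *v y + x) - y) \<partial>lborel)"
      by (rule nn_integral_lborel_translate[symmetric]) measurable
    moreover have "Q *v (transpose Q *v y + x) = y + Q *v x" for x
      by (simp add: matrix_vector_right_distrib matrix_vector_mul_assoc orthogonal_matrix_cancel[OF Q] del: transpose_matrix_vector)
    ultimately show "(\<integral>\<^sup>+x. F (Q *v x) * ?k (Q *v x - y) \<partial>lborel) = (\<integral>\<^sup>+x. F (y + Q *v x) * ?k (Q *v x) \<partial>lborel)"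
      by simp
  qed
  also have "\<dots> = (\<integral>\<^sup>+x. (\<integral>\<^sup>+y. F (y + Q *v x) * ?k (Q *v x) \<partial>lborel) \<partial>lborel)"
    by (rule lborel_pair.Fubini') measurable
  also have "\<dots> = (\<integral>\<^sup>+x. (\<integral>\<^sup>+y. F y \<partial>lborel) * ?k x \<partial>lborel)"
  proof (rule nn_integral_cong)
    fix x
    have "(\<integral>\<^sup>+y. F (y + Q *v x) * ?k (Q *v x) \<partial>lborel) = (\<integral>\<^sup>+y. F (Q *v x + y) \<partial>lborel) * ?k (Q *v x)"
      by (simp add: nn_integral_multc add.commute)
    also have "(\<integral>\<^sup>+y. F (Q *v x + y) \<partial>lborel) = (\<integral>\<^sup>+y. F y \<partial>lborel)"
      by (rule nn_integral_lborel_translate[OF F])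
    also have "?k (Q *v x) = ?k x" by (simp add: norm_orthogonal_matrix[OF Q])
    finally show "(\<integral>\<^sup>+y. F (y + Q *v x) * ?k (Q *v x) \<partial>lborel) = (\<integral>\<^sup>+y. F y \<partial>lborel) * ?k x"
      by (simp only: norm_orthogonal_matrix[OF Q])
  qed
  also have "\<dots> = (\<integral>\<^sup>+x. F x \<partial>lborel) * V"
    using kV[of 0] by (simp add: nn_integral_cmult)
  finally show ?thesis using V by (simp add: mult.commute ennreal_mult_cancel_left)
qed

lemma nn_integral_diag_mat:
  fixes d :: "real^'n" and F :: "real^'n \<Rightarrow> ennreal"
  assumes d: "\<And>i. d $ i \<noteq> 0" and F [measurable]: "F \<in> borel_measurable borel"
  shows "ennreal \<bar>det (diag_mat d)\<bar> * (\<integral>\<^sup>+x. F (diag_mat d *v x) \<partial>lborel) = (\<integral>\<^sup>+x. F x \<partial>lborel)"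
proof -
  define c where "c b = b \<bullet> d" for b :: "real^'n"
  have cb: "c (axis i 1) = d $ i" for i by (simp add: c_def inner_axis')
  have B: "(Basis :: (real^'n) set) = (\<lambda>i. axis i 1) ` UNIV" by (auto simp: Basis_vec_def)
  have inj: "inj (\<lambda>i::'n. axis i (1::real))" by (simp add: inj_def axis_eq_axis)
  have T: "0 + (\<Sum>j\<in>Basis. (c j * (x \<bullet> j)) *\<^sub>R j) = diag_mat d *v x" for x
  proof -
    have "(\<Sum>i\<in>UNIV. d $ i * x $ i * axis i 1 $ k) = (\<Sum>i\<in>UNIV. if i = k then d $ k * x $ k else 0)" for k
      by (intro sum.cong) (auto simp: axis_def)
    then show ?thesis
      unfolding B by (simp add: sum.reindex[OF inj] cb inner_axis vec_eq_iff diag_mat_vec)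
  qed
  have P: "(\<Prod>j\<in>Basis. \<bar>c j\<bar>) = \<bar>det (diag_mat d)\<bar>"
    unfolding B by (simp add: prod.reindex[OF inj] cb det_diag_mat abs_prod)
  have "lborel = density (distr lborel borel (\<lambda>x. diag_mat d *v x)) (\<lambda>_. ennreal \<bar>det (diag_mat d)\<bar>)"
    using lborel_affine_euclidean[of c 0] d unfolding T P by (force simp: B cb)
  then have "(\<integral>\<^sup>+x. F x \<partial>lborel) = (\<integral>\<^sup>+x. F x \<partial>density (distr lborel borel (\<lambda>x. diag_mat d *v x)) (\<lambda>_. ennreal \<bar>det (diag_mat d)\<bar>))"
    by metis
  also have "\<dots> = ennreal \<bar>det (diag_mat d)\<bar> * (\<integral>\<^sup>+x. F (diag_mat d *v x) \<partial>lborel)"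
    by (simp add: nn_integral_density nn_integral_distr nn_integral_cmult)
  finally show ?thesis by simp
qed

text \<open>In \<open>A = Q ** diag_mat d ** transpose Q ** R\<close> the orthogonal factors
  preserve Lebesgue measure, and the diagonal factor scales the coordinates separately.\<close>

lemma nn_integral_matrix:
  fixes A :: "real^'n^'n" and F :: "real^'n \<Rightarrow> ennreal"
  assumes A: "invertible A" and F [measurable]: "F \<in> borel_measurable borel"
  shows "ennreal \<bar>det A\<bar> * (\<integral>\<^sup>+x. F (A *v x) \<partial>lborel) = (\<integral>\<^sup>+x. F x \<partial>lborel)"
proof -
  obtain h R where h: "posdef h" and R: "orthogonal_matrix R" and gR: "A = h ** R"
    using polar_decomposition[OF A] by metis
  obtain Q d where Q: "orthogonal_matrix Q" and e: "h = Q ** diag_mat d ** transpose Q" and d: "\<And>i. d $ i > 0"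
    using posdef_spectral[OF h] by metis
  have dA: "\<bar>det A\<bar> = \<bar>det (diag_mat d)\<bar>"
  proof -
    have "det h = det (diag_mat d)" unfolding e det_orthogonal_conj[OF Q] ..
    then show ?thesis using det_orthogonal_matrix[OF R] by (auto simp: gR det_mul)
  qed
  have "(\<integral>\<^sup>+x. F (A *v x) \<partial>lborel) = (\<integral>\<^sup>+x. F (Q *v (diag_mat d *v (transpose Q *v (R *v x)))) \<partial>lborel)"
    by (simp only: gR e matrix_vector_mul_assoc matrix_mul_assoc)
  also have "\<dots> = (\<integral>\<^sup>+x. F (Q *v (diag_mat d *v (transpose Q *v x))) \<partial>lborel)"
    by (intro nn_integral_orthogonal[OF R, where F = "\<lambda>x. F (Q *v (diag_mat d *v (transpose Q *v x)))"]) measurable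
  also have "\<dots> = (\<integral>\<^sup>+x. F (Q *v (diag_mat d *v x)) \<partial>lborel)"
    by (intro nn_integral_orthogonal[OF orthogonal_transpose[OF Q], where F = "\<lambda>x. F (Q *v (diag_mat d *v x))"]) measurable
  finally have "(\<integral>\<^sup>+x. F (A *v x) \<partial>lborel) = (\<integral>\<^sup>+x. F (Q *v (diag_mat d *v x)) \<partial>lborel)" .
  moreover have "ennreal \<bar>det (diag_mat d)\<bar> * (\<integral>\<^sup>+x. F (Q *v (diag_mat d *v x)) \<partial>lborel) = (\<integral>\<^sup>+x. F (Q *v x) \<partial>lborel)"
    using d by (intro nn_integral_diag_mat[where F = "\<lambda>x. F (Q *v x)"]) (auto simp: less_imp_neq[THEN not_sym])
  moreover have "(\<integral>\<^sup>+x. F (Q *v x) \<partial>lborel) = (\<integral>\<^sup>+x. F x \<partial>lborel)"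
    by (rule nn_integral_orthogonal[OF Q F])
  ultimately show ?thesis by (simp add: dA)
qed

lemma nn_integral_linear_map:
  fixes f :: "real^'n \<Rightarrow> real^'n" and F :: "real^'n \<Rightarrow> ennreal"
  assumes f: "linear f" "det (matrix f) \<noteq> 0" and F: "F \<in> borel_measurable borel"
  shows "ennreal \<bar>det (matrix f)\<bar> * (\<integral>\<^sup>+x. F (f x) \<partial>lborel) = (\<integral>\<^sup>+x. F x \<partial>lborel)"
  using nn_integral_matrix[of "matrix f" F] f F by (simp add: matrix_works invertible_det_nz)

lemma nn_integral_congr:
  fixes g :: "real^'p^'p" and F :: "real^('p::finite) uprod \<Rightarrow> ennreal"
  assumes g: "invertible g" and F: "F \<in> borel_measurable borel"
  shows "ennreal (\<bar>det g\<bar> ^ (CARD('p) + 1)) * (\<integral>\<^sup>+x. F (congr g x) \<partial>lborel) = (\<integral>\<^sup>+x. F x \<partial>lborel)"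
proof -
  have "det g \<noteq> 0" using g by (simp add: invertible_det_nz)
  then have "det (matrix (congr g)) \<noteq> 0" using abs_det_congr[OF g] by (metis abs_zero power_not_zero abs_eq_0_iff)
  from nn_integral_linear_map[OF linear_congr this F] show ?thesis by (simp only: abs_det_congr[OF g])
qed

interpretation lborel_prod: product_sigma_finite "\<lambda>_::'i. lborel :: 'a::euclidean_space measure"
  by (rule product_sigma_finite.intro) (rule sigma_finite_lborel)

text \<open>The Jacobian enters as a scaling hypothesis on integrals, so that translations, linear
  maps and dilations of single coordinates are all covered. The two measures are compared on
  rectangles.\<close>

lemma nn_integral_PiM_map:
  fixes h :: "'i \<Rightarrow> 'a::euclidean_space \<Rightarrow> 'a" and F :: "('i \<Rightarrow> 'a) \<Rightarrow> ennreal"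
  assumes I: "finite I" 
    and h [measurable]: "\<And>i. i \<in> I \<Longrightarrow> h i \<in> borel_measurable borel"
    and scale: "\<And>i G. i \<in> I \<Longrightarrow> G \<in> borel_measurable borel \<Longrightarrow> 
      ennreal c * (\<integral>\<^sup>+x. G (h i x) \<partial>lborel) = (\<integral>\<^sup>+x. G x \<partial>lborel)"
    and F [measurable]: "F \<in> borel_measurable (PiM I (\<lambda>_. lborel))"
  shows "ennreal c ^ card I * (\<integral>\<^sup>+y. F (\<lambda>i\<in>I. h i (y i)) \<partial>PiM I (\<lambda>_. lborel)) = (\<integral>\<^sup>+y. F y \<partial>PiM I (\<lambda>_. lborel))"
proof -
  let ?T = "\<lambda>y. \<lambda>i\<in>I. h i (y i)"
  have T [measurable]: "?T \<in> measurable (PiM I (\<lambda>_. lborel)) (PiM I (\<lambda>_. lborel))"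
    by (rule measurable_restrict) measurable
  let ?P = "density (distr (PiM I (\<lambda>_. lborel)) (PiM I (\<lambda>_. lborel)) ?T) (\<lambda>_. ennreal c ^ card I)"
  have "?P = PiM I (\<lambda>_. lborel)"
  proof (rule lborel_prod.PiM_eqI[OF I])
    fix A :: "'i \<Rightarrow> 'a set" assume A: "\<And>i. i \<in> I \<Longrightarrow> A i \<in> sets lborel"
    have hA: "i \<in> I \<Longrightarrow> h i -` A i \<in> sets lborel" for i
      using measurable_sets[OF h[of i], of "A i"] A[of i] by simp
    have "Pi\<^sub>E I A \<in> sets (PiM I (\<lambda>_. lborel))" using A by (intro sets_PiM_I_finite I) auto
    then have "emeasure ?P (Pi\<^sub>E I A) = ennreal c ^ card I * emeasure (PiM I (\<lambda>_. lborel)) (?T -` (Pi\<^sub>E I A) \<inter> space (PiM I (\<lambda>_. lborel)))"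
      by (subst emeasure_density) (auto simp: nn_integral_cmult emeasure_distr)
    also have "?T -` (Pi\<^sub>E I A) \<inter> space (PiM I (\<lambda>_. lborel)) = Pi\<^sub>E I (\<lambda>i. h i -` A i)"
      by (auto simp: space_PiM PiE_iff)
    also have "emeasure (PiM I (\<lambda>_. lborel)) \<dots> = (\<Prod>i\<in>I. emeasure lborel (h i -` A i))"
      using hA by (intro lborel_prod.emeasure_PiM I) auto
    also have "ennreal c ^ card I * \<dots> = (\<Prod>i\<in>I. ennreal c * emeasure lborel (h i -` A i))"
      by (simp add: prod.distrib)
    also have "\<dots> = (\<Prod>i\<in>I. emeasure lborel (A i))"
    proof (rule prod.cong[OF refl])
      fix i assume i: "i \<in> I"
      have "ennreal c * (\<integral>\<^sup>+x. indicator (A i) (h i x) \<partial>lborel) = (\<integral>\<^sup>+x. indicator (A i) x \<partial>lborel)"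
        using A[OF i] by (intro scale i) simp
      moreover have "(\<lambda>x. indicator (A i) (h i x) :: ennreal) = indicator (h i -` A i)"
        by (auto simp: indicator_def)
      ultimately show "ennreal c * emeasure lborel (h i -` A i) = emeasure lborel (A i)"
        using hA[OF i] A[OF i] by simp
    qed
    finally show "emeasure ?P (Pi\<^sub>E I A) = (\<Prod>i\<in>I. emeasure lborel (A i))" .
  qed simp
  then have "(\<integral>\<^sup>+y. F y \<partial>PiM I (\<lambda>_. lborel)) = (\<integral>\<^sup>+y. F y \<partial>?P)" by simp
  also have "\<dots> = ennreal c ^ card I * (\<integral>\<^sup>+y. F (?T y) \<partial>PiM I (\<lambda>_. lborel))"
    by (simp add: nn_integral_density nn_integral_distr nn_integral_cmult)
  finally show ?thesis by simp
qed

text \<open>On each line in direction \<open>z\<close> the determinant is a nonzero polynomial in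
  \<open>s\<close>, so its zeros on the line are null. Integrating over \<open>s\<close> and
  exchanging the integrals, translation invariance yields the measure of the zero set times the
  infinite length of the line; as this is 0, the zero set is null.\<close>

lemma AE_PiM_det_nonzero:
  fixes M :: "('i \<Rightarrow> 'a::euclidean_space) \<Rightarrow> real^'n^'n"
  assumes I: "finite I"
    and M [measurable]: "(\<lambda>y. det (M y)) \<in> borel_measurable (PiM I (\<lambda>_. lborel))"
    and P: "\<And>y s i j. M (\<lambda>i\<in>I. s *\<^sub>R z i + y i) $ i $ j = poly (P y i j) s"
    and nz: "\<And>y. \<exists>s. det (M (\<lambda>i\<in>I. s *\<^sub>R z i + y i)) \<noteq> 0"
  shows "AE y in PiM I (\<lambda>_. lborel). det (M y) \<noteq> 0"
proof -
  let ?L = "PiM I (\<lambda>_. lborel) :: ('i \<Rightarrow> 'a) measure"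
  interpret L: sigma_finite_measure ?L by (rule lborel_prod.sigma_finite[OF I])
  interpret pair_sigma_finite "lborel :: real measure" ?L ..
  let ?Z = "\<lambda>y. indicator {0} (det (M y)) :: ennreal"
  let ?T = "\<lambda>s y. \<lambda>i\<in>I. s *\<^sub>R z i + y i"
  have T [measurable]: "(\<lambda>(s, y). ?T s y) \<in> measurable (lborel \<Otimes>\<^sub>M ?L) ?L"
    unfolding split_def by (rule measurable_restrict) measurable
  have inv: "(\<integral>\<^sup>+y. ?Z (?T s y) \<partial>?L) = (\<integral>\<^sup>+y. ?Z y \<partial>?L)" for s
  proof -
    have "ennreal 1 ^ card I * (\<integral>\<^sup>+y. ?Z (\<lambda>i\<in>I. s *\<^sub>R z i + y i) \<partial>?L) = (\<integral>\<^sup>+y. ?Z y \<partial>?L)"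
      by (rule nn_integral_PiM_map[OF I, where h = "\<lambda>i x. s *\<^sub>R z i + x"]) (simp_all add: nn_integral_lborel_translate)
    then show ?thesis by simp
  qed
  have "(\<integral>\<^sup>+s. ?Z (?T s y) \<partial>lborel) = 0" for y
  proof -
    define Q where "Q = det (\<chi> i j. P y i j)"
    have Q: "det (M (?T s y)) = poly Q s" for s
      unfolding Q_def det_def using P by (simp add: poly_sum poly_prod restrict_def)
    then have "Q \<noteq> 0" using nz[of y] by auto
    then have "finite {s. poly Q s = 0}" by (rule poly_roots_finite)
    then have "{s. poly Q s = 0} \<in> null_sets lborel" by (rule finite_imp_null_set_lborel)
    then have "AE s in lborel. poly Q s \<noteq> 0" by (rule AE_I') auto
    then have "(\<integral>\<^sup>+s. ?Z (?T s y) \<partial>lborel) = (\<integral>\<^sup>+s. 0 \<partial>(lborel :: real measure))"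
      by (intro nn_integral_cong_AE) (auto simp: Q)
    then show ?thesis by simp
  qed
  then have "(\<integral>\<^sup>+y. (\<integral>\<^sup>+s. ?Z (?T s y) \<partial>lborel) \<partial>?L) = 0" by simp
  also have "(\<integral>\<^sup>+y. (\<integral>\<^sup>+s. ?Z (?T s y) \<partial>lborel) \<partial>?L) = (\<integral>\<^sup>+s. (\<integral>\<^sup>+y. ?Z (?T s y) \<partial>?L) \<partial>lborel)"
    by (rule Fubini') measurable
  finally have "(\<integral>\<^sup>+y. ?Z y \<partial>?L) * emeasure lborel (UNIV :: real set) = 0" by (simp add: inv)
  then have "(\<integral>\<^sup>+y. ?Z y \<partial>?L) = 0" by simp
  then have "AE y in ?L. ?Z y = 0" by (subst (asm) nn_integral_0_iff_AE) measurable
  then show ?thesis by eventually_elim (auto simp: indicator_def split: if_splits)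
qed

subsection \<open>Invariant measures on the cone of positive definite matrices\<close>

lemma borel_measurable_vecI:
  fixes f :: "'b \<Rightarrow> 'a::euclidean_space^'n"
  assumes "\<And>i. (\<lambda>x. f x $ i) \<in> borel_measurable M"
  shows "f \<in> borel_measurable M"
proof (subst borel_measurable_euclidean_space, intro ballI)
  fix b :: "'a^'n" assume "b \<in> Basis"
  then obtain i u where b: "b = axis i u" by (auto simp: Basis_vec_def)
  show "(\<lambda>x. f x \<bullet> b) \<in> borel_measurable M"
    unfolding b inner_axis using assms[of i] by measurable
qed

lemma borel_measurable_vec_nth [measurable (raw)]:
  fixes f :: "'b \<Rightarrow> 'a::euclidean_space^'n"
  assumes "f \<in> borel_measurable M"
  shows "(\<lambda>x. f x $ i) \<in> borel_measurable M"
  by (rule measurable_compose[OF assms borel_measurable_continuous_onI]) (intro continuous_intros)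

lemma borel_measurable_det:
  fixes A :: "'b \<Rightarrow> real^'n^'n"
  assumes [measurable]: "\<And>i j. (\<lambda>x. A x $ i $ j) \<in> borel_measurable M"
  shows "(\<lambda>x. det (A x)) \<in> borel_measurable M"
  unfolding det_def by measurable

lemma measurable_det_smat [measurable (raw)]:
  assumes [measurable]: "f \<in> borel_measurable M"
  shows "(\<lambda>x. det (smat (f x))) \<in> borel_measurable M"
  by (rule borel_measurable_det) simp

lemma pd_cone_borel [measurable]: "pd_cone \<in> sets borel"
  using open_pd_cone by (rule borel_open)

lemma congr_nth: "congr g x $ Upair i j = (\<Sum>l\<in>UNIV. (\<Sum>k\<in>UNIV. g $ i $ k * x $ Upair k l) * g $ j $ l)"
proof -
  have "congr g x $ Upair i j = smat (congr g x) $ i $ j" by simp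
  also have "\<dots> = (\<Sum>l\<in>UNIV. (\<Sum>k\<in>UNIV. g $ i $ k * x $ Upair k l) * g $ j $ l)"
    unfolding smat_congr by (simp add: matrix_matrix_mult_def transpose_def)
  finally show ?thesis .
qed

lemma borel_measurable_congr:
  fixes G :: "'b \<Rightarrow> real^'p^('p::finite)"
  assumes [measurable]: "\<And>i j. (\<lambda>y. G y $ i $ j) \<in> borel_measurable M" "X \<in> borel_measurable M"
  shows "(\<lambda>y. congr (G y) (X y)) \<in> borel_measurable M"
proof (rule borel_measurable_vecI)
  fix e show "(\<lambda>y. congr (G y) (X y) $ e) \<in> borel_measurable M"
    by (cases e) (simp add: congr_nth)
qed

lemma congr_pd_cone: "x \<in> pd_cone \<Longrightarrow> invertible g \<Longrightarrow> congr g x \<in> pd_cone"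
  by (simp add: pd_cone_def smat_congr posdef_congruence)

lemma det_congr: "det (smat (congr g x)) = (det g)\<^sup>2 * det (smat x)"
  by (simp add: smat_congr det_mul power2_eq_square)

lemma congr_pd_cone_iff:
  "x \<in> pd_cone \<Longrightarrow> congr g x \<in> pd_cone \<longleftrightarrow> invertible g"
  using congr_pd_cone pd_cone_det_pos[of "congr g x"] by (auto simp: det_congr invertible_det_nz)

lemma vinv_congr:
  assumes g: "invertible g" and x: "x \<in> pd_cone"
  shows "vinv (congr g x) = congr (transpose (matrix_inv g)) (vinv x)"
proof -
  have i: "invertible (smat x)" "invertible (smat (congr g x))"
    using g x congr_pd_cone pd_cone_invertible by blast+
  have tg: "transpose (matrix_inv g) = matrix_inv (transpose g)" by (rule transpose_matrix_inv[OF g])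
  have "smat (congr g x) ** smat (congr (transpose (matrix_inv g)) (vinv x)) = mat 1"
    unfolding smat_congr smat_vinv[OF i(1)] transpose_transpose unfolding tg
    by (simp add: matrix_mul_assoc[symmetric] matrix_inv_cancel[OF g] matrix_inv_cancel[OF i(1)]
        matrix_inv_cancel[OF transpose_invertible[OF g]])
  then have "matrix_inv (smat (congr g x)) = smat (congr (transpose (matrix_inv g)) (vinv x))"
    by (rule matrix_inv_eqI)
  then show ?thesis by (simp add: vinv_def)
qed

definition gram :: "('p \<Rightarrow> real^'p) \<Rightarrow> real^('p::finite) uprod" where
  "gram \<gamma> = congr (vec_lambda \<gamma>) (svec (mat 1))"

text \<open>Matrices as families of rows: Lebesgue measure is then a product measure, on which right
  multiplication acts row by row.\<close>

abbreviation row_space :: "('p::finite \<Rightarrow> real^'p) measure" where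
  "row_space \<equiv> PiM UNIV (\<lambda>_. lborel)"

lemma measurable_row_entry [measurable]:
  "(\<lambda>\<gamma>. vec_lambda \<gamma> $ i $ j) \<in> borel_measurable (row_space :: ('p::finite \<Rightarrow> real^'p) measure)"
  by simp

lemma smat_mat1: "smat (svec (mat 1)) = mat 1"
  by (simp add: smat_svec transpose_mat)

lemma one_pd_cone: "svec (mat 1) \<in> pd_cone"
  by (simp add: pd_cone_def smat_mat1 posdef_mat1)

lemma measurable_gram [measurable]: "gram \<in> borel_measurable row_space"
  unfolding gram_def by (intro borel_measurable_congr) simp_all

lemma gram_diag: "gram \<gamma> $ Upair i i = (norm (\<gamma> i))\<^sup>2"
proof -
  have "gram \<gamma> $ Upair i i = smat (gram \<gamma>) $ i $ i" by simp
  also have "\<dots> = (\<Sum>k\<in>UNIV. \<gamma> i $ k * \<gamma> i $ k)"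
    unfolding gram_def smat_congr smat_mat1 matrix_mul_rid
    by (simp add: matrix_matrix_mult_def transpose_def)
  finally show ?thesis by (simp add: dot_square_norm[symmetric] inner_vec_def)
qed

lemma gram_pd_cone_iff: "gram \<gamma> \<in> pd_cone \<longleftrightarrow> det (vec_lambda \<gamma>) \<noteq> 0"
  unfolding gram_def by (simp add: congr_pd_cone_iff[OF one_pd_cone] invertible_det_nz)

lemma vec_lambda_right_mult:
  "vec_lambda (\<lambda>i. transpose h *v \<gamma> i) = vec_lambda \<gamma> ** h" for h :: "real^'p^'p"
  by (simp add: vec_eq_iff matrix_matrix_mult_def matrix_vector_mult_def transpose_def mult.commute)

lemma nn_integral_row_space_right_mult:
  fixes h :: "real^'p^'p::finite"
  assumes h: "invertible h" and F: "F \<in> borel_measurable row_space"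
  shows "ennreal (\<bar>det h\<bar> ^ CARD('p)) * (\<integral>\<^sup>+\<gamma>. F (\<lambda>i. transpose h *v \<gamma> i) \<partial>row_space) = (\<integral>\<^sup>+\<gamma>. F \<gamma> \<partial>row_space)"
proof -
  have "ennreal \<bar>det h\<bar> ^ card (UNIV::'p set) * (\<integral>\<^sup>+\<gamma>. F (\<lambda>i\<in>UNIV. transpose h *v \<gamma> i) \<partial>row_space) = (\<integral>\<^sup>+\<gamma>. F \<gamma> \<partial>row_space)"
  proof (rule nn_integral_PiM_map[OF finite, where h = "\<lambda>i x. transpose h *v x"])
    show "(*v) (transpose h) \<in> borel_measurable borel" by (rule measurable_matrix_vector)
    show "ennreal \<bar>det h\<bar> * (\<integral>\<^sup>+x. G (transpose h *v x) \<partial>lborel) = integral\<^sup>N lborel G"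
      if "G \<in> borel_measurable borel" for G
      using nn_integral_matrix[OF transpose_invertible[OF h] that] by (simp only: det_transpose)
  qed (rule F)
  then show ?thesis by (simp add: ennreal_power restrict_UNIV)
qed

text \<open>A cut-off set of positive finite measure in two senses: for \<open>gram \<gamma>\<close>
  the condition says, up to null sets, that all rows lie in the unit ball, and in the cone it
  describes a bounded set with interior points.\<close>

definition diag_le1 :: "(real^('p::finite) uprod) set" where
  "diag_le1 = {x \<in> pd_cone. \<forall>i. x $ Upair i i \<le> 1}"

lemma diag_le1_borel [measurable]: "diag_le1 \<in> sets borel"
proof -
  have "{x \<in> space borel. x \<in> pd_cone \<and> (\<forall>i. x $ Upair i i \<le> 1)} \<in> sets borel"
    by measurable
  then show ?thesis by (simp add: diag_le1_def)
qed

lemma AE_row_space_det: "AE \<gamma> in row_space. det (vec_lambda \<gamma> :: real^'p^'p::finite) \<noteq> 0"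
proof (rule AE_PiM_det_nonzero[where z = "\<lambda>i. axis i 1"])
  show "(\<lambda>\<gamma>. det (vec_lambda \<gamma> :: real^'p^'p)) \<in> borel_measurable row_space"
    by (intro borel_measurable_det) simp
  show "(vec_lambda (\<lambda>i\<in>UNIV. s *\<^sub>R axis i 1 + \<gamma> i) :: real^'p^'p) $ i $ j = 
      poly [:\<gamma> i $ j, if i = j then 1 else 0:] s" for \<gamma> s i j
    by (simp add: axis_def)
  fix \<gamma> :: "'p \<Rightarrow> real^'p"
  \<comment> \<open>\<open>r\<close> stands for \<open>1 / s\<close>: the determinant of
    \<open>I + r \<gamma>\<close> is continuous in \<open>r\<close> and equals 1 at 0, so the matrix
    \<open>s I + \<gamma>\<close> is invertible for large \<open>s\<close>.\<close>
  let ?f = "\<lambda>r::real. det ((\<chi> i. axis i 1 + r *\<^sub>R \<gamma> i) :: real^'p^'p)"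
  have "continuous (at 0) ?f"
    unfolding det_def by (simp, intro continuous_intros)
  then have "(?f \<longlongrightarrow> ?f 0) (at 0)" by (simp add: continuous_at)
  moreover have "(\<chi> i. axis i 1 + 0 *\<^sub>R \<gamma> i) = (mat 1 :: real^'p^'p)" by (simp add: vec_eq_iff mat_def axis_def)
  then have "?f 0 \<noteq> 0" by simp
  ultimately have "eventually (\<lambda>r. ?f r \<noteq> 0) (at 0)" by (rule tendsto_imp_eventually_ne)
  then have "eventually (\<lambda>r. ?f r \<noteq> 0 \<and> r \<noteq> 0) (at 0)"
    by (intro eventually_conj) (auto simp: eventually_at_filter)
  then obtain r where r: "?f r \<noteq> 0" "r \<noteq> 0" 
    using eventually_happens trivial_limit_at by blast
  have "(\<chi> i. axis i 1 + r *\<^sub>R \<gamma> i) = (\<chi> i. r *\<^sub>R (vec_lambda (\<lambda>i\<in>UNIV. (1 / r) *\<^sub>R axis i 1 + \<gamma> i) $ i))"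
    using r by (simp add: vec_eq_iff algebra_simps restrict_def)
  then have "?f r = det (\<chi> i. r *\<^sub>R (vec_lambda (\<lambda>i\<in>UNIV. (1 / r) *\<^sub>R axis i 1 + \<gamma> i) $ i))" by simp
  also have "\<dots> = r ^ CARD('p) * det (vec_lambda (\<lambda>i\<in>UNIV. (1 / r) *\<^sub>R axis i 1 + \<gamma> i) :: real^'p^'p)"
    using det_rows_mul[of "\<lambda>_. r" "\<lambda>i. vec_lambda (\<lambda>i\<in>UNIV. (1 / r) *\<^sub>R axis i 1 + \<gamma> i) $ i"]
    by (simp add: scalar_mult_eq_scaleR restrict_def)
  finally show "\<exists>s. det (vec_lambda (\<lambda>i\<in>UNIV. s *\<^sub>R axis i 1 + \<gamma> i) :: real^'p^'p) \<noteq> 0" using r by fastforce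
qed simp

lemma nn_integral_gram_diag_le1:
  "(\<integral>\<^sup>+\<gamma>. indicator diag_le1 (gram \<gamma>) \<partial>(row_space :: ('p::finite \<Rightarrow> real^'p) measure)) \<noteq> 0"
  "(\<integral>\<^sup>+\<gamma>. indicator diag_le1 (gram \<gamma>) \<partial>(row_space :: ('p::finite \<Rightarrow> real^'p) measure)) \<noteq> \<infinity>"
proof -
  have V: "emeasure lborel (cball (0::real^'p) 1) \<noteq> 0" "emeasure lborel (cball (0::real^'p) 1) \<noteq> \<infinity>"
    using emeasure_lborel_cball_finite[of "0::real^'p" 1]
    by (auto simp: emeasure_cball ennreal_eq_0_iff) (metis less_le unit_ball_vol_pos of_nat_0_le_iff not_le)
  have "(\<integral>\<^sup>+\<gamma>. indicator diag_le1 (gram \<gamma>) \<partial>(row_space :: ('p \<Rightarrow> real^'p) measure)) = (\<integral>\<^sup>+\<gamma>. indicator (PiE UNIV (\<lambda>_. cball (0::real^'p) 1)) \<gamma> \<partial>(row_space :: ('p \<Rightarrow> real^'p) measure))"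
  proof (rule nn_integral_cong_AE)
    show "AE \<gamma> in (row_space :: ('p \<Rightarrow> real^'p) measure). indicator diag_le1 (gram \<gamma>) = (indicator (PiE UNIV (\<lambda>_. cball (0::real^'p) 1)) \<gamma> :: ennreal)"
      using AE_row_space_det
      by eventually_elim (auto simp: indicator_def diag_le1_def gram_pd_cone_iff gram_diag abs_square_le_1)
  qed
  also have "\<dots> = emeasure row_space (PiE UNIV (\<lambda>_. cball (0::real^'p) 1))"
    by (intro nn_integral_indicator sets_PiM_I_finite) auto
  also have "\<dots> = (\<Prod>i\<in>(UNIV::'p set). emeasure lborel (cball (0::real^'p) 1))"
    by (intro lborel_prod.emeasure_PiM) auto
  finally have e: "(\<integral>\<^sup>+\<gamma>. indicator diag_le1 (gram \<gamma>) \<partial>(row_space :: ('p \<Rightarrow> real^'p) measure)) = emeasure lborel (cball (0::real^'p) 1) ^ CARD('p)"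
    by simp
  show "(\<integral>\<^sup>+\<gamma>. indicator diag_le1 (gram \<gamma>) \<partial>(row_space :: ('p \<Rightarrow> real^'p) measure)) \<noteq> 0"
    "(\<integral>\<^sup>+\<gamma>. indicator diag_le1 (gram \<gamma>) \<partial>(row_space :: ('p \<Rightarrow> real^'p) measure)) \<noteq> \<infinity>"
    unfolding e using V by (auto simp: power_eq_top_ennreal)
qed

definition vinv0 :: "real^('p::finite) uprod \<Rightarrow> real^'p uprod" where
  "vinv0 x = (if x \<in> pd_cone then vinv x else 0)"

lemma measurable_vinv0 [measurable]: "vinv0 \<in> borel_measurable borel"
  unfolding vinv0_def
  by (intro borel_measurable_continuous_on_if continuous_on_vinv continuous_on_const) auto

text \<open>Two measures on the cone of positive definite matrices that are invariant under all
  congruences are proportional: integrate \<open>F (g X g\<^sup>T)\<close> against \<open>N\<close> and the Haar measure of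
  the general linear group, cut off on \<open>diag_le1\<close>, in both orders. In the inner integral over
  \<open>g\<close> the matrix \<open>X\<close> is absorbed through its symmetric square root.\<close>
lemma invariant_integral:
  fixes X :: "'b \<Rightarrow> real^('p::finite) uprod" and F :: "real^'p uprod \<Rightarrow> ennreal"
  assumes N: "sigma_finite_measure N" and X [measurable]: "X \<in> borel_measurable N"
    and pd: "AE y in N. X y \<in> pd_cone"
    and inv: "\<And>g G. invertible g \<Longrightarrow> G \<in> borel_measurable borel \<Longrightarrow>
      (\<integral>\<^sup>+y. G (congr g (X y)) \<partial>N) = (\<integral>\<^sup>+y. G (X y) \<partial>N)"
    and F [measurable]: "F \<in> borel_measurable borel" and F0: "\<And>x. x \<notin> pd_cone \<Longrightarrow> F x = 0"
  shows "(\<integral>\<^sup>+\<gamma>. indicator diag_le1 (gram \<gamma>) \<partial>(row_space :: ('p \<Rightarrow> real^'p) measure)) * (\<integral>\<^sup>+y. F (X y) \<partial>N) =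
    (\<integral>\<^sup>+y. ennreal (det (smat (X y)) powr (- real CARD('p) / 2)) * indicator diag_le1 (vinv0 (X y)) \<partial>N) *
    (\<integral>\<^sup>+\<gamma>. F (gram \<gamma>) * ennreal (\<bar>det (vec_lambda \<gamma>)\<bar> powr (- real CARD('p))) \<partial>(row_space :: ('p \<Rightarrow> real^'p) measure))"
proof -
  let ?R = "row_space :: ('p \<Rightarrow> real^'p) measure"
  let ?b = "indicator diag_le1 :: real^'p uprod \<Rightarrow> ennreal"
  let ?p = "real CARD('p)"
  define \<kappa> where "\<kappa> x = ennreal (det (smat x) powr (- ?p / 2)) * ?b (vinv0 x)" for x :: "real^'p uprod"
  have \<kappa> [measurable]: "\<kappa> \<in> borel_measurable borel" unfolding \<kappa>_def by measurable
  interpret R: sigma_finite_measure ?R by (rule lborel_prod.sigma_finite) simp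
  interpret N: sigma_finite_measure N by fact
  interpret pair_sigma_finite N ?R ..
  have [measurable]: "(\<lambda>(y, \<gamma>). congr (vec_lambda \<gamma>) (X y)) \<in> borel_measurable (N \<Otimes>\<^sub>M ?R)"
    unfolding split_def by (intro borel_measurable_congr) simp_all
  have [measurable]: "(\<lambda>(y, \<gamma>). congr (vec_lambda \<gamma>) (vinv0 (X y))) \<in> borel_measurable (N \<Otimes>\<^sub>M ?R)"
    unfolding split_def by (intro borel_measurable_congr) simp_all
  have [measurable]: "(\<lambda>\<gamma>. det (vec_lambda \<gamma> :: real^'p^'p)) \<in> borel_measurable ?R"
    by (intro borel_measurable_det) simp
  have left: "(\<integral>\<^sup>+y. F (congr (vec_lambda \<gamma>) (X y)) * ?b (gram \<gamma>) \<partial>N) = ?b (gram \<gamma>) * (\<integral>\<^sup>+y. F (X y) \<partial>N)" for \<gamma>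
  proof (cases "gram \<gamma> \<in> diag_le1")
    case True
    then have "invertible (vec_lambda \<gamma>)" by (auto simp: diag_le1_def gram_pd_cone_iff invertible_det_nz)
    then show ?thesis using inv[of "vec_lambda \<gamma>" F] True by simp
  qed simp
  \<comment> \<open>With \<open>h ** h = smat (X y)\<close>, the substitution of
    \<open>\<gamma> h^-1\<close> for \<open>\<gamma>\<close> turns
    \<open>\<gamma> X \<gamma>^T\<close> into \<open>gram \<gamma>\<close> and
    \<open>gram \<gamma>\<close> into \<open>\<gamma> X^-1 \<gamma>^T\<close>. Its Jacobian is
    \<open>|det h^-1| ^ p\<close>, which is \<open>det X powr (- p / 2)\<close>.\<close>
  have right: "(\<integral>\<^sup>+\<gamma>. F (congr (vec_lambda \<gamma>) (X y)) * ?b (gram \<gamma>) \<partial>?R) =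
     (\<integral>\<^sup>+\<gamma>. F (gram \<gamma>) * (ennreal (det (smat (X y)) powr (- ?p / 2)) * ?b (congr (vec_lambda \<gamma>) (vinv0 (X y)))) \<partial>?R)"
    if y: "y \<in> space N" and py: "X y \<in> pd_cone" for y
  proof -
    obtain h where h: "posdef h" "h ** h = smat (X y)"
      using posdef_sqrt[of "smat (X y)"] py by (auto simp: pd_cone_def)
    have ih: "invertible h" and th: "transpose h = h" and dh: "det h > 0"
      using h posdef_invertible posdef_symmetric posdef_det_pos by auto
    have iX: "invertible (smat (X y))" by (rule pd_cone_invertible[OF py])
    let ?k = "matrix_inv h"
    have ik: "invertible ?k" by (rule invertible_matrix_inv[OF ih])
    have tk: "transpose ?k = ?k" by (simp add: transpose_matrix_inv[OF ih] th)
    have hX: "congr h (svec (mat 1)) = X y"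
    proof -
      have "smat (congr h (svec (mat 1))) = smat (X y)" by (simp add: smat_congr smat_mat1 th h)
      then show ?thesis by simp
    qed
    have kX: "congr ?k (svec (mat 1)) = vinv0 (X y)"
    proof -
      have "smat (congr ?k (svec (mat 1))) = ?k ** ?k" by (simp add: smat_congr smat_mat1 tk)
      also have "\<dots> = smat (vinv (X y))" by (simp add: smat_vinv[OF iX] h(2)[symmetric] matrix_inv_mult[OF ih ih])
      finally show ?thesis using py by (simp add: vinv0_def)
    qed
    have meas: "(\<lambda>\<gamma>. F (congr (vec_lambda \<gamma>) (X y)) * ?b (gram \<gamma>)) \<in> borel_measurable ?R"
    proof -
      have [measurable]: "(\<lambda>\<gamma>. congr (vec_lambda \<gamma>) (X y)) \<in> borel_measurable ?R"
        by (intro borel_measurable_congr) simp_all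
      show ?thesis by measurable
    qed
    have "(\<integral>\<^sup>+\<gamma>. F (congr (vec_lambda \<gamma>) (X y)) * ?b (gram \<gamma>) \<partial>?R) = 
      ennreal (\<bar>det ?k\<bar> ^ CARD('p)) *
        (\<integral>\<^sup>+\<gamma>. F (congr (vec_lambda (\<lambda>i. transpose ?k *v \<gamma> i)) (X y)) * ?b (gram (\<lambda>i. transpose ?k *v \<gamma> i)) \<partial>?R)"
      by (rule nn_integral_row_space_right_mult[OF ik meas, symmetric])
    also have "\<dots> = ennreal (\<bar>det ?k\<bar> ^ CARD('p)) *
        (\<integral>\<^sup>+\<gamma>. F (gram \<gamma>) * ?b (congr (vec_lambda \<gamma>) (vinv0 (X y))) \<partial>?R)"
    proof -
      have "congr (vec_lambda \<gamma> ** ?k) (X y) = gram \<gamma>" for \<gamma>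
        unfolding hX[symmetric] gram_def congr_mult[symmetric, unfolded comp_def fun_eq_iff, rule_format]
        by (simp add: matrix_mul_assoc[symmetric] matrix_inv_cancel[OF ih])
      moreover have "gram (\<lambda>i. transpose ?k *v \<gamma> i) = congr (vec_lambda \<gamma>) (vinv0 (X y))" for \<gamma>
        unfolding gram_def vec_lambda_right_mult congr_mult comp_def kX ..
      ultimately show ?thesis unfolding vec_lambda_right_mult by simp
    qed
    also have "\<bar>det ?k\<bar> ^ CARD('p) = det (smat (X y)) powr (- ?p / 2)"
    proof -
      have "det (smat (X y)) powr (- ?p / 2) = (det h powr 2) powr (- ?p / 2)"
        using dh by (simp add: h(2)[symmetric] det_mul powr_numeral power2_eq_square)
      also have "\<dots> = det h powr (- ?p)" by (simp only: powr_powr) simp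
      also have "\<dots> = (1 / det h) ^ CARD('p)" using dh by (simp add: powr_minus powr_realpow power_one_over inverse_eq_divide)
      finally show ?thesis using dh by (simp add: det_matrix_inv[OF ih])
    qed
    finally have "(\<integral>\<^sup>+\<gamma>. F (congr (vec_lambda \<gamma>) (X y)) * ?b (gram \<gamma>) \<partial>?R) =
      ennreal (det (smat (X y)) powr (- ?p / 2)) *
        (\<integral>\<^sup>+\<gamma>. F (gram \<gamma>) * ?b (congr (vec_lambda \<gamma>) (vinv0 (X y))) \<partial>?R)" .
    also have "\<dots> = (\<integral>\<^sup>+\<gamma>. ennreal (det (smat (X y)) powr (- ?p / 2)) * (F (gram \<gamma>) * ?b (congr (vec_lambda \<gamma>) (vinv0 (X y)))) \<partial>?R)"
    proof -
      have [measurable]: "(\<lambda>\<gamma>. congr (vec_lambda \<gamma>) (vinv0 (X y))) \<in> borel_measurable ?R"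
        by (intro borel_measurable_congr) simp_all
      show ?thesis by (intro nn_integral_cmult[symmetric]) measurable
    qed
    finally show ?thesis by (simp add: ac_simps)
  qed
  \<comment> \<open>Now \<open>g\<close> is absorbed by invariance of \<open>N\<close>: for
    \<open>k\<close> the inverse transpose of \<open>g\<close>, the matrix \<open>g X^-1 g^T\<close>
    is the inverse of \<open>k X k^T\<close>, so the integrand is \<open>\<kappa>\<close> at
    \<open>congr k (X y)\<close> up to the factor \<open>|det g| powr (- p)\<close>.\<close>
  have mid: "F (gram \<gamma>) * (\<integral>\<^sup>+y. ennreal (det (smat (X y)) powr (- ?p / 2)) * ?b (congr (vec_lambda \<gamma>) (vinv0 (X y))) \<partial>N)
    = F (gram \<gamma>) * ennreal (\<bar>det (vec_lambda \<gamma>)\<bar> powr (- ?p)) * (\<integral>\<^sup>+y. \<kappa> (X y) \<partial>N)" for \<gamma>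
  proof (cases "gram \<gamma> \<in> pd_cone")
    case True
    define g where "g = vec_lambda \<gamma>"
    have g: "invertible g" and dg: "det g \<noteq> 0" using True by (simp_all add: g_def gram_pd_cone_iff invertible_det_nz)
    define k where "k = transpose (matrix_inv g)"
    have k: "invertible k" unfolding k_def by (intro transpose_invertible invertible_matrix_inv g)
    have "transpose k = matrix_inv g" by (simp add: k_def)
    then have "matrix_inv (transpose k) = g" by (simp add: matrix_inv_matrix_inv[OF g])
    then have kg: "transpose (matrix_inv k) = g" by (simp add: transpose_matrix_inv[OF k])
    have dk: "det k = 1 / det g" by (simp add: k_def det_matrix_inv[OF g])
    have "(\<integral>\<^sup>+y. ennreal (det (smat (X y)) powr (- ?p / 2)) * ?b (congr g (vinv0 (X y))) \<partial>N) =
      (\<integral>\<^sup>+y. ennreal (\<bar>det g\<bar> powr (- ?p)) * \<kappa> (congr k (X y)) \<partial>N)"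
    proof (rule nn_integral_cong_AE)
      show "AE y in N. ennreal (det (smat (X y)) powr (- ?p / 2)) * ?b (congr g (vinv0 (X y))) =
         ennreal (\<bar>det g\<bar> powr (- ?p)) * \<kappa> (congr k (X y))"
        using pd
      proof eventually_elim
        fix y assume py: "X y \<in> pd_cone"
        have pc: "congr k (X y) \<in> pd_cone" by (rule congr_pd_cone[OF py k])
        have "vinv0 (congr k (X y)) = congr g (vinv0 (X y))"
          using pc py by (simp add: vinv0_def vinv_congr[OF k py] kg)
        moreover have "det (smat (X y)) powr (- ?p / 2) = \<bar>det g\<bar> powr (- ?p) * det (smat (congr k (X y))) powr (- ?p / 2)"
        proof -
          have "det (smat (X y)) = \<bar>det g\<bar> powr 2 * det (smat (congr k (X y)))"
            using dg by (simp add: det_congr dk power_one_over powr_numeral)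
          then have "det (smat (X y)) powr (- ?p / 2) = (\<bar>det g\<bar> powr 2) powr (- ?p / 2) * det (smat (congr k (X y))) powr (- ?p / 2)"
            using pd_cone_det_pos[OF pc] by (simp only: powr_mult powr_ge_zero less_imp_le)
          then show ?thesis by (simp only: powr_powr) simp
        qed
        ultimately show "ennreal (det (smat (X y)) powr (- ?p / 2)) * ?b (congr g (vinv0 (X y))) =
         ennreal (\<bar>det g\<bar> powr (- ?p)) * \<kappa> (congr k (X y))"
          by (simp add: \<kappa>_def ennreal_mult mult.assoc)
      qed
    qed
    also have "\<dots> = ennreal (\<bar>det g\<bar> powr (- ?p)) * (\<integral>\<^sup>+y. \<kappa> (congr k (X y)) \<partial>N)"
    proof -
      have [measurable]: "(\<lambda>y. congr k (X y)) \<in> borel_measurable N"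
        by (intro borel_measurable_congr) simp_all
      show ?thesis by (intro nn_integral_cmult) measurable
    qed
    also have "(\<integral>\<^sup>+y. \<kappa> (congr k (X y)) \<partial>N) = (\<integral>\<^sup>+y. \<kappa> (X y) \<partial>N)" by (rule inv[OF k \<kappa>])
    finally show ?thesis by (simp add: g_def mult.assoc)
  qed (simp add: F0)
  have "(\<integral>\<^sup>+\<gamma>. ?b (gram \<gamma>) \<partial>?R) * (\<integral>\<^sup>+y. F (X y) \<partial>N) = (\<integral>\<^sup>+\<gamma>. (\<integral>\<^sup>+y. F (congr (vec_lambda \<gamma>) (X y)) * ?b (gram \<gamma>) \<partial>N) \<partial>?R)"
    unfolding left by (simp add: nn_integral_multc)
  also have "\<dots> = (\<integral>\<^sup>+y. (\<integral>\<^sup>+\<gamma>. F (congr (vec_lambda \<gamma>) (X y)) * ?b (gram \<gamma>) \<partial>?R) \<partial>N)"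
    by (rule Fubini') measurable
  also have "\<dots> = (\<integral>\<^sup>+y. (\<integral>\<^sup>+\<gamma>. F (gram \<gamma>) * (ennreal (det (smat (X y)) powr (- ?p / 2)) * ?b (congr (vec_lambda \<gamma>) (vinv0 (X y)))) \<partial>?R) \<partial>N)"
  proof (rule nn_integral_cong_AE)
    show "AE y in N. (\<integral>\<^sup>+\<gamma>. F (congr (vec_lambda \<gamma>) (X y)) * ?b (gram \<gamma>) \<partial>?R) =
      (\<integral>\<^sup>+\<gamma>. F (gram \<gamma>) * (ennreal (det (smat (X y)) powr (- ?p / 2)) * ?b (congr (vec_lambda \<gamma>) (vinv0 (X y)))) \<partial>?R)"
      using pd AE_space[of N] by eventually_elim (rule right)
  qed
  also have "\<dots> = (\<integral>\<^sup>+\<gamma>. (\<integral>\<^sup>+y. F (gram \<gamma>) * (ennreal (det (smat (X y)) powr (- ?p / 2)) * ?b (congr (vec_lambda \<gamma>) (vinv0 (X y)))) \<partial>N) \<partial>?R)"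
    by (rule Fubini'[symmetric]) measurable
  also have "\<dots> = (\<integral>\<^sup>+\<gamma>. F (gram \<gamma>) * (\<integral>\<^sup>+y. ennreal (det (smat (X y)) powr (- ?p / 2)) * ?b (congr (vec_lambda \<gamma>) (vinv0 (X y))) \<partial>N) \<partial>?R)"
  proof (rule nn_integral_cong)
    fix \<gamma>
    show "(\<integral>\<^sup>+y. F (gram \<gamma>) * (ennreal (det (smat (X y)) powr (- ?p / 2)) * ?b (congr (vec_lambda \<gamma>) (vinv0 (X y)))) \<partial>N)
      = F (gram \<gamma>) * (\<integral>\<^sup>+y. ennreal (det (smat (X y)) powr (- ?p / 2)) * ?b (congr (vec_lambda \<gamma>) (vinv0 (X y))) \<partial>N)"
    proof -
      have [measurable]: "(\<lambda>y. congr (vec_lambda \<gamma>) (vinv0 (X y))) \<in> borel_measurable N"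
        by (intro borel_measurable_congr) simp_all
      show ?thesis by (intro nn_integral_cmult) measurable
    qed
  qed
  also have "\<dots> = (\<integral>\<^sup>+\<gamma>. F (gram \<gamma>) * ennreal (\<bar>det (vec_lambda \<gamma>)\<bar> powr (- ?p)) \<partial>?R) * (\<integral>\<^sup>+y. \<kappa> (X y) \<partial>N)"
    unfolding mid by (intro nn_integral_multc) measurable
  finally show ?thesis by (simp add: \<kappa>_def mult.commute)
qed

subsection \<open>Sample mean and sample covariance\<close>

definition outer :: "real^'p \<Rightarrow> real^'p \<Rightarrow> real^'p^'p" where
  "outer a b = (\<chi> i j. a $ i * b $ j)"

lemma outer_nth [simp]: "outer a b $ i $ j = a $ i * b $ j"
  by (simp add: outer_def)

lemma transpose_outer [simp]: "transpose (outer a a) = outer a a"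
  by (simp add: transpose_def vec_eq_iff mult.commute)

lemma outer_vec: "outer a b *v u = (b \<bullet> u) *\<^sub>R a"
  by (simp add: matrix_vector_mult_def vec_eq_iff inner_vec_def sum_distrib_left sum_distrib_right mult.assoc mult.commute mult.left_commute)

lemma trace_mult_outer: "trace (A ** outer a b) = b \<bullet> (A *v a)"
proof -
  have "trace (A ** outer a b) = (\<Sum>i\<in>UNIV. \<Sum>j\<in>UNIV. A $ i $ j * a $ j * b $ i)"
    by (simp add: trace_def matrix_matrix_mult_def mult.assoc)
  also have "\<dots> = b \<bullet> (A *v a)"
    by (simp add: inner_vec_def matrix_vector_mult_def sum_distrib_left sum_distrib_right mult.commute)
  finally show ?thesis .
qed

lemma outer_matrix_vector: "outer (g *v a) (g *v b) = g ** outer a b ** transpose g"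
proof -
  have "(g ** outer a b) $ i $ k = (g *v a) $ i * b $ k" for i k
    by (simp add: matrix_matrix_mult_def matrix_vector_mult_def sum_distrib_right mult.assoc)
  then show ?thesis
    by (simp add: vec_eq_iff matrix_matrix_mult_def[of "g ** outer a b"] matrix_vector_mult_def[of g b] transpose_def
        sum_distrib_left mult.assoc mult.commute mult.left_commute)
qed

definition sample_mean :: "nat \<Rightarrow> (nat \<Rightarrow> real^'p) \<Rightarrow> real^'p" where
  "sample_mean n y = (1 / real n) *\<^sub>R (\<Sum>k=1..n. y k)"

definition sample_cov_mat :: "nat \<Rightarrow> (nat \<Rightarrow> real^'p) \<Rightarrow> real^'p^'p" where
  "sample_cov_mat n y = (1 / real n) *\<^sub>R (\<Sum>k=1..n. outer (y k - sample_mean n y) (y k - sample_mean n y))"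

definition sample_cov :: "nat \<Rightarrow> (nat \<Rightarrow> real^'p) \<Rightarrow> real^('p::finite) uprod" where
  "sample_cov n y = svec (sample_cov_mat n y)"

lemma sample_cov_mat_nth: "sample_cov_mat n y $ i $ j =
    (1 / real n) * (\<Sum>k=1..n. (y k - sample_mean n y) $ i * (y k - sample_mean n y) $ j)"
  by (simp add: sample_cov_mat_def)

lemma smat_sample_cov: "smat (sample_cov n y) = sample_cov_mat n y"
  unfolding sample_cov_def
  by (rule smat_svec) (simp add: transpose_def vec_eq_iff sample_cov_mat_nth mult.commute)

lemma sample_cov_nth: "sample_cov n y $ Upair i j =
    (1 / real n) * (\<Sum>k=1..n. (y k - sample_mean n y) $ i * (y k - sample_mean n y) $ j)"
  using smat_nth[of "sample_cov n y" i j] by (simp only: smat_sample_cov sample_cov_mat_nth)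

lemma sample_mean_restrict [simp]: "sample_mean n (restrict y {1..n}) = sample_mean n y"
  by (simp add: sample_mean_def)

lemma sample_cov_restrict [simp]: "sample_cov n (restrict y {1..n}) = sample_cov n y"
  unfolding sample_cov_def sample_cov_mat_def sample_mean_restrict by simp

lemma sample_mean_linear: "linear f \<Longrightarrow> sample_mean n (\<lambda>k. f (y k)) = f (sample_mean n y)"
  by (simp add: sample_mean_def linear_scale linear_sum)

lemma sample_mean_affine: "n > 0 \<Longrightarrow> sample_mean n (\<lambda>k. a + y k) = a + sample_mean n y"
  by (simp add: sample_mean_def sum.distrib scaleR_right_distrib sum_constant_scaleR del: sum_constant)

lemma sample_cov_translate: "n > 0 \<Longrightarrow> sample_cov n (\<lambda>k. a + y k) = sample_cov n y"
  by (simp add: sample_cov_def sample_cov_mat_def sample_mean_affine)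

lemma sample_cov_congr: "sample_cov n (\<lambda>k. g *v y k) = congr g (sample_cov n y)"
proof -
  have "g *v y k - sample_mean n (\<lambda>k. g *v y k) = g *v (y k - sample_mean n y)" for k
    unfolding sample_mean_linear[OF matrix_vector_mul_linear]
    by (simp add: linear_diff[OF matrix_vector_mul_linear])
  then have "sample_cov_mat n (\<lambda>k. g *v y k) = (1 / real n) *\<^sub>R (\<Sum>k=1..n. g ** outer (y k - sample_mean n y) (y k - sample_mean n y) ** transpose g)"
    by (simp add: sample_cov_mat_def outer_matrix_vector)
  also have "\<dots> = g ** sample_cov_mat n y ** transpose g"
  proof -
    have lin: "linear (\<lambda>X::real^'a^'a. g ** X ** transpose g)"
      by (rule linearI) (simp_all add: matrix_matrix_mult_def vec_eq_iff sum_distrib_left sum_distrib_right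
        sum.distrib algebra_simps)
    show ?thesis unfolding sample_cov_mat_def linear_scale[OF lin] linear_sum[OF lin] ..
  qed
  finally have "smat (sample_cov n (\<lambda>k. g *v y k)) = smat (congr g (sample_cov n y))"
    by (simp add: smat_sample_cov smat_congr)
  then show ?thesis by simp
qed

abbreviation data_space :: "nat \<Rightarrow> (nat \<Rightarrow> real^'p) measure" where
  "data_space n \<equiv> PiM {1..n} (\<lambda>_. lborel)"

lemma measurable_sample_mean [measurable]: "sample_mean n \<in> borel_measurable (data_space n)"
  unfolding sample_mean_def
  by (intro borel_measurable_scaleR borel_measurable_const borel_measurable_sum) simp

lemma measurable_sample_cov [measurable]: "sample_cov n \<in> borel_measurable (data_space n)"
proof (rule borel_measurable_vecI)
  fix e :: "'a uprod"
  have [measurable]: "(\<lambda>y. y k $ i) \<in> borel_measurable (data_space n)" if "k \<in> {1..n}" for k i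
    by (intro borel_measurable_vec_nth) (use that in simp)
  obtain i j where e: "e = Upair i j" by (cases e)
  show "(\<lambda>y. sample_cov n y $ e) \<in> borel_measurable (data_space n)"
    unfolding e sample_cov_nth vector_minus_component
    by (intro borel_measurable_times borel_measurable_const borel_measurable_sum borel_measurable_diff
       borel_measurable_vec_nth measurable_sample_mean) simp_all
qed

lemma quadratic_sample_cov:
  "u \<bullet> (smat (sample_cov n y) *v u) = (1 / real n) * (\<Sum>k=1..n. ((y k - sample_mean n y) \<bullet> u)\<^sup>2)"
proof -
  have lin: "linear (\<lambda>X::real^'a^'a. u \<bullet> (X *v u))"
    by (rule linearI) (simp_all add: matrix_vector_mult_add_rdistrib inner_add_right scaleR_matrix_vector_assoc[symmetric])
  show ?thesis
    unfolding smat_sample_cov sample_cov_mat_def linear_scale[OF lin] linear_sum[OF lin]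
    by (simp add: outer_vec power2_eq_square inner_commute)
qed

text \<open>A sample covariance is positive semidefinite. If its quadratic form vanishes at
  \<open>u\<close>, all centred observations are orthogonal to \<open>u\<close>, and then
  \<open>u\<close> lies in the kernel of the matrix.\<close>

lemma sample_cov_pd_cone_iff_det: "n > 0 \<Longrightarrow> sample_cov n y \<in> pd_cone \<longleftrightarrow> det (smat (sample_cov n y)) \<noteq> 0"
  using pd_cone_det_pos[of "sample_cov n y"]
proof (intro iffI)
  assume n: "n > 0" and d: "det (smat (sample_cov n y)) \<noteq> 0"
  have nonneg: "0 \<le> u \<bullet> (smat (sample_cov n y) *v u)" for u
    by (simp add: quadratic_sample_cov sum_nonneg)
  obtain Q c where Q: "orthogonal_matrix Q" and e: "smat (sample_cov n y) = Q ** diag_mat c ** transpose Q"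
    using symmetric_spectral[OF transpose_smat] by metis
  have "0 < u \<bullet> (smat (sample_cov n y) *v u)" if u: "u \<noteq> 0" for u
  proof (rule ccontr)
    assume "\<not> ?thesis"
    then have "(\<Sum>k=1..n. ((y k - sample_mean n y) \<bullet> u)\<^sup>2) = 0"
      using nonneg[of u] n unfolding quadratic_sample_cov by (simp add: divide_le_0_iff not_less sum_nonneg order_antisym)
    then have 0: "\<And>k. k \<in> {1..n} \<Longrightarrow> (y k - sample_mean n y) \<bullet> u = 0"
      by (subst (asm) sum_nonneg_eq_0_iff) auto
    have lin: "linear (\<lambda>X::real^'a^'a. X *v u)"
      by (rule linearI) (simp_all add: matrix_vector_mult_add_rdistrib scaleR_matrix_vector_assoc[symmetric])
    have "smat (sample_cov n y) *v u = 0"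
      unfolding smat_sample_cov sample_cov_mat_def linear_scale[OF lin] linear_sum[OF lin]
      by (simp add: outer_vec 0)
    moreover have "invertible (smat (sample_cov n y))" using d by (simp add: invertible_det_nz)
    ultimately show False using u by (metis invertible_left_inverse matrix_left_invertible_ker)
  qed
  then show "sample_cov n y \<in> pd_cone" by (simp add: pd_cone_def posdef_def)
qed auto

lemma AE_sample_cov_pd_cone:
  assumes n: "n \<ge> CARD('p) + 1"
  shows "AE y in data_space n. sample_cov n y \<in> (pd_cone :: (real^('p::finite) uprod) set)"
proof -
  have n0: "n > 0" using n by simp
  obtain b :: "'p \<Rightarrow> nat" where b: "bij_betw b UNIV {1..CARD('p)}"
    using finite_same_card_bij[of "UNIV::'p set" "{1..CARD('p)}"] by auto
  \<comment> \<open>A sample consisting of the \<open>p\<close> basis vectors and zeros. Since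
    \<open>n \<ge> p + 1\<close>, at least the observation with index \<open>n\<close> is
    zero.\<close>
  define z :: "nat \<Rightarrow> real^'p" where "z k = (if k \<in> {1..CARD('p)} then axis (inv_into UNIV b k) 1 else 0)" for k
  have zb: "z (b i) = axis i 1" for i
    using b by (auto simp: z_def bij_betw_def)
  have bn: "b i \<in> {1..n}" for i using bij_betwE[OF b] n by fastforce
  have nn: "n \<in> {1..n}" "z n = 0" using n0 n by (auto simp: z_def)
  have zpd: "sample_cov n z \<in> pd_cone"
  proof -
    have "0 < u \<bullet> (smat (sample_cov n z) *v u)" if u: "u \<noteq> 0" for u :: "real^'p"
    proof (rule ccontr)
      assume "\<not> ?thesis"
      then have "(\<Sum>k=1..n. ((z k - sample_mean n z) \<bullet> u)\<^sup>2) \<le> 0"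
        using n0 unfolding quadratic_sample_cov by (simp add: divide_le_0_iff not_less)
      then have "(\<Sum>k=1..n. ((z k - sample_mean n z) \<bullet> u)\<^sup>2) = 0" by (simp add: sum_nonneg order_antisym)
      then have 0: "(z k - sample_mean n z) \<bullet> u = 0" if "k \<in> {1..n}" for k
        using that by (subst (asm) sum_nonneg_eq_0_iff) auto
      \<comment> \<open>The zero observation shows the mean to be orthogonal to \<open>u\<close>;
        the basis vectors then give the coordinates of \<open>u\<close>.\<close>
      have "sample_mean n z \<bullet> u = 0" using 0[OF nn(1)] nn(2) by simp
      then have "u $ i = 0" for i
        using 0[OF bn[of i]] by (simp add: zb inner_diff_left inner_axis')
      then show False using u by (simp add: vec_eq_iff)
    qed
    then show ?thesis by (simp add: pd_cone_def posdef_def)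
  qed
  let ?P = "\<lambda>y i j. smult (1 / real n) (\<Sum>k=1..n. [:(y k - sample_mean n y) $ i, (z k - sample_mean n z) $ i:] *
     [:(y k - sample_mean n y) $ j, (z k - sample_mean n z) $ j:])"
  have lin: "sample_mean n (\<lambda>k. s *\<^sub>R z k + t *\<^sub>R y k) = s *\<^sub>R sample_mean n z + t *\<^sub>R sample_mean n y" for s t y
    by (simp add: sample_mean_def sum.distrib scaleR_sum_right scaleR_right_distrib mult.commute)
  have "AE y in data_space n. det (smat (sample_cov n y) :: real^'p^'p) \<noteq> 0"
  proof (rule AE_PiM_det_nonzero[where z = z and P = ?P])
    show "(\<lambda>y. det (smat (sample_cov n y) :: real^'p^'p)) \<in> borel_measurable (data_space n)" by measurable
    fix y :: "nat \<Rightarrow> real^'p"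
    show "smat (sample_cov n (\<lambda>i\<in>{1..n}. s *\<^sub>R z i + y i)) $ i $ j = poly (?P y i j) s" for s i j
      unfolding sample_cov_restrict smat_sample_cov sample_cov_mat_nth
      using lin[of s 1 y] by (simp add: poly_sum algebra_simps)
    \<comment> \<open>Again \<open>r\<close> stands for \<open>1 / s\<close>: the determinant is
      continuous in \<open>r\<close> and positive at \<open>r = 0\<close>, where the sample is
      \<open>z\<close> itself. Rescaling the sample by \<open>r\<close> changes the determinant only
      by a nonzero factor.\<close>
    let ?f = "\<lambda>r::real. det (smat (sample_cov n (\<lambda>k. 1 *\<^sub>R z k + r *\<^sub>R y k)))"
    have "continuous (at 0) ?f"
      unfolding det_def smat_nth sample_cov_nth lin vector_minus_component vector_add_component vector_scaleR_component
      by (intro continuous_intros)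
    then have "(?f \<longlongrightarrow> ?f 0) (at 0)" by (simp add: continuous_at)
    moreover have "?f 0 \<noteq> 0" using pd_cone_det_pos[OF zpd] by simp
    ultimately have "eventually (\<lambda>r. ?f r \<noteq> 0) (at 0)" by (rule tendsto_imp_eventually_ne)
    then have "eventually (\<lambda>r. ?f r \<noteq> 0 \<and> r \<noteq> 0) (at 0)"
      by (intro eventually_conj) (auto simp: eventually_at_filter)
    then obtain r where r: "?f r \<noteq> 0" "r \<noteq> 0" 
      using eventually_happens trivial_limit_at by blast
    have "(\<lambda>k. 1 *\<^sub>R z k + r *\<^sub>R y k) = (\<lambda>k. (r *\<^sub>R mat 1) *v ((1 / r) *\<^sub>R z k + y k))"
      using r(2) by (simp add: scaleR_matrix_vector_assoc[symmetric] scaleR_right_distrib)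
    then have "?f r = (det (r *\<^sub>R mat 1 :: real^'p^'p))\<^sup>2 * det (smat (sample_cov n (\<lambda>k. (1 / r) *\<^sub>R z k + y k)))"
      by (simp only: sample_cov_congr det_congr)
    then have "det (smat (sample_cov n (\<lambda>k. (1 / r) *\<^sub>R z k + y k))) \<noteq> 0" using r by fastforce
    then show "\<exists>s. det (smat (sample_cov n (\<lambda>i\<in>{1..n}. s *\<^sub>R z i + y i)) :: real^'p^'p) \<noteq> 0"
      unfolding sample_cov_restrict by blast
  qed simp
  then show ?thesis using n0 by (simp add: sample_cov_pd_cone_iff_det)
qed

lemma nn_integral_lborel_reflect:
  fixes F :: "'a::euclidean_space \<Rightarrow> ennreal"
  assumes [measurable]: "F \<in> borel_measurable borel"
  shows "(\<integral>\<^sup>+x. F (a - x) \<partial>lborel) = (\<integral>\<^sup>+x. F x \<partial>lborel)"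
proof -
  have "lborel = density (distr lborel borel (\<lambda>x::'a. a - x)) (\<lambda>_. 1)"
    using lborel_affine[of "-1" a] by simp
  then have "(\<integral>\<^sup>+x. F x \<partial>lborel) = (\<integral>\<^sup>+x. F x \<partial>density (distr lborel borel (\<lambda>x::'a. a - x)) (\<lambda>_. 1))" by metis
  then show ?thesis by (simp add: nn_integral_density nn_integral_distr)
qed

lemma nn_integral_data_space_map:
  fixes h :: "real^'p \<Rightarrow> real^'p"
  assumes "h \<in> borel_measurable borel"
    "\<And>G. G \<in> borel_measurable borel \<Longrightarrow> ennreal c * (\<integral>\<^sup>+x. G (h x) \<partial>lborel) = (\<integral>\<^sup>+x. G x \<partial>lborel)"
    "F \<in> borel_measurable (data_space n)" "\<And>y. F (restrict y {1..n}) = F y"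
  shows "ennreal c ^ n * (\<integral>\<^sup>+y. F (\<lambda>k. h (y k)) \<partial>data_space n) = (\<integral>\<^sup>+y. F y \<partial>data_space n)"
proof -
  have "ennreal c ^ card {1..n} * (\<integral>\<^sup>+y. F (\<lambda>k\<in>{1..n}. h (y k)) \<partial>data_space n) = (\<integral>\<^sup>+y. F y \<partial>data_space n)"
    by (rule nn_integral_PiM_map) (use assms in simp_all)
  then show ?thesis unfolding assms(4) by simp
qed

text \<open>Translations move the sample mean but not the sample covariance.\<close>
lemma sample_mean_weight_change:
  fixes H :: "real^('p::finite) uprod \<Rightarrow> ennreal" and v w :: "real^'p \<Rightarrow> ennreal"
  assumes n: "n > 0" and [measurable]: "H \<in> borel_measurable borel" "v \<in> borel_measurable borel" "w \<in> borel_measurable borel"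
  shows "(\<integral>\<^sup>+x. w x \<partial>lborel) * (\<integral>\<^sup>+y. H (sample_cov n y) * v (sample_mean n y) \<partial>data_space n) =
    (\<integral>\<^sup>+x. v x \<partial>lborel) * (\<integral>\<^sup>+y. H (sample_cov n y) * w (sample_mean n y) \<partial>data_space n)"
proof -
  interpret D: sigma_finite_measure "data_space n :: (nat \<Rightarrow> real^'p) measure"
    by (rule lborel_prod.sigma_finite) simp
  interpret pair_sigma_finite "lborel :: (real^'p) measure" "data_space n :: (nat \<Rightarrow> real^'p) measure" ..
  let ?D = "data_space n :: (nat \<Rightarrow> real^'p) measure"
  let ?H = "\<lambda>y. H (sample_cov n y)" and ?m = "sample_mean n"
  have "(\<integral>\<^sup>+x. w x \<partial>lborel) * (\<integral>\<^sup>+y. ?H y * v (?m y) \<partial>?D) = (\<integral>\<^sup>+y. (\<integral>\<^sup>+x. w x \<partial>lborel) * (?H y * v (?m y)) \<partial>?D)"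
    by (rule nn_integral_cmult[symmetric]) measurable
  also have "\<dots> = (\<integral>\<^sup>+y. (\<integral>\<^sup>+x. ?H y * v (?m y) * w (?m y + x) \<partial>lborel) \<partial>?D)"
  proof (intro nn_integral_cong)
    fix y :: "nat \<Rightarrow> real^'p"
    have "(\<integral>\<^sup>+x. ?H y * v (?m y) * w (?m y + x) \<partial>lborel) = ?H y * v (?m y) * (\<integral>\<^sup>+x. w (?m y + x) \<partial>lborel)"
      by (rule nn_integral_cmult) measurable
    then show "(\<integral>\<^sup>+x. w x \<partial>lborel) * (?H y * v (?m y)) = (\<integral>\<^sup>+x. ?H y * v (?m y) * w (?m y + x) \<partial>lborel)"
      by (simp add: nn_integral_lborel_translate mult.commute)
  qed
  also have "\<dots> = (\<integral>\<^sup>+x. (\<integral>\<^sup>+y. ?H y * v (?m y) * w (?m y + x) \<partial>?D) \<partial>lborel)"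
    by (rule Fubini') measurable
  also have "\<dots> = (\<integral>\<^sup>+x. (\<integral>\<^sup>+y. ?H y * v (?m y - x) * w (?m y) \<partial>?D) \<partial>lborel)"
  proof (rule nn_integral_cong)
    fix x :: "real^'p"
    have "ennreal 1 ^ n * (\<integral>\<^sup>+y. ?H (\<lambda>k. - x + y k) * v (?m (\<lambda>k. - x + y k)) * w (?m (\<lambda>k. - x + y k) + x) \<partial>?D)
      = (\<integral>\<^sup>+y. ?H y * v (?m y) * w (?m y + x) \<partial>?D)"
    proof (rule nn_integral_data_space_map[where h = "\<lambda>y. - x + y" and F = "\<lambda>y. ?H y * v (?m y) * w (?m y + x)"])
      show "ennreal 1 * (\<integral>\<^sup>+z. G (- x + z) \<partial>lborel) = integral\<^sup>N lborel G" if "G \<in> borel_measurable borel" for G :: "real^'p \<Rightarrow> ennreal"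
        using nn_integral_lborel_translate[OF that, of "- x"] by simp
      show "(\<lambda>y. ?H y * v (?m y) * w (?m y + x)) \<in> borel_measurable ?D" by measurable
      show "?H (restrict y {1..n}) * v (?m (restrict y {1..n})) * w (?m (restrict y {1..n}) + x) = ?H y * v (?m y) * w (?m y + x)" for y
        unfolding sample_mean_restrict sample_cov_restrict ..
    qed measurable
    then show "(\<integral>\<^sup>+y. ?H y * v (?m y) * w (?m y + x) \<partial>?D) = (\<integral>\<^sup>+y. ?H y * v (?m y - x) * w (?m y) \<partial>?D)"
      unfolding sample_mean_affine[OF n] sample_cov_translate[OF n] by simp
  qed
  also have "\<dots> = (\<integral>\<^sup>+y. (\<integral>\<^sup>+x. ?H y * v (?m y - x) * w (?m y) \<partial>lborel) \<partial>?D)"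
    by (rule Fubini'[symmetric]) measurable
  also have "\<dots> = (\<integral>\<^sup>+y. (\<integral>\<^sup>+x. v x \<partial>lborel) * (?H y * w (?m y)) \<partial>?D)"
  proof (intro nn_integral_cong)
    fix y :: "nat \<Rightarrow> real^'p"
    have "(\<integral>\<^sup>+x. ?H y * v (?m y - x) * w (?m y) \<partial>lborel) = (\<integral>\<^sup>+x. v (?m y - x) * (?H y * w (?m y)) \<partial>lborel)"
      by (simp add: ac_simps)
    also have "\<dots> = (\<integral>\<^sup>+x. v (?m y - x) \<partial>lborel) * (?H y * w (?m y))" by (rule nn_integral_multc) measurable
    finally show "(\<integral>\<^sup>+x. ?H y * v (?m y - x) * w (?m y) \<partial>lborel) = (\<integral>\<^sup>+x. v x \<partial>lborel) * (?H y * w (?m y))"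
      by (simp add: nn_integral_lborel_reflect)
  qed
  also have "\<dots> = (\<integral>\<^sup>+x. v x \<partial>lborel) * (\<integral>\<^sup>+y. ?H y * w (?m y) \<partial>?D)"
    by (rule nn_integral_cmult) measurable
  finally show ?thesis .
qed

subsection \<open>The Wishart density\<close>

lemma congr_pd_cone_iff_right: "invertible g \<Longrightarrow> congr g x \<in> pd_cone \<longleftrightarrow> x \<in> pd_cone"
proof
  assume g: "invertible g" and x: "congr g x \<in> pd_cone"
  have "congr (matrix_inv g) (congr g x) = x"
    using congr_mult[of "matrix_inv g" g] by (simp add: matrix_inv_cancel[OF g] congr_mat1 fun_eq_iff)
  then show "x \<in> pd_cone" using congr_pd_cone[OF x invertible_matrix_inv[OF g]] by simp
qed (rule congr_pd_cone)

lemma det_congr_powr: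
  assumes g: "invertible g" and x: "x \<in> pd_cone"
  shows "det (smat (congr g x)) powr a = \<bar>det g\<bar> powr (2 * a) * det (smat x) powr a"
proof -
  have "det (smat (congr g x)) = \<bar>det g\<bar> powr 2 * det (smat x)"
    using g by (simp add: det_congr powr_numeral invertible_det_nz)
  also have "\<dots> powr a = (\<bar>det g\<bar> powr 2) powr a * det (smat x) powr a"
    by (rule powr_mult)
  finally show ?thesis by (simp only: powr_powr)
qed

lemma mult_cancel_ennreal:
  fixes a b c :: ennreal
  shows "c \<noteq> 0 \<Longrightarrow> c \<noteq> \<infinity> \<Longrightarrow> c * a = c * b \<Longrightarrow> a = b"
  by (simp add: ennreal_mult_cancel_left)

definition cone_density :: "real \<Rightarrow> real^('p::finite) uprod \<Rightarrow> ennreal" where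
  "cone_density a x = indicator pd_cone x * ennreal (det (smat x) powr a)"

lemma measurable_cone_density [measurable]: "cone_density a \<in> borel_measurable borel"
  unfolding cone_density_def by measurable

lemma cone_density_finite: "cone_density a x \<noteq> \<infinity>"
  by (simp add: cone_density_def indicator_def)

lemma cone_density_congr:
  assumes g: "invertible g"
  shows "cone_density a (congr g x) = ennreal (\<bar>det g\<bar> powr (2 * a)) * cone_density a x"
  using det_congr_powr[OF g]
  by (cases "x \<in> pd_cone") (simp_all add: cone_density_def congr_pd_cone_iff_right[OF g] ennreal_mult)

lemma cone_density_mult: "cone_density a x * ennreal (det (smat x) powr b) = cone_density (a + b) x"
  by (cases "x \<in> pd_cone") (simp_all add: cone_density_def powr_add ennreal_mult)

text \<open>The invariant measure of the cone: a congruence multiplies \<open>det X\<close> by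
  \<open>(det g)\<^sup>2\<close>, so this power of the determinant cancels the Jacobian
  \<open>|det g| ^ (p + 1)\<close>.\<close>

definition cone_measure :: "(real^('p::finite) uprod) measure" where
  "cone_measure = density lborel (cone_density (- (real CARD('p) + 1) / 2))"

lemma cone_measure_invariant:
  fixes G :: "real^('p::finite) uprod \<Rightarrow> ennreal"
  assumes g: "invertible g" and G [measurable]: "G \<in> borel_measurable borel"
  shows "(\<integral>\<^sup>+x. G (congr g x) \<partial>cone_measure) = (\<integral>\<^sup>+x. G x \<partial>cone_measure)"
proof -
  let ?a = "- (real CARD('p) + 1) / 2"
  have [measurable]: "congr g \<in> borel_measurable borel"
    using borel_measurable_congr[of "\<lambda>_. g" borel "\<lambda>x. x"] by simp
  have dg: "det g \<noteq> 0" using g by (simp add: invertible_det_nz)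
  have "(\<integral>\<^sup>+x. G (congr g x) \<partial>cone_measure) = (\<integral>\<^sup>+x. cone_density ?a x * G (congr g x) \<partial>lborel)"
    unfolding cone_measure_def by (subst nn_integral_density) auto
  also have "\<dots> = (\<integral>\<^sup>+x. ennreal (\<bar>det g\<bar> ^ (CARD('p) + 1)) * (cone_density ?a (congr g x) * G (congr g x)) \<partial>lborel)"
  proof (rule nn_integral_cong)
    fix x
    have "\<bar>det g\<bar> ^ (CARD('p) + 1) * \<bar>det g\<bar> powr (2 * ?a) = \<bar>det g\<bar> powr (real CARD('p) + 1) * \<bar>det g\<bar> powr (- (real CARD('p) + 1))"
    proof -
      have "2 * ?a = - (real CARD('p) + 1)" by simp
      moreover have "\<bar>det g\<bar> powr (real CARD('p) + 1) = \<bar>det g\<bar> ^ (CARD('p) + 1)"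
        using dg powr_realpow[of "\<bar>det g\<bar>" "CARD('p) + 1"] by (simp add: add.commute)
      ultimately show ?thesis by (simp only:)
    qed
    also have "\<dots> = 1" using dg by (simp add: powr_add[symmetric])
    finally show "cone_density ?a x * G (congr g x) = ennreal (\<bar>det g\<bar> ^ (CARD('p) + 1)) * (cone_density ?a (congr g x) * G (congr g x))"
      unfolding cone_density_congr[OF g] mult.assoc[symmetric] by (simp add: ennreal_mult[symmetric])
  qed
  also have "\<dots> = ennreal (\<bar>det g\<bar> ^ (CARD('p) + 1)) * (\<integral>\<^sup>+x. cone_density ?a (congr g x) * G (congr g x) \<partial>lborel)"
    by (rule nn_integral_cmult) measurable
  also have "\<dots> = (\<integral>\<^sup>+x. cone_density ?a x * G x \<partial>lborel)"
    by (rule nn_integral_congr[OF g]) measurable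
  also have "\<dots> = (\<integral>\<^sup>+x. G x \<partial>cone_measure)"
    unfolding cone_measure_def by (subst nn_integral_density) auto
  finally show ?thesis .
qed

lemma emeasure_diag_le1:
  "emeasure lborel (diag_le1 :: (real^('p::finite) uprod) set) \<noteq> 0"
  "emeasure lborel (diag_le1 :: (real^('p::finite) uprod) set) \<noteq> \<infinity>"
proof -
  let ?U = "{x \<in> pd_cone. \<forall>i. x $ Upair i i < 1} :: (real^'p uprod) set"
  have "open ?U"
  proof -
    have "?U = pd_cone \<inter> (\<Inter>i. {x. x $ Upair i i < 1})" by auto
    moreover have "open {x :: real^'p uprod. x $ Upair i i < 1}" for i
      by (intro open_Collect_less continuous_intros)
    ultimately show ?thesis using open_pd_cone by (auto intro!: open_Int open_INT)
  qed
  moreover have "(1/2) *\<^sub>R svec (mat 1) \<in> ?U"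
    using one_pd_cone by (auto simp: pd_cone_def smat_scaleR svec_nth transpose_mat intro!: posdef_scaleR) (simp add: mat_def)
  ultimately have "emeasure lborel ?U \<noteq> 0"
  proof -
    assume "open ?U" "(1/2) *\<^sub>R svec (mat 1) \<in> ?U"
    then obtain e where e: "e > 0" "ball ((1/2) *\<^sub>R svec (mat 1)) e \<subseteq> ?U" using open_contains_ball by blast
    have "0 < emeasure lborel (ball ((1/2) *\<^sub>R svec (mat 1) :: real^'p uprod) e)"
      using e(1) by (simp add: emeasure_ball unit_ball_vol_pos)
    also have "\<dots> \<le> emeasure lborel ?U" using e(2) \<open>open ?U\<close> by (intro emeasure_mono) auto
    finally show ?thesis by simp
  qed
  moreover have "emeasure lborel ?U \<le> emeasure lborel (diag_le1 :: (real^'p uprod) set)"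
    by (intro emeasure_mono) (auto simp: diag_le1_def intro: less_imp_le)
  ultimately show "emeasure lborel (diag_le1 :: (real^('p::finite) uprod) set) \<noteq> 0" by auto
  have "(diag_le1 :: (real^'p uprod) set) \<subseteq> cbox (\<chi> e. - 1) (\<chi> e. 1)"
  proof
    fix x :: "real^'p uprod" assume x: "x \<in> diag_le1"
    have "\<bar>x $ e\<bar> \<le> 1" for e
    proof (cases e)
      case (Upair i j)
      have "2 * \<bar>x $ Upair i j\<bar> \<le> x $ Upair i i + x $ Upair j j"
      proof (rule psd_entry_bound)
        show "0 \<le> u \<bullet> (smat x *v u)" for u
          using x by (cases "u = 0") (auto simp: diag_le1_def pd_cone_def posdef_def less_imp_le)
      qed
      also have "\<dots> \<le> 1 + 1" using x by (intro add_mono) (auto simp: diag_le1_def)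
      finally show ?thesis using Upair by simp
    qed
    then show "x \<in> cbox (\<chi> e. - 1) (\<chi> e. 1)" by (auto simp: mem_box_cart abs_le_iff minus_le_iff)
  qed
  then have "emeasure lborel (diag_le1 :: (real^'p uprod) set) \<le> emeasure lborel (cbox (\<chi> e. - 1) (\<chi> e. 1) :: (real^'p uprod) set)"
    by (intro emeasure_mono) auto
  also have "\<dots> < \<infinity>" using emeasure_bounded_finite[OF bounded_cbox] by blast
  finally show "emeasure lborel (diag_le1 :: (real^('p::finite) uprod) set) \<noteq> \<infinity>" by simp
qed

text \<open>Transforming all observations by \<open>g\<close> costs \<open>|det g| ^ n\<close>, and
  restoring the weight \<open>w\<close> of the mean costs one factor \<open>|det g|\<close>. The
  remaining power \<open>n - 1\<close> is cancelled by \<open>det\<close> to the power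
  \<open>- (n - 1) / 2\<close>. The weight keeps the measure finite in the direction of translations
  of the sample, which do not change the covariance.\<close>

lemma data_measure_invariant:
  fixes G :: "real^('p::finite) uprod \<Rightarrow> ennreal" and w :: "real^'p \<Rightarrow> ennreal"
  assumes n: "n > 0" and g: "invertible g"
    and [measurable]: "G \<in> borel_measurable borel" "w \<in> borel_measurable borel"
    and w0: "(\<integral>\<^sup>+x. w x \<partial>lborel) \<noteq> 0" "(\<integral>\<^sup>+x. w x \<partial>lborel) \<noteq> \<infinity>"
  defines "f \<equiv> \<lambda>y. cone_density (- (real n - 1) / 2) (sample_cov n y) * w (sample_mean n y)"
  shows "(\<integral>\<^sup>+y. G (congr g (sample_cov n y)) \<partial>density (data_space n) f) =
    (\<integral>\<^sup>+y. G (sample_cov n y) \<partial>density (data_space n) f)"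
proof -
  let ?a = "- (real n - 1) / 2"
  let ?D = "\<bar>det g\<bar>"
  let ?H = "\<lambda>x. cone_density ?a x * G x"
  let ?v = "\<lambda>x. w (matrix_inv g *v x)"
  have [measurable]: "f \<in> borel_measurable (data_space n)" unfolding f_def by measurable
  have [measurable]: "(\<lambda>y. congr g (sample_cov n y)) \<in> borel_measurable (data_space n)"
    by (rule borel_measurable_congr[OF _ measurable_sample_cov]) simp
  have vm: "?v \<in> borel_measurable borel" by measurable
  have [measurable]: "(\<lambda>y. ?v (sample_mean n y)) \<in> borel_measurable (data_space n)"
    by (rule measurable_compose[OF measurable_sample_mean vm])
  have dg: "?D > 0" using g by (simp add: invertible_det_nz)
  have v: "(\<integral>\<^sup>+x. ?v x \<partial>lborel) = ennreal ?D * (\<integral>\<^sup>+x. w x \<partial>lborel)"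
  proof -
    have "ennreal ?D * (ennreal \<bar>det (matrix_inv g)\<bar> * (\<integral>\<^sup>+x. ?v x \<partial>lborel)) = ennreal ?D * (\<integral>\<^sup>+x. w x \<partial>lborel)"
      by (subst nn_integral_matrix[OF invertible_matrix_inv[OF g]]) auto
    moreover have "ennreal ?D * ennreal \<bar>det (matrix_inv g)\<bar> = 1"
      using dg by (simp add: det_matrix_inv[OF g] ennreal_mult[symmetric])
    ultimately show ?thesis by (simp add: mult.assoc[symmetric])
  qed
  have "(\<integral>\<^sup>+x. w x \<partial>lborel) * (\<integral>\<^sup>+y. ?H (sample_cov n y) * ?v (sample_mean n y) \<partial>data_space n) =
    (\<integral>\<^sup>+x. ?v x \<partial>lborel) * (\<integral>\<^sup>+y. ?H (sample_cov n y) * w (sample_mean n y) \<partial>data_space n)"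
    by (rule sample_mean_weight_change[OF n]) measurable
  then have "(\<integral>\<^sup>+x. w x \<partial>lborel) * (\<integral>\<^sup>+y. ?H (sample_cov n y) * ?v (sample_mean n y) \<partial>data_space n) =
    (\<integral>\<^sup>+x. w x \<partial>lborel) * (ennreal ?D * (\<integral>\<^sup>+y. ?H (sample_cov n y) * w (sample_mean n y) \<partial>data_space n))"
    unfolding v by (simp add: ac_simps)
  then have Hv: "(\<integral>\<^sup>+y. ?H (sample_cov n y) * ?v (sample_mean n y) \<partial>data_space n) =
    ennreal ?D * (\<integral>\<^sup>+y. ?H (sample_cov n y) * w (sample_mean n y) \<partial>data_space n)"
    by (rule mult_cancel_ennreal[OF w0])
  have "ennreal ?D ^ n * (\<integral>\<^sup>+y. ?H (sample_cov n (\<lambda>k. g *v y k)) * ?v (sample_mean n (\<lambda>k. g *v y k)) \<partial>data_space n) =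
    (\<integral>\<^sup>+y. ?H (sample_cov n y) * ?v (sample_mean n y) \<partial>data_space n)"
  proof (rule nn_integral_data_space_map[where F = "\<lambda>y. ?H (sample_cov n y) * ?v (sample_mean n y)"])
    show "?H (sample_cov n (restrict y {1..n})) * ?v (sample_mean n (restrict y {1..n})) = ?H (sample_cov n y) * ?v (sample_mean n y)" for y
      unfolding sample_mean_restrict sample_cov_restrict ..
    have "(\<lambda>y. ?H (sample_cov n y)) \<in> borel_measurable (data_space n)" by measurable
    then show "(\<lambda>y. ?H (sample_cov n y) * ?v (sample_mean n y)) \<in> borel_measurable (data_space n)"
      by (rule borel_measurable_times_ennreal) (rule measurable_compose[OF measurable_sample_mean vm])
  qed (measurable, rule nn_integral_matrix[OF g])
  moreover have "?v (sample_mean n (\<lambda>k. g *v y k)) = w (sample_mean n y)" for y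
    unfolding sample_mean_linear[OF matrix_vector_mul_linear]
    by (simp add: matrix_vector_mul_assoc matrix_inv_cancel[OF g])
  ultimately have *: "ennreal ?D ^ n * (\<integral>\<^sup>+y. ?H (congr g (sample_cov n y)) * w (sample_mean n y) \<partial>data_space n) =
     ennreal ?D * (\<integral>\<^sup>+y. ?H (sample_cov n y) * w (sample_mean n y) \<partial>data_space n)"
    unfolding sample_cov_congr Hv by simp
  have Dn: "ennreal ?D * (ennreal (?D powr (real n - 1))) = ennreal ?D ^ n"
  proof -
    have "?D * ?D powr (real n - 1) = ?D powr 1 * ?D powr (real n - 1)" using dg by simp
    also have "\<dots> = ?D ^ n" using dg by (subst powr_add[symmetric]) (simp add: powr_realpow)
    finally show ?thesis by (simp add: ennreal_mult[symmetric] ennreal_power)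
  qed
  have "(\<integral>\<^sup>+y. G (congr g (sample_cov n y)) \<partial>density (data_space n) f) = 
    (\<integral>\<^sup>+y. f y * G (congr g (sample_cov n y)) \<partial>data_space n)"
    by (rule nn_integral_density) measurable
  also have "\<dots> = (\<integral>\<^sup>+y. ennreal (?D powr (real n - 1)) * (?H (congr g (sample_cov n y)) * w (sample_mean n y)) \<partial>data_space n)"
  proof (rule nn_integral_cong)
    fix y :: "nat \<Rightarrow> real^'p"
    have "?D powr (real n - 1) * ?D powr (2 * ?a) = 1"
      using dg by (subst powr_add[symmetric]) (simp add: field_simps)
    then have "ennreal (?D powr (real n - 1)) * (ennreal (?D powr (2 * ?a)) * c) = c" for c
      by (simp add: mult.assoc[symmetric] ennreal_mult[symmetric])
    then show "f y * G (congr g (sample_cov n y)) = ennreal (?D powr (real n - 1)) * (?H (congr g (sample_cov n y)) * w (sample_mean n y))"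
      unfolding f_def cone_density_congr[OF g] by (simp only: mult.assoc) (simp only: ac_simps)
  qed
  also have "\<dots> = ennreal (?D powr (real n - 1)) * (\<integral>\<^sup>+y. ?H (congr g (sample_cov n y)) * w (sample_mean n y) \<partial>data_space n)"
    by (rule nn_integral_cmult) measurable
  finally have "ennreal ?D * (\<integral>\<^sup>+y. G (congr g (sample_cov n y)) \<partial>density (data_space n) f) =
     ennreal ?D * (\<integral>\<^sup>+y. ?H (sample_cov n y) * w (sample_mean n y) \<partial>data_space n)"
    using * by (simp add: mult.assoc[symmetric] Dn)
  then have "(\<integral>\<^sup>+y. G (congr g (sample_cov n y)) \<partial>density (data_space n) f) = (\<integral>\<^sup>+y. ?H (sample_cov n y) * w (sample_mean n y) \<partial>data_space n)"
    by (rule mult_cancel_ennreal[rotated 2]) (use dg in auto)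
  also have "\<dots> = (\<integral>\<^sup>+y. f y * G (sample_cov n y) \<partial>data_space n)"
    by (simp add: f_def ac_simps)
  also have "\<dots> = (\<integral>\<^sup>+y. G (sample_cov n y) \<partial>density (data_space n) f)"
    by (rule nn_integral_density[symmetric]) measurable
  finally show ?thesis .
qed

text \<open>The image of the weighted data measure under \<open>sample_cov\<close> and
  \<open>cone_measure\<close> are both invariant, hence multiples of the same functional
  \<open>L\<close>. Undoing the two weights leaves the exponent
  \<open>(n - 1) / 2 - (p + 1) / 2\<close>.\<close>

theorem sample_cov_wishart:
  fixes w :: "real^'p::finite \<Rightarrow> ennreal"
  assumes n: "n \<ge> CARD('p) + 1" and w [measurable]: "w \<in> borel_measurable borel" and wfin: "\<And>x. w x \<noteq> \<infinity>"
    and w0: "(\<integral>\<^sup>+x. w x \<partial>lborel) \<noteq> 0" "(\<integral>\<^sup>+x. w x \<partial>lborel) \<noteq> \<infinity>"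
  shows "\<exists>C. \<forall>F \<in> borel_measurable borel.
    (\<integral>\<^sup>+y. F (sample_cov n y) * w (sample_mean n y) \<partial>data_space n) =
    C * (\<integral>\<^sup>+x. F x * cone_density ((real n - real CARD('p) - 2) / 2) x \<partial>lborel)"
proof -
  let ?R = "row_space :: ('p \<Rightarrow> real^'p) measure"
  let ?a = "- (real n - 1) / 2" and ?p = "real CARD('p)"
  have n0: "n > 0" using n by simp
  define f where "f = (\<lambda>y. cone_density ?a (sample_cov n y) * w (sample_mean n y))"
  have f [measurable]: "f \<in> borel_measurable (data_space n)" unfolding f_def by measurable
  let ?N = "density (data_space n) f"
  interpret D: sigma_finite_measure "data_space n :: (nat \<Rightarrow> real^'p) measure"
    by (rule lborel_prod.sigma_finite) simp
  have f_fin: "f y \<noteq> \<infinity>" for y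
    using wfin[of "sample_mean n y"] cone_density_finite[of ?a "sample_cov n y"]
    unfolding f_def by (auto simp: ennreal_mult_eq_top_iff)
  have sfN: "sigma_finite_measure ?N"
    using f_fin by (subst D.sigma_finite_iff_density_finite[OF f]) auto
  have sfM: "sigma_finite_measure (cone_measure :: (real^'p uprod) measure)"
    unfolding cone_measure_def using cone_density_finite
    by (subst sigma_finite_measure.sigma_finite_iff_density_finite[OF sigma_finite_lborel]) auto
  define C0 where "C0 = (\<integral>\<^sup>+\<gamma>. indicator diag_le1 (gram \<gamma>) \<partial>?R)"
  define L where "L F = (\<integral>\<^sup>+\<gamma>. F (gram \<gamma>) * ennreal (\<bar>det (vec_lambda \<gamma>)\<bar> powr (- ?p)) \<partial>?R)" for F
  define \<kappa> where "\<kappa> x = ennreal (det (smat x) powr (- ?p / 2)) * indicator diag_le1 (vinv0 x)" for x :: "real^'p uprod"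
  define K1 where "K1 = (\<integral>\<^sup>+x. \<kappa> x \<partial>cone_measure)"
  define K2 where "K2 = (\<integral>\<^sup>+y. \<kappa> (sample_cov n y) \<partial>?N)"
  have C0: "C0 \<noteq> 0" "C0 \<noteq> \<infinity>" unfolding C0_def by (rule nn_integral_gram_diag_le1)+
  have eqM: "C0 * (\<integral>\<^sup>+x. F x \<partial>cone_measure) = K1 * L F"
    if [measurable]: "F \<in> borel_measurable borel" and F0: "\<And>x. x \<notin> pd_cone \<Longrightarrow> F x = 0" for F
    unfolding C0_def K1_def \<kappa>_def L_def
  proof (rule invariant_integral[OF sfM, where X = "\<lambda>x. x"])
    show "(\<lambda>x. x) \<in> borel_measurable cone_measure" by (simp add: cone_measure_def)
    show "AE x in cone_measure. x \<in> pd_cone"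
      unfolding cone_measure_def
      by (subst AE_density) (auto simp: cone_density_def indicator_def intro!: AE_I2)
  qed (auto simp: cone_measure_invariant F0)
  have eqN: "C0 * (\<integral>\<^sup>+y. F (sample_cov n y) \<partial>?N) = K2 * L F"
    if [measurable]: "F \<in> borel_measurable borel" and F0: "\<And>x. x \<notin> pd_cone \<Longrightarrow> F x = 0" for F
    unfolding C0_def K2_def \<kappa>_def L_def
  proof (rule invariant_integral[OF sfN])
    show "sample_cov n \<in> borel_measurable ?N" by measurable
    show "AE y in ?N. sample_cov n y \<in> pd_cone"
      by (subst AE_density[OF f]) (auto simp: f_def cone_density_def indicator_def intro!: AE_I2)
  qed (use data_measure_invariant[OF n0 _ _ w w0] F0 in \<open>auto simp: f_def\<close>)
  \<comment> \<open>Tested on a function whose integral with respect to \<open>cone_measure\<close>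
    is the Lebesgue measure of \<open>diag_le1\<close>, hence positive and finite.\<close>
  have K1: "K1 \<noteq> 0" "K1 \<noteq> \<infinity>"
  proof -
    let ?F = "\<lambda>x :: real^'p uprod. indicator diag_le1 x * ennreal (det (smat x) powr ((?p + 1) / 2)) :: ennreal"
    have "(\<integral>\<^sup>+x. ?F x \<partial>cone_measure) = (\<integral>\<^sup>+x. cone_density (- (?p + 1) / 2) x * ?F x \<partial>lborel)"
      unfolding cone_measure_def by (subst nn_integral_density) auto
    also have "\<dots> = (\<integral>\<^sup>+x. indicator diag_le1 x \<partial>(lborel :: (real^'p uprod) measure))"
    proof (rule nn_integral_cong)
      fix x :: "real^'p uprod"
      show "cone_density (- (?p + 1) / 2) x * ?F x = indicator diag_le1 x"
      proof (cases "x \<in> diag_le1")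
        case True
        then have x: "x \<in> pd_cone" by (simp add: diag_le1_def)
        then have "cone_density (- (?p + 1) / 2) x * ?F x = cone_density (- (?p + 1) / 2 + (?p + 1) / 2) x"
          using True by (subst cone_density_mult[symmetric]) simp
        also have "- (?p + 1) / 2 + (?p + 1) / 2 = 0" by (simp add: field_simps)
        also have "cone_density 0 x = 1" using x pd_cone_det_pos[OF x] by (simp add: cone_density_def)
        finally show ?thesis using True by simp
      qed simp
    qed
    also have "\<dots> = emeasure lborel (diag_le1 :: (real^'p uprod) set)" by simp
    finally have I: "(\<integral>\<^sup>+x. ?F x \<partial>cone_measure) \<noteq> 0" "(\<integral>\<^sup>+x. ?F x \<partial>cone_measure) \<noteq> \<infinity>"
      using emeasure_diag_le1 by simp_all
    have eq: "C0 * (\<integral>\<^sup>+x. ?F x \<partial>cone_measure) = K1 * L ?F"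
      by (rule eqM) (auto simp: diag_le1_def)
    then have "K1 * L ?F \<noteq> 0" "K1 * L ?F \<noteq> \<infinity>" 
      using C0 I by (auto simp: ennreal_mult_eq_top_iff simp flip: eq)
    then show "K1 \<noteq> 0" "K1 \<noteq> \<infinity>" by (auto simp: ennreal_mult_eq_top_iff)
  qed
  show ?thesis
  proof (intro exI[of _ "K2 / K1"] ballI)
    fix F :: "real^'p uprod \<Rightarrow> ennreal" assume F [measurable]: "F \<in> borel_measurable borel"
    \<comment> \<open>The factor removes the weight \<open>det powr (- (n - 1) / 2)\<close> in
      \<open>f\<close>; it also makes \<open>G\<close> vanish outside the cone.\<close>
    define G where "G x = F x * cone_density ((real n - 1) / 2) x" for x
    have G [measurable]: "G \<in> borel_measurable borel" unfolding G_def by measurable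
    have G0: "x \<notin> pd_cone \<Longrightarrow> G x = 0" for x by (simp add: G_def cone_density_def)
    have cd: "cone_density a x * cone_density b x = cone_density (a + b) x" for a b and x :: "real^'p uprod"
      by (cases "x \<in> pd_cone") (simp_all add: cone_density_def powr_add ennreal_mult)
    have "(\<integral>\<^sup>+y. G (sample_cov n y) \<partial>?N) = (\<integral>\<^sup>+y. f y * G (sample_cov n y) \<partial>data_space n)"
      by (rule nn_integral_density) measurable
    also have "\<dots> = (\<integral>\<^sup>+y. F (sample_cov n y) * w (sample_mean n y) \<partial>data_space n)"
    proof (rule nn_integral_cong_AE)
      show "AE y in data_space n. f y * G (sample_cov n y) = F (sample_cov n y) * w (sample_mean n y)"
        using AE_sample_cov_pd_cone[OF n]
      proof eventually_elim
        fix y :: "nat \<Rightarrow> real^'p" assume y: "sample_cov n y \<in> pd_cone"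
        have "f y * G (sample_cov n y) = F (sample_cov n y) * w (sample_mean n y) * (cone_density ?a (sample_cov n y) * cone_density ((real n - 1) / 2) (sample_cov n y))"
          by (simp add: f_def G_def ac_simps)
        also have "cone_density ?a (sample_cov n y) * cone_density ((real n - 1) / 2) (sample_cov n y) = 1"
        proof -
          have "?a + (real n - 1) / 2 = 0" by (simp add: field_simps)
          then show ?thesis unfolding cd using y pd_cone_det_pos[OF y] by (simp only: cone_density_def) simp
        qed
        finally show "f y * G (sample_cov n y) = F (sample_cov n y) * w (sample_mean n y)" by simp
      qed
    qed
    finally have N: "(\<integral>\<^sup>+y. G (sample_cov n y) \<partial>?N) = (\<integral>\<^sup>+y. F (sample_cov n y) * w (sample_mean n y) \<partial>data_space n)" .
    have "(\<integral>\<^sup>+x. G x \<partial>cone_measure) = (\<integral>\<^sup>+x. cone_density (- (?p + 1) / 2) x * G x \<partial>lborel)"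
      unfolding cone_measure_def by (subst nn_integral_density) auto
    also have "\<dots> = (\<integral>\<^sup>+x. F x * cone_density ((real n - ?p - 2) / 2) x \<partial>lborel)"
    proof (rule nn_integral_cong)
      fix x :: "real^'p uprod"
      have "cone_density (- (?p + 1) / 2) x * G x = F x * (cone_density (- (?p + 1) / 2) x * cone_density ((real n - 1) / 2) x)"
        by (simp add: G_def ac_simps)
      also have "cone_density (- (?p + 1) / 2) x * cone_density ((real n - 1) / 2) x = cone_density ((real n - ?p - 2) / 2) x"
      proof -
        have "- (?p + 1) / 2 + (real n - 1) / 2 = (real n - ?p - 2) / 2" by (simp add: field_simps)
        then show ?thesis unfolding cd by (simp only:)
      qed
      finally show "cone_density (- (?p + 1) / 2) x * G x = F x * cone_density ((real n - ?p - 2) / 2) x" .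
    qed
    finally have M: "(\<integral>\<^sup>+x. G x \<partial>cone_measure) = (\<integral>\<^sup>+x. F x * cone_density ((real n - ?p - 2) / 2) x \<partial>lborel)" .
    let ?A = "(\<integral>\<^sup>+y. F (sample_cov n y) * w (sample_mean n y) \<partial>data_space n)"
    let ?B = "(\<integral>\<^sup>+x. F x * cone_density ((real n - ?p - 2) / 2) x \<partial>lborel)"
    have e1: "C0 * ?A = K2 * L G" unfolding N[symmetric] by (rule eqN[OF G]) (rule G0)
    have e2: "C0 * ?B = K1 * L G" unfolding M[symmetric] by (rule eqM[OF G]) (rule G0)
    have "C0 * (K1 * ?A) = K1 * (C0 * ?A)" by (rule mult.left_commute)
    also have "\<dots> = K2 * (C0 * ?B)" unfolding e1 e2 by (rule mult.left_commute)
    also have "\<dots> = C0 * (K2 * ?B)" by (rule mult.left_commute)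
    finally have "K1 * ?A = K2 * ?B" by (rule mult_cancel_ennreal[OF C0])
    also have "\<dots> = K1 * (K2 / K1 * ?B)"
    proof -
      have "K1 * (K2 / K1) = K2"
        using K1 ennreal_mult_divide_eq[of K1 K2] unfolding ennreal_times_divide mult.commute[of K1] by simp
      then show ?thesis by (simp add: mult.assoc[symmetric])
    qed
    finally show "?A = K2 / K1 * ?B" by (rule mult_cancel_ennreal[OF K1])
  qed
qed

subsection \<open>Sliding along rays through the completion\<close>

text \<open>Product form of Lebesgue measure, through which the coordinates in \<open>E\<close> can
  be integrated separately from the others.\<close>

lemma lborel_vec_PiM: "(lborel :: (real^'n) measure) = distr (PiM UNIV (\<lambda>_. lborel)) borel vec_lambda"
proof (rule lborel_eqI)
  have m: "(vec_lambda :: ('n \<Rightarrow> real) \<Rightarrow> real^'n) \<in> borel_measurable (PiM UNIV (\<lambda>_. lborel))"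
    by (rule borel_measurable_vecI) simp
  fix l u :: "real^'n" assume le: "\<And>b. b \<in> Basis \<Longrightarrow> l \<bullet> b \<le> u \<bullet> b"
  have le': "l $ i \<le> u $ i" for i
    using le[of "axis i 1"] by (simp add: inner_axis axis_in_Basis_iff)
  have "emeasure (distr (PiM UNIV (\<lambda>_. lborel)) borel (vec_lambda :: _ \<Rightarrow> real^'n)) (box l u) =
    emeasure (PiM UNIV (\<lambda>_. lborel)) (PiE UNIV (\<lambda>i. {l $ i <..< u $ i}))"
    by (subst emeasure_distr[OF m]) (auto simp: mem_box_cart space_PiM PiE_iff intro!: arg_cong[where f = "emeasure _"])
  also have "\<dots> = (\<Prod>i\<in>UNIV. emeasure lborel {l $ i <..< u $ i})"
    by (intro lborel_prod.emeasure_PiM) auto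
  also have "\<dots> = ennreal (\<Prod>i\<in>UNIV. u $ i - l $ i)"
    using le' by (simp add: prod_ennreal)
  also have "(\<Prod>i\<in>UNIV. u $ i - l $ i) = (\<Prod>b\<in>Basis. (u - l) \<bullet> b)"
  proof -
    have B: "(Basis :: (real^'n) set) = (\<lambda>i. axis i 1) ` UNIV" by (auto simp: Basis_vec_def)
    have inj: "inj (\<lambda>i::'n. axis i (1::real))" by (simp add: inj_def axis_eq_axis)
    show ?thesis unfolding B by (simp add: prod.reindex[OF inj] inner_axis)
  qed
  finally show "emeasure (distr (PiM UNIV (\<lambda>_. lborel)) borel (vec_lambda :: _ \<Rightarrow> real^'n)) (box l u) = ennreal (\<Prod>b\<in>Basis. (u - l) \<bullet> b)" .
qed simp

text \<open>The line from the completion (\<open>t = 0\<close>) through \<open>x\<close>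
  (\<open>t = 1\<close>). For \<open>x\<close> the sample covariance it is the covariance fitted at
  \<open>s(t)\<close> on the directional path.\<close>

definition slide :: "('p::finite) uprod set \<Rightarrow> real \<Rightarrow> real^'p uprod \<Rightarrow> real^'p uprod" where
  "slide E t x = pd_completion E x + t *\<^sub>R (x - pd_completion E x)"

lemma slide_nth: "slide E t x $ e = pd_completion E x $ e + t * (x $ e - pd_completion E x $ e)"
  by (simp add: slide_def)

lemma slide_nth_off: "e \<notin> E \<Longrightarrow> slide E t x $ e = x $ e"
  by (simp add: slide_nth pd_completion_nth)

lemma pd_completion_slide [simp]: "pd_completion E (slide E t x) = pd_completion E x"
  by (rule pd_completion_cong) (simp add: off_def vec_eq_iff slide_nth_off)

lemma slide_slide [simp]: "slide E s (slide E t x) = slide E (s * t) x"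
  unfolding slide_def[of E s] pd_completion_slide by (simp add: slide_def)

lemma slide_1 [simp]: "slide E 1 x = x"
  by (simp add: slide_def)

lemma measurable_slide [measurable (raw)]:
  assumes [measurable]: "t \<in> borel_measurable M" "f \<in> borel_measurable M"
  shows "(\<lambda>y. slide E (t y) (f y)) \<in> borel_measurable M"
proof -
  have [measurable]: "(\<lambda>y. pd_completion E (f y)) \<in> borel_measurable M"
    by (rule measurable_compose[OF assms(2) measurable_pd_completion])
  show ?thesis unfolding slide_def by measurable
qed

text \<open>With the entries outside \<open>E\<close> held fixed, the completion is a constant
  \<open>c\<close> and \<open>slide E t\<close> is the dilation about \<open>c\<close> with ratio
  \<open>t\<close> in \<open>card E\<close> coordinates.\<close>

lemma nn_integral_slide:
  fixes F :: "real^('p::finite) uprod \<Rightarrow> ennreal"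
  assumes t: "t \<noteq> 0" and F [measurable]: "F \<in> borel_measurable borel"
  shows "ennreal (\<bar>t\<bar> ^ card E) * (\<integral>\<^sup>+x. F (slide E t x) \<partial>lborel) = (\<integral>\<^sup>+x. F x \<partial>lborel)"
proof -
  have vl [measurable]: "(vec_lambda :: _ \<Rightarrow> real^'p uprod) \<in> borel_measurable (PiM UNIV (\<lambda>_. lborel))"
    by (rule borel_measurable_vecI) simp
  have U: "- E \<union> E = UNIV" by simp
  have split: "(\<integral>\<^sup>+x. G x \<partial>lborel) = (\<integral>\<^sup>+u. (\<integral>\<^sup>+v. G (vec_lambda (merge (- E) E (u, v))) \<partial>PiM E (\<lambda>_. lborel)) \<partial>PiM (- E) (\<lambda>_. lborel))"
    if [measurable]: "G \<in> borel_measurable borel" for G :: "real^'p uprod \<Rightarrow> ennreal"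
  proof -
    have "(\<integral>\<^sup>+x. G x \<partial>lborel) = (\<integral>\<^sup>+z. G (vec_lambda z) \<partial>PiM (- E \<union> E) (\<lambda>_. lborel))"
      unfolding U by (subst lborel_vec_PiM) (simp add: nn_integral_distr)
    also have "\<dots> = (\<integral>\<^sup>+u. (\<integral>\<^sup>+v. G (vec_lambda (merge (- E) E (u, v))) \<partial>PiM E (\<lambda>_. lborel)) \<partial>PiM (- E) (\<lambda>_. lborel))"
    proof (rule lborel_prod.product_nn_integral_fold)
      show "(\<lambda>z. G (vec_lambda z)) \<in> borel_measurable (PiM (- E \<union> E) (\<lambda>_. lborel))"
        unfolding U by measurable
    qed auto
    finally show ?thesis .
  qed
  have inner: "ennreal (\<bar>t\<bar> ^ card E) * (\<integral>\<^sup>+v. F (slide E t (vec_lambda (merge (- E) E (u, v)))) \<partial>PiM E (\<lambda>_. lborel)) =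
    (\<integral>\<^sup>+v. F (vec_lambda (merge (- E) E (u, v))) \<partial>PiM E (\<lambda>_. lborel))"
    if u: "u \<in> space (PiM (- E) (\<lambda>_. lborel))" for u
  proof -
    \<comment> \<open>The entries in \<open>E\<close> are set to 0 only to name a representative;
      the completion does not depend on them.\<close>
    define c where "c = pd_completion E (vec_lambda (merge (- E) E (u, \<lambda>_. 0)))"
    have c: "pd_completion E (vec_lambda (merge (- E) E (u, v))) = c" for v
      unfolding c_def by (rule pd_completion_cong) (simp add: off_def vec_eq_iff merge_def)
    have s: "slide E t (vec_lambda (merge (- E) E (u, v))) = vec_lambda (merge (- E) E (u, \<lambda>e\<in>E. c $ e + t * (v e - c $ e)))" for v
    proof -
      have "slide E t (vec_lambda (merge (- E) E (u, v))) $ e = merge (- E) E (u, \<lambda>e\<in>E. c $ e + t * (v e - c $ e)) e" for e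
      proof (cases "e \<in> E")
        case True then show ?thesis unfolding slide_nth c by (simp add: merge_def)
      next
        case False then show ?thesis by (simp add: slide_nth_off merge_def)
      qed
      then show ?thesis by (simp add: vec_eq_iff)
    qed
    have "(\<lambda>v. merge (- E) E (u, v)) \<in> measurable (PiM E (\<lambda>_. lborel)) (PiM (- E \<union> E) (\<lambda>_. lborel))"
      using u by (intro measurable_compose[OF measurable_Pair measurable_merge]) auto
    then have [measurable]: "(\<lambda>v. merge (- E) E (u, v)) \<in> measurable (PiM E (\<lambda>_. lborel)) (PiM UNIV (\<lambda>_. lborel :: real measure))"
      unfolding U .
    have "ennreal \<bar>t\<bar> ^ card E * (\<integral>\<^sup>+v. F (vec_lambda (merge (- E) E (u, \<lambda>e\<in>E. c $ e + t * (v e - c $ e)))) \<partial>PiM E (\<lambda>_. lborel)) =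
      (\<integral>\<^sup>+v. F (vec_lambda (merge (- E) E (u, v))) \<partial>PiM E (\<lambda>_. lborel))"
    proof (rule nn_integral_PiM_map[where h = "\<lambda>e r. c $ e + t * (r - c $ e)" and F = "\<lambda>v. F (vec_lambda (merge (- E) E (u, v)))"])
      fix e and G :: "real \<Rightarrow> ennreal" assume G: "G \<in> borel_measurable borel"
      show "ennreal \<bar>t\<bar> * (\<integral>\<^sup>+x. G (c $ e + t * (x - c $ e)) \<partial>lborel) = integral\<^sup>N lborel G"
        using nn_integral_real_affine[OF G t, of "c $ e - t * c $ e"] by (simp add: algebra_simps)
    qed (auto simp: )
    then show ?thesis unfolding s ennreal_power[OF abs_ge_zero, symmetric] .
  qed
  have [measurable]: "(\<lambda>x. F (slide E t x)) \<in> borel_measurable borel" by measurable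
  have mm: "(\<lambda>u. \<integral>\<^sup>+v. F (slide E t (vec_lambda (merge (- E) E (u, v)))) \<partial>PiM E (\<lambda>_. lborel)) \<in> borel_measurable (PiM (- E) (\<lambda>_. lborel))"
  proof -
    interpret sigma_finite_measure "PiM E (\<lambda>_. lborel :: real measure)" by (rule lborel_prod.sigma_finite) simp
    have "merge (- E) E \<in> measurable (PiM (- E) (\<lambda>_. lborel) \<Otimes>\<^sub>M PiM E (\<lambda>_. lborel)) (PiM (- E \<union> E) (\<lambda>_. lborel :: real measure))"
      by (rule measurable_merge)
    then have [measurable]: "merge (- E) E \<in> measurable (PiM (- E) (\<lambda>_. lborel) \<Otimes>\<^sub>M PiM E (\<lambda>_. lborel)) (PiM UNIV (\<lambda>_. lborel :: real measure))"
      unfolding U .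
    have "(\<lambda>z. F (slide E t (vec_lambda (merge (- E) E z)))) \<in> borel_measurable (PiM (- E) (\<lambda>_. lborel) \<Otimes>\<^sub>M PiM E (\<lambda>_. lborel))"
      by measurable
    then show ?thesis by (intro borel_measurable_nn_integral) (simp add: split_def)
  qed
  have "ennreal (\<bar>t\<bar> ^ card E) * (\<integral>\<^sup>+x. F (slide E t x) \<partial>lborel) =
    (\<integral>\<^sup>+u. ennreal (\<bar>t\<bar> ^ card E) * (\<integral>\<^sup>+v. F (slide E t (vec_lambda (merge (- E) E (u, v)))) \<partial>PiM E (\<lambda>_. lborel)) \<partial>PiM (- E) (\<lambda>_. lborel))"
    by (subst split) (auto intro!: nn_integral_cmult[symmetric] mm)
  also have "\<dots> = (\<integral>\<^sup>+u. (\<integral>\<^sup>+v. F (vec_lambda (merge (- E) E (u, v))) \<partial>PiM E (\<lambda>_. lborel)) \<partial>PiM (- E) (\<lambda>_. lborel))"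
    by (rule nn_integral_cong) (rule inner)
  also have "\<dots> = (\<integral>\<^sup>+x. F x \<partial>lborel)" by (rule split[symmetric]) measurable
  finally show ?thesis .
qed

lemma nn_integral_inversion:
  fixes \<phi> :: "real \<Rightarrow> ennreal"
  assumes \<phi> [measurable]: "\<phi> \<in> borel_measurable borel"
  shows "(\<integral>\<^sup>+t. indicator {0<..} t * ennreal (1 / t\<^sup>2) * \<phi> (1 / t) \<partial>lborel) = (\<integral>\<^sup>+s. indicator {0<..} s * \<phi> s \<partial>lborel)"
proof -
  let ?M = "distr (density lborel (\<lambda>t. indicator {0<..} t * ennreal (1 / t\<^sup>2))) borel (\<lambda>t. 1 / t) :: real measure"
  let ?N = "density lborel (indicator {0<..}) :: real measure"
  have "?M = ?N"
  proof (rule measure_eqI)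
    fix A :: "real set" assume "A \<in> sets ?M"
    then have A [measurable]: "A \<in> sets borel" by simp
    \<comment> \<open>Compact intervals that exhaust the half-line and are mapped onto themselves by
      inversion.\<close>
    define J where "J k = {1 / real (Suc k) .. real (Suc k)}" for k
    have J: "incseq J" "(\<Union>k. J k) = {0<..}"
    proof -
      show "incseq J" unfolding J_def incseq_def by (auto simp: frac_le elim!: order_trans[rotated] intro: order_trans)
      show "(\<Union>k. J k) = {0<..}"
      proof safe
        fix x k assume "x \<in> J k"
        then have "0 < 1 / real (Suc k)" "1 / real (Suc k) \<le> x" by (auto simp: J_def)
        then show "0 < x" by linarith
      next
        fix x :: real assume x: "0 < x"
        obtain k where k: "max x (1 / x) < real k" using reals_Archimedean2 by blast
        then have "x \<le> real (Suc k)" "1 / x \<le> real (Suc k)" by auto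
        then have "x \<in> J k" using x by (auto simp: J_def field_simps)
        then show "x \<in> (\<Union>k. J k)" by blast
      qed
    qed
    have Jm [measurable]: "J k \<in> sets borel" for k by (simp add: J_def)
    have eq: "(\<integral>\<^sup>+t. indicator (J k) t * (ennreal (1 / t\<^sup>2) * indicator A (1 / t)) \<partial>lborel) = (\<integral>\<^sup>+s. indicator (J k) s * indicator A s \<partial>lborel)" for k
    proof -
      let ?a = "1 / real (Suc k)" and ?b = "real (Suc k)"
      \<comment> \<open>The substitution is made with the increasing map \<open>- 1 / x\<close> and
        followed by a reflection; hence the minus sign.\<close>
      let ?f = "\<lambda>y. indicator A (- y) :: real"
      have ab: "?a \<le> ?b" by (simp add: field_simps)
      have a0: "?a > 0" by simp
      have "(\<integral>\<^sup>+x. ?f x * indicator {- 1 / ?a .. - 1 / ?b} x \<partial>lborel) =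
             (\<integral>\<^sup>+x. ?f (- 1 / x) * (1 / x\<^sup>2) * indicator {?a..?b} x \<partial>lborel)"
      proof (rule nn_integral_substitution[where g = "\<lambda>x. - 1 / x"])
        show "set_borel_measurable borel {- 1 / ?a .. - 1 / ?b} ?f"
          unfolding set_borel_measurable_def by measurable
        show "((\<lambda>x. - 1 / x) has_real_derivative 1 / x\<^sup>2) (at x)" if "x \<in> {?a..?b}" for x
        proof -
          have "x \<noteq> 0" using that a0 by auto
          then show ?thesis by (auto intro!: derivative_eq_intros simp: power2_eq_square)
        qed
        show "continuous_on {?a..?b} (\<lambda>x. 1 / x\<^sup>2)"
          using a0 by (intro continuous_intros) auto
      qed (use ab in auto)
      moreover have "(\<integral>\<^sup>+x. ?f x * indicator {- 1 / ?a .. - 1 / ?b} x \<partial>lborel) = (\<integral>\<^sup>+s. indicator (J k) s * indicator A s \<partial>lborel)"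
      proof -
        have "(\<integral>\<^sup>+x. ennreal (?f x * indicator {- 1 / ?a .. - 1 / ?b} x) \<partial>lborel) = (\<integral>\<^sup>+x. ennreal (?f (0 - x) * indicator {- 1 / ?a .. - 1 / ?b} (0 - x)) \<partial>lborel)"
          by (rule nn_integral_lborel_reflect[symmetric]) measurable
        also have "\<dots> = (\<integral>\<^sup>+s. indicator (J k) s * indicator A s \<partial>lborel)"
          by (intro nn_integral_cong) (auto simp: J_def indicator_def)
        finally show ?thesis .
      qed
      moreover have "(\<integral>\<^sup>+x. ?f (- 1 / x) * (1 / x\<^sup>2) * indicator {?a..?b} x \<partial>lborel) = (\<integral>\<^sup>+t. indicator (J k) t * (ennreal (1 / t\<^sup>2) * indicator A (1 / t)) \<partial>lborel)"
        by (intro nn_integral_cong) (auto simp: J_def indicator_def)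
      ultimately show ?thesis by simp
    qed
    have lim: "(\<integral>\<^sup>+t. indicator {0<..} t * G t \<partial>lborel) = (SUP k. \<integral>\<^sup>+t. indicator (J k) t * G t \<partial>lborel)"
      if [measurable]: "G \<in> borel_measurable borel" for G :: "real \<Rightarrow> ennreal"
    proof -
      have "(\<integral>\<^sup>+t. indicator {0<..} t * G t \<partial>lborel) = emeasure (density lborel G) (\<Union>k. J k)"
        unfolding J(2) by (subst emeasure_density) (auto simp: mult.commute)
      also have "\<dots> = (SUP k. emeasure (density lborel G) (J k))"
        using J(1) by (intro SUP_emeasure_incseq[symmetric]) auto
      also have "\<dots> = (SUP k. \<integral>\<^sup>+t. indicator (J k) t * G t \<partial>lborel)"
        by (intro SUP_cong refl, subst emeasure_density) (auto simp: mult.commute)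
      finally show ?thesis .
    qed
    have "emeasure ?M A = (\<integral>\<^sup>+t. indicator {0<..} t * (ennreal (1 / t\<^sup>2) * indicator A (1 / t)) \<partial>lborel)"
      by (subst nn_integral_indicator[symmetric], simp, subst nn_integral_distr, simp, simp, subst nn_integral_density) (auto simp: mult.assoc)
    also have "\<dots> = (\<integral>\<^sup>+t. indicator {0<..} t * indicator A t \<partial>lborel)"
      by (subst (1 2) lim) (auto simp: eq)
    also have "\<dots> = emeasure ?N A"
      by (subst emeasure_density) auto
    finally show "emeasure ?M A = emeasure ?N A" .
  qed simp
  then have "integral\<^sup>N ?M \<phi> = integral\<^sup>N ?N \<phi>" by simp
  also have "integral\<^sup>N ?M \<phi> = (\<integral>\<^sup>+t. indicator {0<..} t * ennreal (1 / t\<^sup>2) * \<phi> (1 / t) \<partial>lborel)"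
    by (subst nn_integral_distr, simp, simp, subst nn_integral_density) auto
  also have "integral\<^sup>N ?N \<phi> = (\<integral>\<^sup>+s. indicator {0<..} s * \<phi> s \<partial>lborel)"
    by (subst nn_integral_density) auto
  finally show ?thesis .
qed

text \<open>The probability integral transform for the survival function \<open>G t / G 0\<close> of
  the density proportional to \<open>\<rho>\<close> on the positive half-line. The law has no atoms,
  so its distribution function is continuous and takes every intermediate value.\<close>

lemma tail_quantile_transform:
  fixes \<rho> :: "real \<Rightarrow> ennreal"
  defines "G \<equiv> \<lambda>r. \<integral>\<^sup>+t. indicator {r<..} t * \<rho> t \<partial>lborel"
  assumes \<rho> [measurable]: "\<rho> \<in> borel_measurable borel"
    and G0: "G 0 \<noteq> 0" "G 0 \<noteq> \<infinity>" and u: "0 < u" "u < 1"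
  shows "(\<integral>\<^sup>+t. indicator {0<..} t * \<rho> t * indicator {..u} (enn2real (G t) / enn2real (G 0)) \<partial>lborel) = ennreal u * G 0"
proof -
  define M where "M = density lborel (\<lambda>t. indicator {0<..} t * \<rho> t)"
  have Ms [simp]: "sets M = sets borel" "space M = UNIV" by (simp_all add: M_def)
  have eM: "emeasure M A = (\<integral>\<^sup>+t. indicator {0<..} t * \<rho> t * indicator A t \<partial>lborel)" if "A \<in> sets borel" for A
    unfolding M_def using that by (subst emeasure_density) auto
  have MU: "emeasure M UNIV = G 0" by (subst eM) (simp_all add: G_def)
  have "finite_measure M" using G0 MU by (intro finite_measureI) simp
  then interpret finite_borel_measure M
    by (intro finite_borel_measure.intro finite_borel_measure_axioms.intro) simp_all
  define g where "g = enn2real (G 0)"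
  have g: "G 0 = ennreal g" "g > 0" using G0 by (simp_all add: g_def enn2real_positive_iff top.not_eq_extremum less_top zero_less_iff_neq_zero)
  have mU: "measure M UNIV = g" by (simp add: measure_def MU g_def)
  have atom: "measure M {x} = 0" for x
  proof -
    have "emeasure M {x} = (\<integral>\<^sup>+t. 0 \<partial>(lborel :: real measure))"
    proof (subst eM, simp, rule nn_integral_cong_AE)
      have "AE t in lborel. t \<noteq> x" by (rule AE_lborel_singleton)
      then show "AE t in lborel. indicator {0<..} t * \<rho> t * indicator {x} t = 0" by eventually_elim simp
    qed
    then show ?thesis by (simp add: measure_def)
  qed
  have cont: "isCont (cdf M) x" for x by (simp add: isCont_cdf atom)
  have Gt: "enn2real (G t) = g - cdf M t" if "t \<ge> 0" for t
  proof -
    have "G t = emeasure M {t<..}"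
      unfolding G_def using that by (subst eM) (auto intro!: nn_integral_cong simp: indicator_def)
    then have "enn2real (G t) = measure M {t<..}" by (simp add: measure_def)
    also have "{t<..} = UNIV - {..t}" by auto
    also have "measure M \<dots> = measure M UNIV - measure M {..t}" by (intro finite_measure_Diff) auto
    finally show ?thesis by (simp add: mU cdf_def2)
  qed
  \<comment> \<open>The level at which \<open>G t / G 0 \<le> u\<close> becomes
    \<open>q \<le> cdf M t\<close>, since \<open>G t\<close> is \<open>g - cdf M t\<close>.\<close>
  define q where "q = (1 - u) * g"
  have q: "0 < q" "q < g" using u g by (simp_all add: q_def)
  define S where "S = {t. q \<le> cdf M t}"
  have "closed S" unfolding S_def
    by (intro closed_Collect_le continuous_intros) (simp add: continuous_at_imp_continuous_on cont)
  have "eventually (\<lambda>t. q < cdf M t) at_top"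
    using cdf_lim_at_top q mU by (intro order_tendstoD) auto
  then have "S \<noteq> {}" unfolding S_def using eventually_happens[of _ "at_top :: real filter"] less_imp_le by fastforce
  have "eventually (\<lambda>t. cdf M t < q) at_bot"
    using cdf_lim_at_bot q by (intro order_tendstoD) auto
  then obtain b where b: "\<And>t. t \<le> b \<Longrightarrow> cdf M t < q" unfolding eventually_at_bot_linorder by blast
  have bdd: "bdd_below S" 
  proof (rule bdd_belowI[of _ b])
    fix x assume "x \<in> S"
    then show "b \<le> x" using b[of x] by (cases "x \<le> b") (auto simp: S_def)
  qed
  \<comment> \<open>The distribution function may be constant on intervals, so the smallest point at
    level \<open>q\<close> is taken; continuity from the left gives the value \<open>q\<close>
    there.\<close>
  define t0 where "t0 = Inf S"
  have t0S: "t0 \<in> S" unfolding t0_def by (rule closed_contains_Inf) fact+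
  have lt: "cdf M t < q" if "t < t0" for t
    using cInf_lower[of t S] that bdd by (force simp: t0_def S_def)
  have "cdf M t0 \<le> q"
  proof (rule tendsto_upperbound)
    show "(cdf M \<longlongrightarrow> cdf M t0) (at_left t0)" using cont[of t0] by (simp add: isCont_def filterlim_at_split)
    show "eventually (\<lambda>t. cdf M t \<le> q) (at_left t0)"
      unfolding eventually_at_left_field by (meson lt less_imp_le lt_ex)
  qed simp
  then have ct0: "cdf M t0 = q" using t0S by (simp add: S_def)
  have iff: "enn2real (G t) / enn2real (G 0) \<le> u \<longleftrightarrow> t0 \<le> t" if "t > 0" for t
  proof -
    have "enn2real (G t) / enn2real (G 0) \<le> u \<longleftrightarrow> g - cdf M t \<le> u * g"
      using that g by (simp add: Gt g_def[symmetric] divide_le_eq)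
    also have "\<dots> \<longleftrightarrow> q \<le> cdf M t" by (auto simp: q_def algebra_simps)
    also have "\<dots> \<longleftrightarrow> t0 \<le> t" using lt[of t] cdf_nondecreasing[of t0 t] ct0 by (auto simp: not_less[symmetric])
    finally show ?thesis .
  qed
  have "(\<integral>\<^sup>+t. indicator {0<..} t * \<rho> t * indicator {..u} (enn2real (G t) / enn2real (G 0)) \<partial>lborel) = 
    (\<integral>\<^sup>+t. indicator {0<..} t * \<rho> t * indicator {t0..} t \<partial>lborel)"
    by (intro nn_integral_cong) (use iff in \<open>auto simp: indicator_def\<close>)
  also have "\<dots> = emeasure M {t0..}" by (subst eM) auto
  also have "\<dots> = ennreal (measure M {t0..})" by (simp add: emeasure_eq_measure)
  also have "measure M {t0..} = u * g"
  proof -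
    have "measure M {t0..} = measure M ({t0} \<union> (UNIV - {..t0}))" by (rule arg_cong[where f = "measure M"]) auto
    also have "\<dots> = measure M {t0} + (measure M UNIV - measure M {..t0})"
      by (subst finite_measure_Union) (auto simp: finite_measure_Diff)
    finally show ?thesis by (simp add: atom mU cdf_def2[symmetric] ct0 q_def algebra_simps)
  qed
  finally show ?thesis using u g by (simp add: ennreal_mult)
qed

subsection \<open>The radial p-value\<close>

text \<open>The integral of the directional p-value without its constants. The upper limit is
  implicit: \<open>cone_density\<close> vanishes where the line is outside the cone.\<close>

definition tail :: "('p::finite) uprod set \<Rightarrow> real \<Rightarrow> real \<Rightarrow> real^'p uprod \<Rightarrow> ennreal" where
  "tail E a r x = (\<integral>\<^sup>+t. indicator {r<..} t * (ennreal (t ^ (card E - 1)) * cone_density a (slide E t x)) \<partial>lborel)"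

definition radial_pvalue :: "('p::finite) uprod set \<Rightarrow> real \<Rightarrow> real^'p uprod \<Rightarrow> real" where
  "radial_pvalue E a x = enn2real (tail E a 1 x) / enn2real (tail E a 0 x)"

lemma measurable_tail [measurable]: "tail E a r \<in> borel_measurable borel"
proof -
  have "(\<lambda>x. \<integral>\<^sup>+t. indicator {r<..} t * (ennreal (t ^ (card E - 1)) * cone_density a (slide E t x)) \<partial>lborel)
     \<in> borel_measurable borel"
    by (rule sigma_finite_measure.borel_measurable_nn_integral[OF sigma_finite_lborel]) (simp add: split_def)
  then show ?thesis by (simp add: tail_def[abs_def])
qed

lemma measurable_radial_pvalue [measurable]: "radial_pvalue E a \<in> borel_measurable borel"
  unfolding radial_pvalue_def[abs_def] by measurable

text \<open>The substitution of \<open>s * t\<close> for \<open>t\<close>: the differential and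
  \<open>t ^ (card E - 1)\<close> together contribute \<open>s ^ card E\<close>.\<close>

lemma tail_slide:
  assumes s: "s > 0" and E: "E \<noteq> {}"
  shows "ennreal (s ^ card E) * tail E a r (slide E s x) = tail E a (r * s) x"
proof -
  have cE: "card E = Suc (card E - 1)" using E by (metis Suc_pred' card_gt_0_iff finite)
  have "tail E a (r * s) x = ennreal s * (\<integral>\<^sup>+t. indicator {r * s<..} (s * t) * (ennreal ((s * t) ^ (card E - 1)) * cone_density a (slide E (s * t) x)) \<partial>lborel)"
    unfolding tail_def
    by (subst nn_integral_real_affine[where c = s and t = 0]) (use s in auto)
  also have "(\<integral>\<^sup>+t. indicator {r * s<..} (s * t) * (ennreal ((s * t) ^ (card E - 1)) * cone_density a (slide E (s * t) x)) \<partial>lborel) =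
    (\<integral>\<^sup>+t. ennreal (s ^ (card E - 1)) * (indicator {r<..} t * (ennreal (t ^ (card E - 1)) * cone_density a (slide E t (slide E s x)))) \<partial>lborel)"
  proof (rule nn_integral_cong)
    fix t
    have "indicator {r * s<..} (s * t) = (indicator {r<..} t :: ennreal)"
      using s by (simp add: indicator_def mult.commute)
    moreover have "ennreal ((s * t) ^ (card E - 1)) = ennreal (s ^ (card E - 1)) * ennreal (t ^ (card E - 1))"
      using s by (simp add: power_mult_distrib ennreal_mult')
    ultimately show "indicator {r * s<..} (s * t) * (ennreal ((s * t) ^ (card E - 1)) * cone_density a (slide E (s * t) x)) =
      ennreal (s ^ (card E - 1)) * (indicator {r<..} t * (ennreal (t ^ (card E - 1)) * cone_density a (slide E t (slide E s x))))"
      by (simp add: ac_simps)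
  qed
  also have "\<dots> = ennreal (s ^ (card E - 1)) * tail E a r (slide E s x)"
    unfolding tail_def by (rule nn_integral_cmult) measurable
  also have "ennreal s * (ennreal (s ^ (card E - 1)) * tail E a r (slide E s x)) = ennreal (s ^ card E) * tail E a r (slide E s x)"
    using s by (subst cE) (simp add: mult.assoc[symmetric] ennreal_mult[symmetric])
  finally show ?thesis by simp
qed

text \<open>The factors \<open>s ^ card E\<close> cancel. Along one ray the p-value is thus a
  normalized tail evaluated at the radius, to which \<open>tail_quantile_transform\<close>
  applies.\<close>

lemma radial_pvalue_slide:
  assumes s: "s > 0" and E: "E \<noteq> {}"
  shows "radial_pvalue E a (slide E s x) = enn2real (tail E a s x) / enn2real (tail E a 0 x)"
proof -
  have "s ^ card E * enn2real (tail E a r (slide E s x)) = enn2real (tail E a (r * s) x)" for r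
    using s by (simp add: tail_slide[OF s E, symmetric] enn2real_mult)
  from this[of 1] this[of 0] show ?thesis
    using s by (simp add: radial_pvalue_def) (metis mult_divide_mult_cancel_left power_not_zero less_irrefl)
qed

lemma pd_cone_segment:
  assumes "x \<in> pd_cone" "c \<in> pd_cone" "0 \<le> t" "t \<le> 1"
  shows "c + t *\<^sub>R (x - c) \<in> pd_cone"
proof (cases "t = 0 \<or> t = 1")
  case True then show ?thesis using assms by auto
next
  case False
  then have "0 < t" "0 < 1 - t" using assms by auto
  then have "posdef ((1 - t) *\<^sub>R smat c + t *\<^sub>R smat x)"
    using assms by (intro posdef_add posdef_scaleR) (auto simp: pd_cone_def)
  moreover have "smat (c + t *\<^sub>R (x - c)) = (1 - t) *\<^sub>R smat c + t *\<^sub>R smat x"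
    by (simp add: smat_add smat_diff smat_scaleR algebra_simps)
  ultimately show ?thesis by (simp add: pd_cone_def)
qed

lemma slide_pd_cone:
  assumes "\<forall>e\<in>E. proper_uprod e" "x \<in> pd_cone" "0 \<le> t" "t \<le> 1"
  shows "slide E t x \<in> pd_cone"
  unfolding slide_def using assms by (intro pd_cone_segment pd_completion_pd_cone)

text \<open>The displacement has zero diagonal, so it is negative in some direction and the ray
  eventually leaves the cone.\<close>
lemma slide_leaves_pd_cone:
  assumes E: "\<forall>e\<in>E. proper_uprod e" and ne: "x \<noteq> pd_completion E x"
  obtains B where "B > 0" "\<And>t. t \<ge> B \<Longrightarrow> slide E t x \<notin> pd_cone"
proof -
  let ?c = "pd_completion E x"
  define D where "D = x - ?c"
  obtain e where e: "D $ e \<noteq> 0" using ne by (auto simp: D_def vec_eq_iff)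
  then have eE: "e \<in> E" using pd_completion_nth[of e E x] by (auto simp: D_def)
  obtain i j where ij: "e = Upair i j" by (cases e)
  have ne': "i \<noteq> j" using E eE ij by auto
  have diag: "Upair k k \<notin> E" for k using E by (metis proper_uprod_simps)
  define s where "s = - sgn (D $ e)"
  define u where "u = (axis i 1 + s *\<^sub>R axis j 1 :: real^'a)"
  define q where "q = ?c $ Upair i i + 2 * s * ?c $ e + s\<^sup>2 * ?c $ Upair j j"
  have u0: "u \<noteq> 0"
  proof -
    have "u $ i = 1" using ne' by (simp add: u_def axis_def)
    then show ?thesis by (metis zero_index zero_neq_one)
  qed
  have form: "u \<bullet> (smat (slide E t x) *v u) = q - 2 * t * \<bar>D $ e\<bar>" for t
  proof -
    have "s * D $ e = - \<bar>D $ e\<bar>" by (simp add: s_def sgn_if)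
    then have "2 * t * (s * D $ e) = - 2 * t * \<bar>D $ e\<bar>" by simp
    then have "2 * s * (t * D $ e) = - 2 * t * \<bar>D $ e\<bar>" by (simp only: ac_simps)
    then show ?thesis
      unfolding u_def quadratic_axis_pair[OF ne'] slide_nth_off[OF diag]
      by (simp add: slide_nth ij[symmetric] q_def D_def[symmetric] pd_completion_nth[OF diag] algebra_simps
          flip: vector_minus_component)
  qed
  define B where "B = \<bar>q\<bar> / (2 * \<bar>D $ e\<bar>) + 1"
  have "slide E t x \<notin> pd_cone" if t: "t \<ge> B" for t
  proof
    assume "slide E t x \<in> pd_cone"
    then have "0 < q - 2 * t * \<bar>D $ e\<bar>" using u0 form[of t] by (auto simp: pd_cone_def posdef_def)
    moreover have "\<bar>q\<bar> / (2 * \<bar>D $ e\<bar>) \<le> t" using t by (simp add: B_def)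
    then have "\<bar>q\<bar> \<le> t * (2 * \<bar>D $ e\<bar>)" using e by (simp add: divide_le_eq)
    ultimately show False by (simp add: algebra_simps)
  qed
  moreover have "B > 0" by (simp add: B_def add_nonneg_pos)
  ultimately show ?thesis using that by blast
qed

text \<open>By convexity the segment from the completion to \<open>x\<close> stays in the cone, so
  the integrand is positive on the whole interval \<open>{0<..<1}\<close>.\<close>

lemma tail_0_pos:
  assumes E: "\<forall>e\<in>E. proper_uprod e" and x: "x \<in> pd_cone"
  shows "tail E a 0 x \<noteq> 0"
proof
  assume "tail E a 0 x = 0"
  then have "AE t in lborel. indicator {0<..} t * (ennreal (t ^ (card E - 1)) * cone_density a (slide E t x)) = 0"
    unfolding tail_def by (subst (asm) nn_integral_0_iff_AE) measurable
  then have "AE t in lborel. t \<notin> {0<..<1::real}"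
  proof eventually_elim
    fix t assume 0: "indicator {0<..} t * (ennreal (t ^ (card E - 1)) * cone_density a (slide E t x)) = 0"
    show "t \<notin> {0<..<1::real}"
    proof
      assume t: "t \<in> {0<..<1::real}"
      then have "slide E t x \<in> pd_cone" using slide_pd_cone[OF E x] by simp
      then show False using 0 t pd_cone_det_pos[of "slide E t x"] by (simp add: cone_density_def)
    qed
  qed
  then have "emeasure lborel {0<..<1::real} = 0"
    by (subst (asm) AE_iff_null_sets[symmetric]) (auto simp: null_setsD1 Compl_eq[symmetric] AE_iff_null)
  then show False by simp
qed

text \<open>The ray leaves the cone by some time \<open>B\<close>. Up to then the determinant is
  bounded, and since \<open>a \<ge> 0\<close> its power stays bounded even where the determinant
  tends to 0.\<close>

lemma tail_0_finite:
  assumes E: "\<forall>e\<in>E. proper_uprod e" and ne: "x \<noteq> pd_completion E x" and a: "a \<ge> 0"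
  shows "tail E a 0 x \<noteq> \<infinity>"
proof -
  obtain B where B: "B > 0" "\<And>t. t \<ge> B \<Longrightarrow> slide E t x \<notin> pd_cone"
    using slide_leaves_pd_cone[OF E ne] by metis
  have "continuous_on {0..B} (\<lambda>t. det (smat (slide E t x)))"
    unfolding det_def smat_nth slide_nth by (intro continuous_intros)
  then have "bounded ((\<lambda>t. det (smat (slide E t x))) ` {0..B})"
    by (intro compact_imp_bounded compact_continuous_image) auto
  then obtain M where M: "\<forall>t\<in>{0..B}. \<bar>det (smat (slide E t x))\<bar> \<le> M"
    by (auto simp: bounded_iff)
  have le: "indicator {0<..} t * (ennreal (t ^ (card E - 1)) * cone_density a (slide E t x)) \<le>
    ennreal (B ^ (card E - 1) * M powr a) * indicator {0..B} t" for t
  proof (cases "0 < t \<and> slide E t x \<in> pd_cone")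
    case True
    then have t: "0 < t" "t < B" using B(2)[of t] by (auto intro: ccontr simp: not_less)
    have "det (smat (slide E t x)) \<le> M" using bspec[OF M, of t] t by auto
    then have "det (smat (slide E t x)) powr a \<le> M powr a"
      using pd_cone_det_pos[of "slide E t x"] True a by (intro powr_mono2) auto
    moreover have "t ^ (card E - 1) \<le> B ^ (card E - 1)" using t by (intro power_mono) auto
    ultimately have "t ^ (card E - 1) * det (smat (slide E t x)) powr a \<le> B ^ (card E - 1) * M powr a"
      using B(1) by (intro mult_mono) auto
    then show ?thesis using t True
      by (simp add: cone_density_def ennreal_mult[symmetric] ennreal_leI)
  next
    case False
    then show ?thesis by (auto simp: cone_density_def indicator_def)
  qed
  have "tail E a 0 x \<le> (\<integral>\<^sup>+t. ennreal (B ^ (card E - 1) * M powr a) * indicator {0..B} t \<partial>lborel)"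
    unfolding tail_def by (intro nn_integral_mono le)
  also have "\<dots> < \<infinity>" using B by (simp add: nn_integral_cmult ennreal_mult_less_top)
  finally show ?thesis by simp
qed

text \<open>The boundary cases agree: at \<open>z = 0\<close> both sides are infinite, at infinite
  \<open>z\<close> both are 0.\<close>

lemma ennreal_mult_inverse_cancel:
  fixes k :: real and z :: ennreal
  assumes "k > 0"
  shows "ennreal k * inverse (ennreal k * z) = inverse z"
proof (cases z)
  case (real r)
  then show ?thesis using assms
    by (cases "r = 0") (simp_all add: ennreal_mult[symmetric] inverse_ennreal ennreal_mult_top)
next
  case top
  then show ?thesis using assms by (simp add: ennreal_mult_top)
qed

context
  fixes E :: "('p::finite) uprod set" and a :: real and q :: "real^'p uprod \<Rightarrow> ennreal"
  assumes E: "\<forall>e\<in>E. proper_uprod e" and E0: "E \<noteq> {}" and a: "a \<ge> 0"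
    and q [measurable]: "q \<in> borel_measurable borel"
    and q_slide: "\<And>t x. q (slide E t x) = q x"
    and fin: "(\<integral>\<^sup>+x. q x * cone_density a x \<partial>lborel) \<noteq> \<infinity>"
begin

text \<open>Matrices equal to their completion are fixed by \<open>slide E 2\<close>, whose Jacobian
  is \<open>2 ^ card E > 1\<close>. A finite integral that is unchanged by this factor is 0.\<close>

lemma AE_ne_pd_completion: "AE x in lborel. q x * cone_density a x * indicator {0} (x - pd_completion E x) = 0"
proof -
  let ?W = "\<lambda>x. q x * cone_density a x * indicator {0} (x - pd_completion E x)"
  have [measurable]: "?W \<in> borel_measurable borel" by measurable
  have "?W (slide E 2 x) = ?W x" for x
  proof (cases "x = pd_completion E x")
    case True
    then have "slide E 2 x = x" by (simp add: slide_def)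
    then show ?thesis by simp
  next
    case False
    have "slide E 2 x - pd_completion E x = 2 *\<^sub>R (x - pd_completion E x)" by (simp add: slide_def)
    then show ?thesis using False by simp
  qed
  then have eq: "ennreal (2 ^ card E) * (\<integral>\<^sup>+x. ?W x \<partial>lborel) = (\<integral>\<^sup>+x. ?W x \<partial>lborel)"
    using nn_integral_slide[of 2 ?W E] by simp
  have "(\<integral>\<^sup>+x. ?W x \<partial>lborel) \<le> (\<integral>\<^sup>+x. q x * cone_density a x \<partial>lborel)"
    by (intro nn_integral_mono) (simp add: indicator_def)
  then have "(\<integral>\<^sup>+x. ?W x \<partial>lborel) \<noteq> \<infinity>" using fin by (auto simp: top_unique)
  then obtain r where r: "(\<integral>\<^sup>+x. ?W x \<partial>lborel) = ennreal r" "r \<ge> 0" by (cases "\<integral>\<^sup>+x. ?W x \<partial>lborel") auto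
  have "2 ^ card E * r = r" using eq r by (simp add: ennreal_mult[symmetric])
  moreover have "(2::real) ^ card E > 1" using E0 by (simp add: card_gt_0_iff)
  ultimately have "r = 0" by simp
  then have "(\<integral>\<^sup>+x. ?W x \<partial>lborel) = 0" using r by simp
  then show ?thesis by (subst (asm) nn_integral_0_iff_AE) measurable
qed

text \<open>Conditionally on the ray through a point, the radius has the density appearing in the
  definition of \<open>tail\<close>. Instead of introducing polar coordinates, the integrand is multiplied by
  \<open>tail E a 0 x / tail E a 0 x\<close>, the numerator is written as an integral over the ray, and the
  change of variables \<open>x \<mapsto> slide E (1/t) x\<close> exchanges the two points.\<close>
theorem radial_pvalue_uniform:
  assumes u: "0 < u" "u < 1"
  shows "(\<integral>\<^sup>+x. q x * cone_density a x * indicator {..u} (radial_pvalue E a x) \<partial>lborel) =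
    ennreal u * (\<integral>\<^sup>+x. q x * cone_density a x \<partial>lborel)"
proof -
  let ?d = "card E"
  let ?f = "cone_density a :: real^'p uprod \<Rightarrow> ennreal"
  let ?A = "\<lambda>x. indicator (- {0}) (x - pd_completion E x) :: ennreal"
  let ?Z = "tail E a 0"
  let ?I = "\<lambda>x. indicator {..u} (radial_pvalue E a x) :: ennreal"
  have Z: "?Z x * inverse (?Z x) = 1" if "x \<in> pd_cone" "x \<noteq> pd_completion E x" for x
    using tail_0_pos[OF E that(1)] tail_0_finite[OF E that(2) a]
    unfolding divide_ennreal_def[symmetric]
    by (intro ennreal_divide_self) (simp_all add: top.not_eq_extremum[symmetric])
  have AE_A: "AE x in lborel. q x * ?f x = q x * ?A x * ?f x"
    using AE_ne_pd_completion by eventually_elim (auto simp: indicator_def split: if_splits)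
  have cE: "?d = Suc (?d - 1)" using E0 by (metis Suc_pred' card_gt_0_iff finite)
  have A_slide: "?A (slide E t x) = ?A x" if "t \<noteq> 0" for t x
  proof -
    have "slide E t x - pd_completion E (slide E t x) = t *\<^sub>R (x - pd_completion E x)"
      unfolding pd_completion_slide by (simp add: slide_def)
    then show ?thesis using that by (simp add: indicator_def)
  qed
  \<comment> \<open>The integrand after the exchange: \<open>x\<close> is the base point that fixes
    the ray, and the p-value is evaluated at the point \<open>slide E s x\<close> of that
    ray.\<close>
  define \<Phi> where "\<Phi> x s = q x * ?A x * ?f x * inverse (?Z x) * (?f (slide E s x) * ?I (slide E s x))" for x s
  have [measurable]: "(\<lambda>z. \<Phi> (fst z) (snd z)) \<in> borel_measurable (borel \<Otimes>\<^sub>M borel)"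
    unfolding \<Phi>_def by measurable
  have "(\<integral>\<^sup>+x. q x * ?f x * ?I x \<partial>lborel) = (\<integral>\<^sup>+x. q x * ?A x * ?I x * ?f x * inverse (?Z x) * ?Z x \<partial>lborel)"
  proof (rule nn_integral_cong_AE)
    show "AE x in lborel. q x * ?f x * ?I x = q x * ?A x * ?I x * ?f x * inverse (?Z x) * ?Z x"
      using AE_A
    proof eventually_elim
      fix x assume A: "q x * ?f x = q x * ?A x * ?f x"
      show "q x * ?f x * ?I x = q x * ?A x * ?I x * ?f x * inverse (?Z x) * ?Z x"
      proof (cases "x \<in> pd_cone \<and> x \<noteq> pd_completion E x")
        case True
        then have "q x * ?A x * ?I x * ?f x * inverse (?Z x) * ?Z x = q x * ?A x * ?I x * ?f x * (?Z x * inverse (?Z x))"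
          by (simp only: ac_simps)
        also have "\<dots> = q x * ?f x * ?I x" using True Z[of x] by (simp add: ac_simps)
        finally show ?thesis by simp
      next
        case False
        then show ?thesis using A by (auto simp: cone_density_def)
      qed
    qed
  qed
  also have "\<dots> = (\<integral>\<^sup>+x. (\<integral>\<^sup>+t. q x * ?A x * ?I x * ?f x * inverse (?Z x) * (indicator {0<..} t * (ennreal (t ^ (?d - 1)) * ?f (slide E t x))) \<partial>lborel) \<partial>lborel)"
    unfolding tail_def[of E a 0] by (intro nn_integral_cong nn_integral_cmult[symmetric]) measurable
  also have "\<dots> = (\<integral>\<^sup>+t. (\<integral>\<^sup>+x. q x * ?A x * ?I x * ?f x * inverse (?Z x) * (indicator {0<..} t * (ennreal (t ^ (?d - 1)) * ?f (slide E t x))) \<partial>lborel) \<partial>lborel)"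
    by (rule lborel_pair.Fubini') measurable
  also have "\<dots> = (\<integral>\<^sup>+t. (\<integral>\<^sup>+x. indicator {0<..} t * ennreal (1 / t\<^sup>2) * (ennreal ((1 / t) ^ (?d - 1)) * \<Phi> x (1 / t)) \<partial>lborel) \<partial>lborel)"
  proof (rule nn_integral_cong)
    fix t :: real
    show "(\<integral>\<^sup>+x. q x * ?A x * ?I x * ?f x * inverse (?Z x) * (indicator {0<..} t * (ennreal (t ^ (?d - 1)) * ?f (slide E t x))) \<partial>lborel) =
      (\<integral>\<^sup>+x. indicator {0<..} t * ennreal (1 / t\<^sup>2) * (ennreal ((1 / t) ^ (?d - 1)) * \<Phi> x (1 / t)) \<partial>lborel)"
    proof (cases "t > 0")
      case True
      let ?s = "1 / t"
      let ?H = "\<lambda>x. q x * ?A x * ?I x * ?f x * inverse (?Z x) * (indicator {0<..} t * (ennreal (t ^ (?d - 1)) * ?f (slide E t x)))"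
      have s: "?s > 0" using True by simp
      have "(\<integral>\<^sup>+x. ?H x \<partial>lborel) = ennreal (\<bar>?s\<bar> ^ ?d) * (\<integral>\<^sup>+x. ?H (slide E ?s x) \<partial>lborel)"
        by (rule nn_integral_slide[symmetric]) (use True in simp, measurable)
      also have "\<dots> = (\<integral>\<^sup>+x. ennreal (?s ^ ?d) * ?H (slide E ?s x) \<partial>lborel)"
        using True by (subst nn_integral_cmult) auto
      also have "\<dots> = (\<integral>\<^sup>+x. indicator {0<..} t * ennreal (1 / t\<^sup>2) * (ennreal ((1 / t) ^ (?d - 1)) * \<Phi> x (1 / t)) \<partial>lborel)"
      proof (rule nn_integral_cong)
        fix x :: "real^'p uprod"
        have "ennreal (?s ^ ?d) * ?Z (slide E ?s x) = ?Z x" using tail_slide[OF s E0, of a 0 x] by simp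
        then have iZ: "inverse (?Z (slide E ?s x)) = ennreal (?s ^ ?d) * inverse (?Z x)"
          using ennreal_mult_inverse_cancel[of "?s ^ ?d" "?Z (slide E ?s x)"] s by simp
        \<comment> \<open>The Jacobian of \<open>slide\<close> and the rescaling of the normalizer
          \<open>?Z\<close> each give \<open>s ^ d\<close>. With \<open>t ^ (d - 1)\<close> they
          leave \<open>1 / t\<^sup>2\<close>, the Jacobian of the inversion
          \<open>s = 1 / t\<close>, and the radial weight \<open>s ^ (d - 1)\<close>.\<close>
        have pw: "ennreal (?s ^ ?d) * (ennreal (?s ^ ?d) * ennreal (t ^ (?d - 1))) = ennreal (1 / t\<^sup>2) * ennreal (?s ^ (?d - 1))"
        proof -
          have "?s ^ ?d * (?s ^ ?d * t ^ (?d - 1)) = 1 / t\<^sup>2 * ?s ^ (?d - 1)"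
            using True by (subst (1 2) cE) (simp add: field_simps power2_eq_square)
          then show ?thesis using True by (simp add: ennreal_mult[symmetric] del: power_one_over)
        qed
        have "ennreal (?s ^ ?d) * ?H (slide E ?s x) =
          (ennreal (?s ^ ?d) * (ennreal (?s ^ ?d) * ennreal (t ^ (?d - 1)))) * \<Phi> x ?s"
          using True s unfolding \<Phi>_def iZ q_slide A_slide[OF less_imp_neq[OF s, THEN not_sym]]
          by (simp add: ac_simps)
        also have "\<dots> = indicator {0<..} t * ennreal (1 / t\<^sup>2) * (ennreal ((1 / t) ^ (?d - 1)) * \<Phi> x (1 / t))"
          unfolding pw using True by (simp add: ac_simps)
        finally show "ennreal (?s ^ ?d) * ?H (slide E ?s x) = indicator {0<..} t * ennreal (1 / t\<^sup>2) * (ennreal ((1 / t) ^ (?d - 1)) * \<Phi> x (1 / t))" .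
      qed
      finally show ?thesis .
    qed simp
  qed
  also have "\<dots> = (\<integral>\<^sup>+x. (\<integral>\<^sup>+t. indicator {0<..} t * ennreal (1 / t\<^sup>2) * (ennreal ((1 / t) ^ (?d - 1)) * \<Phi> x (1 / t)) \<partial>lborel) \<partial>lborel)"
    unfolding \<Phi>_def by (rule lborel_pair.Fubini'[symmetric]) measurable
  also have "\<dots> = (\<integral>\<^sup>+x. ennreal u * (q x * ?f x) \<partial>lborel)"
  proof (rule nn_integral_cong_AE)
    show "AE x in lborel. (\<integral>\<^sup>+t. indicator {0<..} t * ennreal (1 / t\<^sup>2) * (ennreal ((1 / t) ^ (?d - 1)) * \<Phi> x (1 / t)) \<partial>lborel) = ennreal u * (q x * ?f x)"
      using AE_A
    proof eventually_elim
      fix x :: "real^'p uprod" assume A: "q x * ?f x = q x * ?A x * ?f x"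
      have "(\<integral>\<^sup>+t. indicator {0<..} t * ennreal (1 / t\<^sup>2) * (ennreal ((1 / t) ^ (?d - 1)) * \<Phi> x (1 / t)) \<partial>lborel) =
        (\<integral>\<^sup>+s. indicator {0<..} s * (ennreal (s ^ (?d - 1)) * \<Phi> x s) \<partial>lborel)"
        unfolding \<Phi>_def by (rule nn_integral_inversion) measurable
      also have "\<dots> = (\<integral>\<^sup>+s. (q x * ?A x * ?f x * inverse (?Z x)) * (indicator {0<..} s * (ennreal (s ^ (?d - 1)) * ?f (slide E s x)) *
          indicator {..u} (enn2real (tail E a s x) / enn2real (?Z x))) \<partial>lborel)"
        unfolding \<Phi>_def by (intro nn_integral_cong) (auto simp: indicator_def radial_pvalue_slide[OF _ E0] ac_simps)
      also have "\<dots> = (q x * ?A x * ?f x * inverse (?Z x)) * (\<integral>\<^sup>+s. indicator {0<..} s * (ennreal (s ^ (?d - 1)) * ?f (slide E s x)) *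
          indicator {..u} (enn2real (tail E a s x) / enn2real (?Z x)) \<partial>lborel)"
      proof (rule nn_integral_cmult)
        have "(\<lambda>s. if 0 < s then ?I (slide E s x) else 0) \<in> borel_measurable borel" by measurable
        then have "(\<lambda>s. indicator {0<..} s * (ennreal (s ^ (?d - 1)) * ?f (slide E s x)) * (if 0 < s then ?I (slide E s x) else 0)) \<in> borel_measurable lborel"
          by measurable
        also have "(\<lambda>s. indicator {0<..} s * (ennreal (s ^ (?d - 1)) * ?f (slide E s x)) * (if 0 < s then ?I (slide E s x) else 0)) =
          (\<lambda>s. indicator {0<..} s * (ennreal (s ^ (?d - 1)) * ?f (slide E s x)) * indicator {..u} (enn2real (tail E a s x) / enn2real (?Z x)))"
          by (auto simp: fun_eq_iff indicator_def radial_pvalue_slide[OF _ E0])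
        finally show "\<dots> \<in> borel_measurable lborel" .
      qed
      also have "\<dots> = ennreal u * (q x * ?f x)"
      proof (cases "x \<in> pd_cone \<and> x \<noteq> pd_completion E x")
        case True
        have "(\<integral>\<^sup>+s. indicator {0<..} s * (ennreal (s ^ (?d - 1)) * ?f (slide E s x)) * indicator {..u} (enn2real (tail E a s x) / enn2real (?Z x)) \<partial>lborel) = ennreal u * ?Z x"
          unfolding tail_def
          by (rule tail_quantile_transform[where \<rho> = "\<lambda>s. ennreal (s ^ (?d - 1)) * ?f (slide E s x)"])
             (use True tail_0_pos[OF E, of x a] tail_0_finite[OF E _ a, of x] u in \<open>auto simp: tail_def\<close>)
        then have "(q x * ?A x * ?f x * inverse (?Z x)) * (\<integral>\<^sup>+s. indicator {0<..} s * (ennreal (s ^ (?d - 1)) * ?f (slide E s x)) * indicator {..u} (enn2real (tail E a s x) / enn2real (?Z x)) \<partial>lborel)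
          = ennreal u * (q x * ?A x * ?f x) * (?Z x * inverse (?Z x))" by (simp only: ac_simps)
        then show ?thesis using True Z[of x] by simp
      next
        case False
        then show ?thesis using A by (auto simp: cone_density_def)
      qed
      finally show "(\<integral>\<^sup>+t. indicator {0<..} t * ennreal (1 / t\<^sup>2) * (ennreal ((1 / t) ^ (?d - 1)) * \<Phi> x (1 / t)) \<partial>lborel) = ennreal u * (q x * ?f x)" .
    qed
  qed
  also have "\<dots> = ennreal u * (\<integral>\<^sup>+x. q x * ?f x \<partial>lborel)" by (rule nn_integral_cmult) measurable
  finally show ?thesis .
qed

end

subsection \<open>The normal log-likelihood\<close>

text \<open>The log-likelihood per observation, up to a constant, of data with mean \<open>m\<close>
  and covariance \<open>X\<close>. Since \<open>X\<close> is arbitrary, the same function serves for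
  the observed data, the completion and the tilted likelihoods along the path.\<close>

definition ref_loglik :: "real^'p \<Rightarrow> real^('p::finite) uprod \<Rightarrow> 'p canonical \<Rightarrow> real" where
  "ref_loglik m X \<phi> = xi_of \<phi> \<bullet> m - trace (Lambda_of \<phi> ** (smat X + outer m m)) / 2
     + ln (det (Lambda_of \<phi>)) / 2 - xi_of \<phi> \<bullet> (matrix_inv (Lambda_of \<phi>) *v xi_of \<phi>) / 2"

definition mu_of :: "('p::finite) canonical \<Rightarrow> real^'p" where
  "mu_of \<phi> = matrix_inv (Lambda_of \<phi>) *v xi_of \<phi>"

lemma full_params_iff: "\<phi> \<in> full_params \<longleftrightarrow> sigma_of \<phi> \<in> pd_cone"
  by (simp add: full_params_def pd_cone_def Lambda_of_smat)

lemma full_params_posdef: "\<phi> \<in> full_params \<Longrightarrow> posdef (Lambda_of \<phi>)"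
  by (simp add: full_params_def)

lemma Lambda_mu_of: "\<phi> \<in> full_params \<Longrightarrow> Lambda_of \<phi> *v mu_of \<phi> = xi_of \<phi>"
  by (simp add: mu_of_def matrix_vector_mul_assoc matrix_inv_cancel posdef_invertible full_params_posdef)

lemma matrix_add_ldistrib': "A ** (B + C) = A ** B + A ** C" for A B C :: "real^'n^'n"
  by (simp add: matrix_matrix_mult_def vec_eq_iff sum.distrib algebra_simps)

lemma inner_posdef_commute: "posdef A \<Longrightarrow> u \<bullet> (A *v v) = v \<bullet> (A *v u)"
  by (simp add: inner_matrix_vector[of u] posdef_symmetric inner_commute)

lemma ref_loglik_eq:
  assumes \<phi>: "\<phi> \<in> full_params"
  shows "ref_loglik m X \<phi> = (ln (det (Lambda_of \<phi>)) - trace (Lambda_of \<phi> ** smat X)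
     - (m - mu_of \<phi>) \<bullet> (Lambda_of \<phi> *v (m - mu_of \<phi>))) / 2"
proof -
  have L: "posdef (Lambda_of \<phi>)" by (rule full_params_posdef[OF \<phi>])
  have "(m - mu_of \<phi>) \<bullet> (Lambda_of \<phi> *v (m - mu_of \<phi>)) =
    m \<bullet> (Lambda_of \<phi> *v m) - 2 * (xi_of \<phi> \<bullet> m) + xi_of \<phi> \<bullet> mu_of \<phi>"
    using inner_posdef_commute[OF L, of "mu_of \<phi>" m]
    by (simp add: matrix_vector_mult_diff_distrib inner_diff_left inner_diff_right Lambda_mu_of[OF \<phi>] inner_commute)
  then show ?thesis
    by (simp add: ref_loglik_def matrix_add_ldistrib' trace_add trace_mult_outer mu_of_def[symmetric] field_simps)
qed

text \<open>For \<open>X\<close> in the cone, the canonical parameter of the normal law with mean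
  \<open>m\<close> and covariance \<open>X\<close>.\<close>

definition peak :: "real^'p \<Rightarrow> real^('p::finite) uprod \<Rightarrow> 'p canonical" where
  "peak m X = pack (smat (vinv X) *v m) (vinv X)"

lemma
  assumes X: "X \<in> pd_cone"
  shows peak_full_params: "peak m X \<in> full_params"
    and Lambda_of_peak: "Lambda_of (peak m X) = matrix_inv (smat X)"
    and matrix_inv_Lambda_of_peak: "matrix_inv (Lambda_of (peak m X)) = smat X"
    and mu_of_peak: "mu_of (peak m X) = m"
proof -
  note i = pd_cone_invertible[OF X]
  show "peak m X \<in> full_params" by (simp add: peak_def full_params_iff vinv_pd_cone X)
  have s: "sigma_of (peak m X) = vinv X" by (simp add: peak_def)
  show L: "Lambda_of (peak m X) = matrix_inv (smat X)" by (simp add: Lambda_of_smat s smat_vinv i)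
  show L': "matrix_inv (Lambda_of (peak m X)) = smat X" by (simp add: L matrix_inv_matrix_inv i)
  show "mu_of (peak m X) = m"
    unfolding mu_of_def L' by (simp add: peak_def smat_vinv i matrix_vector_mul_assoc matrix_inv_cancel)
qed

lemma ref_loglik_peak:
  fixes X :: "real^('p::finite) uprod"
  assumes X: "X \<in> pd_cone"
  shows "ref_loglik m X (peak m X) = (- ln (det (smat X)) - real CARD('p)) / 2"
  using pd_cone_det_pos[OF X]
  by (simp add: ref_loglik_eq peak_full_params X mu_of_peak Lambda_of_peak matrix_inv_cancel
      pd_cone_invertible trace_I det_matrix_inv ln_div)

text \<open>The loss with respect to \<open>peak m X\<close> is half the sum of a quadratic form in
  \<open>m - mu_of \<phi>\<close> and the deficit in the determinant-trace inequality for
  \<open>Lambda_of \<phi>\<close> and \<open>X\<close>. Both are nonnegative, and equality forces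
  both to vanish.\<close>

lemma
  fixes X :: "real^('p::finite) uprod"
  assumes X: "X \<in> pd_cone" and \<phi>: "\<phi> \<in> full_params"
  shows ref_loglik_le_peak: "ref_loglik m X \<phi> \<le> ref_loglik m X (peak m X)"
    and ref_loglik_eq_peakD: "ref_loglik m X \<phi> = ref_loglik m X (peak m X) \<Longrightarrow> \<phi> = peak m X"
proof -
  let ?L = "Lambda_of \<phi>"
  have L: "posdef ?L" by (rule full_params_posdef[OF \<phi>])
  have pX: "posdef (smat X)" using X by (simp add: pd_cone_def)
  have q: "0 \<le> (m - mu_of \<phi>) \<bullet> (?L *v (m - mu_of \<phi>))"
    using L by (cases "m - mu_of \<phi> = 0") (auto simp: posdef_def less_imp_le)
  have t: "ln (det ?L) + ln (det (smat X)) - trace (?L ** smat X) \<le> - real CARD('p)"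
    by (rule posdef_pair_ln_det_le_trace(1)[OF L pX])
  show "ref_loglik m X \<phi> \<le> ref_loglik m X (peak m X)"
    unfolding ref_loglik_peak[OF X] ref_loglik_eq[OF \<phi>] using q t by simp
  assume e: "ref_loglik m X \<phi> = ref_loglik m X (peak m X)"
  have arith: "b + d - r = - c \<and> s = 0" if "(b - r - s) / 2 = (- d - c) / 2" "0 \<le> s" "b + d - r \<le> - c" for b c d r s :: real
    using that by (auto simp: field_simps)
  note eqs = arith[OF e[unfolded ref_loglik_peak[OF X] ref_loglik_eq[OF \<phi>]] q t]
  have eq1: "ln (det ?L) + ln (det (smat X)) - trace (?L ** smat X) = - real CARD('p)"
    using eqs by (rule conjunct1)
  have eq2: "(m - mu_of \<phi>) \<bullet> (?L *v (m - mu_of \<phi>)) = 0"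
    using eqs by (rule conjunct2)
  have mu: "mu_of \<phi> = m" using eq2 L unfolding posdef_def by (metis eq_iff_diff_eq_0 less_irrefl)
  have "?L = matrix_inv (smat X)" by (rule posdef_pair_ln_det_le_trace(2)[OF L pX eq1])
  then have "smat (sigma_of \<phi>) = smat (vinv X)" by (simp add: Lambda_of_smat smat_vinv pd_cone_invertible X)
  then have s: "sigma_of \<phi> = vinv X" by simp
  have "xi_of \<phi> = smat (vinv X) *v m"
    using Lambda_mu_of[OF \<phi>] by (simp add: mu Lambda_of_smat s)
  then show "\<phi> = peak m X" using s by (simp add: peak_def canonical_eq_iff)
qed

text \<open>Adding a rank one term in a direction of nonpositive curvature of \<open>X\<close> increases the
  determinant without increasing the trace.\<close>
lemma ref_loglik_unbounded:
  fixes X :: "real^('p::finite) uprod"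
  assumes X: "X \<notin> pd_cone" and \<phi>: "\<phi> \<in> full_params"
  shows "\<exists>\<psi>\<in>full_params. ref_loglik m X \<phi> < ref_loglik m X \<psi>"
proof -
  let ?L = "Lambda_of \<phi>"
  have L: "posdef ?L" by (rule full_params_posdef[OF \<phi>])
  obtain v where v: "v \<noteq> 0" "v \<bullet> (smat X *v v) \<le> 0"
    using X by (auto simp: pd_cone_def posdef_def not_less)
  define L' where "L' = ?L + outer v v"
  have tL': "transpose L' = L'"
    using posdef_symmetric[OF L] transpose_outer[of v] by (simp add: L'_def transpose_def vec_eq_iff)
  have "0 < u \<bullet> (L' *v u)" if "u \<noteq> 0" for u
  proof -
    have "u \<bullet> (L' *v u) = u \<bullet> (?L *v u) + (v \<bullet> u) * (v \<bullet> u)"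
      by (simp add: L'_def matrix_vector_mult_add_rdistrib inner_add_right outer_vec inner_commute)
    moreover have "0 < u \<bullet> (?L *v u)" using L that by (simp add: posdef_def)
    ultimately show ?thesis by (simp add: add_pos_nonneg)
  qed
  then have pL': "posdef L'" using tL' by (simp add: posdef_def)
  define \<psi> where "\<psi> = pack (L' *v m) (svec L')"
  have L\<psi>: "Lambda_of \<psi> = L'" by (simp add: \<psi>_def Lambda_of_smat smat_svec tL')
  have \<psi>: "\<psi> \<in> full_params" by (simp add: full_params_def L\<psi> pL')
  have mu\<psi>: "mu_of \<psi> = m"
    unfolding mu_of_def L\<psi> by (simp add: \<psi>_def matrix_vector_mul_assoc matrix_inv_cancel posdef_invertible[OF pL'])
  have i: "invertible L'" by (rule posdef_invertible[OF pL'])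
  have "ln (det (matrix_inv L')) + ln (det ?L) - trace (matrix_inv L' ** ?L) \<le> - real CARD('p)"
    by (rule posdef_pair_ln_det_le_trace(1)[OF posdef_matrix_inv[OF pL'] L])
  moreover have "trace (matrix_inv L' ** ?L) = real CARD('p) - v \<bullet> (matrix_inv L' *v v)"
  proof -
    have "trace (matrix_inv L' ** L') = trace (matrix_inv L' ** ?L) + trace (matrix_inv L' ** outer v v)"
      by (simp add: L'_def matrix_add_ldistrib' trace_add)
    then show ?thesis by (simp add: matrix_inv_cancel[OF i] trace_I trace_mult_outer)
  qed
  moreover have "0 < v \<bullet> (matrix_inv L' *v v)" using posdef_matrix_inv[OF pL'] v by (simp add: posdef_def)
  moreover have "ln (det (matrix_inv L')) = - ln (det L')"
    using posdef_det_pos[OF pL'] by (simp add: det_matrix_inv[OF i] ln_div)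
  ultimately have "ln (det ?L) < ln (det L')" by simp
  moreover have "trace (L' ** smat X) \<le> trace (?L ** smat X)"
  proof -
    have "trace (L' ** smat X) = trace (smat X ** L')" by (rule trace_mul_sym)
    also have "\<dots> = trace (smat X ** ?L) + v \<bullet> (smat X *v v)"
      by (simp add: L'_def matrix_add_ldistrib' trace_add trace_mult_outer)
    also have "trace (smat X ** ?L) = trace (?L ** smat X)" by (rule trace_mul_sym)
    finally show ?thesis using v by simp
  qed
  moreover have "0 \<le> (m - mu_of \<phi>) \<bullet> (?L *v (m - mu_of \<phi>))"
    using L by (cases "m - mu_of \<phi> = 0") (auto simp: posdef_def less_imp_le)
  ultimately have "ref_loglik m X \<phi> < ref_loglik m X \<psi>"
    unfolding ref_loglik_eq[OF \<phi>] ref_loglik_eq[OF \<psi>] L\<psi> mu\<psi> by simp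
  then show ?thesis using \<psi> by blast
qed

lemma trace_mult_sample_cov:
  "trace (A ** smat (sample_cov n y)) = (1 / real n) * (\<Sum>k=1..n. (y k - sample_mean n y) \<bullet> (A *v (y k - sample_mean n y)))"
  for A :: "real^'p^'p::finite"
proof -
  have lin: "linear (\<lambda>X::real^'p^'p. trace (A ** X))"
    by (rule linearI) (simp_all add: trace_def matrix_matrix_mult_def sum.distrib sum_distrib_left algebra_simps)
  show ?thesis
    unfolding smat_sample_cov sample_cov_mat_def linear_scale[OF lin] linear_sum[OF lin] trace_mult_outer by simp
qed

lemma sum_centered: "n > 0 \<Longrightarrow> (\<Sum>k=1..n. y k - sample_mean n y) = 0"
  by (simp add: sum_subtractf sample_mean_def sum_constant_scaleR del: sum_constant)

text \<open>Around the sample mean the cross terms vanish, because the centred observations sum to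
  0. This splits the normal density into a function of the sample covariance and a function of the
  sample mean.\<close>

lemma sum_quadratic_eq:
  fixes y :: "nat \<Rightarrow> real^'p::finite"
  assumes n: "n > 0" and A: "posdef A"
  shows "(\<Sum>k=1..n. (y k - \<mu>) \<bullet> (A *v (y k - \<mu>))) =
    real n * trace (A ** smat (sample_cov n y)) + real n * ((sample_mean n y - \<mu>) \<bullet> (A *v (sample_mean n y - \<mu>)))"
proof -
  let ?m = "sample_mean n y"
  have "(y k - \<mu>) \<bullet> (A *v (y k - \<mu>)) = (y k - ?m) \<bullet> (A *v (y k - ?m)) + 2 * ((y k - ?m) \<bullet> (A *v (?m - \<mu>)))
    + (?m - \<mu>) \<bullet> (A *v (?m - \<mu>))" for k
  proof -
    have e: "y k - \<mu> = (y k - ?m) + (?m - \<mu>)" by simp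
    show ?thesis
      using inner_posdef_commute[OF A, of "?m - \<mu>" "y k - ?m"]
      unfolding e matrix_vector_right_distrib inner_add_left inner_add_right by simp
  qed
  then have "(\<Sum>k=1..n. (y k - \<mu>) \<bullet> (A *v (y k - \<mu>))) = (\<Sum>k=1..n. (y k - ?m) \<bullet> (A *v (y k - ?m)))
    + 2 * ((\<Sum>k=1..n. y k - ?m) \<bullet> (A *v (?m - \<mu>))) + real n * ((?m - \<mu>) \<bullet> (A *v (?m - \<mu>)))"
    by (simp add: sum.distrib sum_distrib_left[symmetric] inner_sum_left)
  then show ?thesis
    using n unfolding sum_centered[OF n] trace_mult_sample_cov by simp
qed

lemma normal_loglik_eq_ref_loglik:
  fixes y :: "nat \<Rightarrow> real^'p::finite"
  assumes n: "n > 0" and \<phi>: "\<phi> \<in> full_params"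
  shows "normal_loglik n y \<phi> = real n * ref_loglik (sample_mean n y) (sample_cov n y) \<phi>
    - real n * real CARD('p) * ln (2 * pi) / 2"
proof -
  let ?L = "Lambda_of \<phi>" and ?\<mu> = "mu_of \<phi>" and ?m = "sample_mean n y"
  have L: "posdef ?L" by (rule full_params_posdef[OF \<phi>])
  have iL: "invertible ?L" by (rule posdef_invertible[OF L])
  have dL: "det ?L > 0" by (rule posdef_det_pos[OF L])
  have "ln (mvnormal_density ?\<mu> (matrix_inv ?L) x) = - ((x - ?\<mu>) \<bullet> (?L *v (x - ?\<mu>))) / 2 - (real CARD('p) * ln (2 * pi) - ln (det ?L)) / 2" for x
  proof -
    have "ln ((2 * pi) ^ CARD('p) * det (matrix_inv ?L)) = real CARD('p) * ln (2 * pi) - ln (det ?L)"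
    proof -
      have "ln ((2 * pi) ^ CARD('p) / det ?L) = ln ((2 * pi) ^ CARD('p)) - ln (det ?L)"
        using dL by (intro ln_divide_pos) simp_all
      also have "ln ((2 * pi) ^ CARD('p)) = real CARD('p) * ln (2 * pi)" by (rule ln_realpow)
      finally show ?thesis by (simp add: det_matrix_inv[OF iL])
    qed
    moreover have "(2 * pi) ^ CARD('p) * det (matrix_inv ?L) > 0" using dL by (simp add: det_matrix_inv[OF iL])
    ultimately show ?thesis
      unfolding mvnormal_density_def matrix_inv_matrix_inv[OF iL]
      by (subst ln_divide_pos) (simp_all add: ln_sqrt)
  qed
  then have "normal_loglik n y \<phi> = (\<Sum>k=1..n. - ((y k - ?\<mu>) \<bullet> (?L *v (y k - ?\<mu>))) / 2 - (real CARD('p) * ln (2 * pi) - ln (det ?L)) / 2)"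
    unfolding normal_loglik_def mu_of_def[symmetric] by simp
  also have "\<dots> = - (\<Sum>k=1..n. (y k - ?\<mu>) \<bullet> (?L *v (y k - ?\<mu>))) / 2 - real n * (real CARD('p) * ln (2 * pi) - ln (det ?L)) / 2"
    by (simp add: sum_subtractf sum_negf sum_divide_distrib[symmetric])
  also note sum_quadratic_eq[OF n L]
  finally show ?thesis
    unfolding ref_loglik_eq[OF \<phi>] by (simp add: field_simps)
qed

section \<open>Derivatives with respect to the canonical parameters\<close>

lemma open_full_params: "open (full_params :: ('p::finite) canonical set)"
proof -
  have "(full_params :: 'p canonical set) = sigma_of -` pd_cone" by (auto simp: full_params_iff)
  moreover have "continuous_on UNIV (sigma_of :: 'p canonical \<Rightarrow> _)"
    by (intro linear_continuous_on linear_conv_bounded_linear[THEN iffD1] linear_sigma_of)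
  ultimately show ?thesis using open_vimage[OF open_pd_cone, of "sigma_of :: 'p canonical \<Rightarrow> _"] by simp
qed

lemma linear_imp_has_derivative: "linear f \<Longrightarrow> (f has_derivative f) F"
  for f :: "'a::euclidean_space \<Rightarrow> 'b::real_normed_vector"
  by (intro bounded_linear_imp_has_derivative linear_conv_bounded_linear[THEN iffD1])

lemma has_derivative_matrix_inv_Lambda:
  assumes \<phi>: "\<phi> \<in> full_params"
  shows "((\<lambda>\<phi>. matrix_inv (Lambda_of \<phi>)) has_derivative
    (\<lambda>\<psi>. - (matrix_inv (Lambda_of \<phi>) ** Lambda_of \<psi> ** matrix_inv (Lambda_of \<phi>)))) (at \<phi>)"
proof -
  have "invertible (smat (sigma_of \<phi>))" using \<phi> pd_cone_invertible by (simp add: full_params_iff)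
  from has_derivative_compose[OF linear_imp_has_derivative[OF linear_sigma_of, of "at \<phi>"] has_derivative_matrix_inv_smat[OF this]]
  show ?thesis by (simp only: Lambda_of_smat)
qed

text \<open>The product rule and the derivative of the inverse; in the second term the inverse
  applied to \<open>xi_of \<phi>\<close> is \<open>mu_of \<phi>\<close> again.\<close>

lemma has_derivative_mu_of:
  assumes \<phi>: "\<phi> \<in> full_params"
  shows "(mu_of has_derivative (\<lambda>\<psi>. matrix_inv (Lambda_of \<phi>) *v (xi_of \<psi> - Lambda_of \<psi> *v mu_of \<phi>))) (at \<phi>)"
proof (rule has_derivative_vecI)
  fix i
  let ?S = "matrix_inv (Lambda_of \<phi>)"
  have S: "((\<lambda>\<phi>. matrix_inv (Lambda_of \<phi>) $ i $ j) has_derivative (\<lambda>\<psi>. - (?S ** Lambda_of \<psi> ** ?S) $ i $ j)) (at \<phi>)" for j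
    using bounded_linear.has_derivative[OF bounded_linear_compose[OF bounded_linear_vec_nth[of j] bounded_linear_vec_nth[of i]] has_derivative_matrix_inv_Lambda[OF \<phi>]]
    by simp
  have x: "((\<lambda>\<phi>. xi_of \<phi> $ j) has_derivative (\<lambda>\<psi>. xi_of \<psi> $ j)) (at \<phi>)" for j
    using bounded_linear.has_derivative[OF bounded_linear_vec_nth[of j] linear_imp_has_derivative[OF linear_xi_of]] .
  have "((\<lambda>\<phi>. \<Sum>j\<in>UNIV. matrix_inv (Lambda_of \<phi>) $ i $ j * xi_of \<phi> $ j) has_derivative
    (\<lambda>\<psi>. \<Sum>j\<in>UNIV. ?S $ i $ j * xi_of \<psi> $ j + (- (?S ** Lambda_of \<psi> ** ?S)) $ i $ j * xi_of \<phi> $ j)) (at \<phi>)"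
    by (intro has_derivative_sum has_derivative_mult x) (use S in simp)
  moreover have "(\<lambda>\<psi>. \<Sum>j\<in>UNIV. ?S $ i $ j * xi_of \<psi> $ j + (- (?S ** Lambda_of \<psi> ** ?S)) $ i $ j * xi_of \<phi> $ j) =
     (\<lambda>\<psi>. (?S *v (xi_of \<psi> - Lambda_of \<psi> *v mu_of \<phi>)) $ i)"
  proof
    fix \<psi>
    have "(\<Sum>j\<in>UNIV. ?S $ i $ j * xi_of \<psi> $ j + (- (?S ** Lambda_of \<psi> ** ?S)) $ i $ j * xi_of \<phi> $ j)
      = (?S *v xi_of \<psi> - (?S ** Lambda_of \<psi> ** ?S) *v xi_of \<phi>) $ i"
      by (simp add: matrix_vector_mult_def sum.distrib sum_negf sum_subtractf del: pack_simps)
    also have "\<dots> = (?S *v (xi_of \<psi> - Lambda_of \<psi> *v mu_of \<phi>)) $ i"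
      by (simp only: mu_of_def matrix_vector_mult_diff_distrib matrix_vector_mul_assoc matrix_mul_assoc)
    finally show "(\<Sum>j\<in>UNIV. ?S $ i $ j * xi_of \<psi> $ j + (- (?S ** Lambda_of \<psi> ** ?S)) $ i $ j * xi_of \<phi> $ j) = (?S *v (xi_of \<psi> - Lambda_of \<psi> *v mu_of \<phi>)) $ i" .
  qed
  ultimately show "((\<lambda>x. mu_of x $ i) has_derivative (\<lambda>v. (?S *v (xi_of v - Lambda_of v *v mu_of \<phi>)) $ i)) (at \<phi>)"
    by (simp add: mu_of_def[abs_def] matrix_vector_mult_def del: pack_simps)
qed

lemma linear_trace_Lambda: "linear (\<lambda>\<phi>. trace (Lambda_of \<phi> ** A))"
  unfolding Lambda_of_smat trace_mul_sym[of "smat _"]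
  using linear_compose[OF linear_sigma_of linear_trace_smat[of A]] by (simp add: comp_def)

lemma linear_inner_xi: "linear (\<lambda>\<phi>. xi_of \<phi> \<bullet> m)"
  by (rule linearI) (simp_all add: linear_add[OF linear_xi_of] linear_scale[OF linear_xi_of] inner_add_left del: pack_simps)

text \<open>The part of the log-likelihood free of the data is differentiated through the fact that
  \<open>ref_loglik\<close> at the reference \<open>(\<mu>, \<Sigma>)\<close> belonging to \<open>\<phi>\<close> is maximal at \<open>\<phi>\<close>.\<close>
lemma has_derivative_ref_loglik:
  assumes \<phi>: "\<phi> \<in> full_params"
  shows "(ref_loglik m X has_derivative (\<lambda>\<psi>. xi_of \<psi> \<bullet> (m - mu_of \<phi>) -
    trace (Lambda_of \<psi> ** (smat X + outer m m - matrix_inv (Lambda_of \<phi>) - outer (mu_of \<phi>) (mu_of \<phi>))) / 2)) (at \<phi>)"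
proof -
  let ?K = "\<lambda>\<phi>. ln (det (Lambda_of \<phi>)) / 2 - xi_of \<phi> \<bullet> mu_of \<phi> / 2"
  let ?l = "\<lambda>m X \<phi>. xi_of \<phi> \<bullet> m - trace (Lambda_of \<phi> ** (smat X + outer m m)) / 2"
  have sp: "sigma_of \<phi> \<in> pd_cone" using \<phi> by (simp add: full_params_iff)
  define Y where "Y = vinv (sigma_of \<phi>)"
  have Y: "Y \<in> pd_cone" by (simp add: Y_def vinv_pd_cone sp)
  have sY: "smat Y = matrix_inv (Lambda_of \<phi>)" by (simp add: Y_def smat_vinv pd_cone_invertible sp Lambda_of_smat)
  have pk: "peak (mu_of \<phi>) Y = \<phi>"
    using Lambda_mu_of[OF \<phi>] by (simp add: peak_def canonical_eq_iff Y_def vinv_vinv sp Lambda_of_smat del: pack_simps(6,7))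
  have "((\<lambda>\<phi>. ln (det (Lambda_of \<phi>))) has_derivative (\<lambda>\<psi>. trace (matrix_inv (Lambda_of \<phi>) ** Lambda_of \<psi>))) (at \<phi>)"
    using has_derivative_compose[OF linear_imp_has_derivative[OF linear_sigma_of] has_derivative_ln_det_smat[OF sp]]
    by (simp add: Lambda_of_smat)
  moreover have "((\<lambda>\<phi>. xi_of \<phi> \<bullet> mu_of \<phi>) has_derivative (\<lambda>\<psi>. xi_of \<phi> \<bullet> (matrix_inv (Lambda_of \<phi>) *v (xi_of \<psi> - Lambda_of \<psi> *v mu_of \<phi>)) + xi_of \<psi> \<bullet> mu_of \<phi>)) (at \<phi>)"
    by (intro has_derivative_inner linear_imp_has_derivative linear_xi_of has_derivative_mu_of \<phi>)
  ultimately have "(?K has_derivative (\<lambda>\<psi>. trace (matrix_inv (Lambda_of \<phi>) ** Lambda_of \<psi>) / 2 -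
      (xi_of \<phi> \<bullet> (matrix_inv (Lambda_of \<phi>) *v (xi_of \<psi> - Lambda_of \<psi> *v mu_of \<phi>)) + xi_of \<psi> \<bullet> mu_of \<phi>) / 2)) (at \<phi>)"
    by (intro has_derivative_diff bounded_linear.has_derivative[OF bounded_linear_divide])
  \<comment> \<open>Only the existence of the derivative is retained; its value is obtained from
    maximality.\<close>
  then obtain D where D: "(?K has_derivative D) (at \<phi>)" by blast
  have l: "(?l m X has_derivative ?l m X) (at \<phi>)" for m X
  proof -
    have "linear (\<lambda>\<phi>. trace (Lambda_of \<phi> ** (smat X + outer m m)) / 2)"
      using linear_compose_scale_right[OF linear_trace_Lambda, of "1/2" "smat X + outer m m"] by simp
    then show ?thesis by (intro linear_imp_has_derivative linear_compose_sub linear_inner_xi)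
  qed
  have split: "ref_loglik m X = (\<lambda>\<phi>. ?l m X \<phi> + ?K \<phi>)" for m X
    by (simp add: ref_loglik_def mu_of_def fun_eq_iff)
  have dd: "(ref_loglik m X has_derivative (\<lambda>\<psi>. ?l m X \<psi> + D \<psi>)) (at \<phi>)" for m X
    unfolding split by (intro has_derivative_add l D)
  have "(\<lambda>\<psi>. ?l (mu_of \<phi>) Y \<psi> + D \<psi>) = (\<lambda>\<psi>. 0)"
  proof (rule differential_zero_maxmin[OF \<phi> open_full_params dd])
    show "(\<forall>\<psi>\<in>full_params. ref_loglik (mu_of \<phi>) Y \<psi> \<le> ref_loglik (mu_of \<phi>) Y \<phi>) \<or>
      (\<forall>\<psi>\<in>full_params. ref_loglik (mu_of \<phi>) Y \<phi> \<le> ref_loglik (mu_of \<phi>) Y \<psi>)"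
      using ref_loglik_le_peak[OF Y, of _ "mu_of \<phi>"] unfolding pk by blast
  qed
  then have D': "D \<psi> = - ?l (mu_of \<phi>) Y \<psi>" for \<psi> by (metis add_eq_0_iff)
  have "?l m X \<psi> - ?l (mu_of \<phi>) Y \<psi> = xi_of \<psi> \<bullet> (m - mu_of \<phi>) -
    trace (Lambda_of \<psi> ** (smat X + outer m m - matrix_inv (Lambda_of \<phi>) - outer (mu_of \<phi>) (mu_of \<phi>))) / 2" for \<psi>
  proof -
    have "Lambda_of \<psi> ** (smat X + outer m m - smat Y - outer (mu_of \<phi>) (mu_of \<phi>)) =
      Lambda_of \<psi> ** (smat X + outer m m) - Lambda_of \<psi> ** (smat Y + outer (mu_of \<phi>) (mu_of \<phi>))"
      by (simp add: matrix_matrix_mult_def vec_eq_iff sum_subtractf[symmetric] algebra_simps del: smat_nth)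
    then have tr: "trace (Lambda_of \<psi> ** (smat X + outer m m - smat Y - outer (mu_of \<phi>) (mu_of \<phi>))) =
      trace (Lambda_of \<psi> ** (smat X + outer m m)) - trace (Lambda_of \<psi> ** (smat Y + outer (mu_of \<phi>) (mu_of \<phi>)))"
      by (simp only: trace_sub)
    show ?thesis unfolding sY[symmetric] tr by (simp add: inner_diff_right diff_divide_distrib)
  qed
  then have "?l m X \<psi> + D \<psi> = xi_of \<psi> \<bullet> (m - mu_of \<phi>) -
    trace (Lambda_of \<psi> ** (smat X + outer m m - matrix_inv (Lambda_of \<phi>) - outer (mu_of \<phi>) (mu_of \<phi>))) / 2" for \<psi>
    unfolding D' by (simp only: diff_conv_add_uminus)
  then show ?thesis using dd[of m X] by (simp only:)
qed

subsection \<open>Maximum likelihood estimates and Fisher information\<close>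

lemma gradient_inner:
  assumes D: "(f has_derivative D) (at x)"
  shows "gradient f x \<bullet> v = D v"
proof -
  have e: "frechet_derivative f (at x) = D" using frechet_derivative_at[OF D] by simp
  have lin: "linear D" using has_derivative_bounded_linear[OF D] by (rule bounded_linear.linear)
  have "D v = D (\<Sum>i\<in>UNIV. v $ i *\<^sub>R axis i 1)"
    using basis_expansion[of v] by (simp add: scalar_mult_eq_scaleR)
  also have "\<dots> = (\<Sum>i\<in>UNIV. v $ i * D (axis i 1))"
    by (simp add: linear_sum[OF lin] linear_scale[OF lin])
  finally show ?thesis by (simp add: gradient_def e inner_vec_def mult.commute)
qed

lemma gradient_nth:
  "(f has_derivative D) (at x) \<Longrightarrow> gradient f x $ k = D (axis k 1)"
  using frechet_derivative_at[of f D x] by (simp add: gradient_def)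

text \<open>Uniqueness of the maximizer pins down the arbitrary choice made in
  \<open>arg_max_on\<close>.\<close>

lemma mleI:
  fixes l :: "'b \<Rightarrow> real"
  assumes \<phi>: "\<phi> \<in> \<Omega>" and le: "\<And>\<psi>. \<psi> \<in> \<Omega> \<Longrightarrow> l \<psi> \<le> l \<phi>"
    and eq: "\<And>\<psi>. \<psi> \<in> \<Omega> \<Longrightarrow> l \<psi> = l \<phi> \<Longrightarrow> \<psi> = \<phi>"
  shows "mle_exists \<Omega> l" "mle \<Omega> l = \<phi>"
proof -
  have \<phi>max: "is_arg_max l (\<lambda>x. x \<in> \<Omega>) \<phi>" using \<phi> le by (auto simp: is_arg_max_def not_less)
  then show "mle_exists \<Omega> l" by (auto simp: mle_exists_def)
  have "\<psi> = \<phi>" if "is_arg_max l (\<lambda>x. x \<in> \<Omega>) \<psi>" for \<psi>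
    using that \<phi> le[of \<psi>] eq[of \<psi>] by (auto simp: is_arg_max_def not_less dest!: spec[of _ \<phi>])
  then show "mle \<Omega> l = \<phi>"
    unfolding arg_max_on_def arg_max_def using \<phi>max by blast
qed

lemma has_derivative_normal_loglik:
  fixes y :: "nat \<Rightarrow> real^'p::finite"
  assumes n: "n > 0" and \<phi>: "\<phi> \<in> full_params"
  shows "(normal_loglik n y has_derivative (\<lambda>\<psi>. real n * (xi_of \<psi> \<bullet> (sample_mean n y - mu_of \<phi>) -
    trace (Lambda_of \<psi> ** (smat (sample_cov n y) + outer (sample_mean n y) (sample_mean n y)
      - matrix_inv (Lambda_of \<phi>) - outer (mu_of \<phi>) (mu_of \<phi>))) / 2))) (at \<phi>)"
proof -
  have "((\<lambda>\<phi>. real n * ref_loglik (sample_mean n y) (sample_cov n y) \<phi> - real n * real CARD('p) * ln (2 * pi) / 2) has_derivative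
    (\<lambda>\<psi>. real n * (xi_of \<psi> \<bullet> (sample_mean n y - mu_of \<phi>) -
    trace (Lambda_of \<psi> ** (smat (sample_cov n y) + outer (sample_mean n y) (sample_mean n y)
      - matrix_inv (Lambda_of \<phi>) - outer (mu_of \<phi>) (mu_of \<phi>))) / 2) - 0)) (at \<phi>)"
    by (intro has_derivative_diff has_derivative_const has_derivative_mult_right has_derivative_ref_loglik \<phi>)
  then have "((\<lambda>\<phi>. real n * ref_loglik (sample_mean n y) (sample_cov n y) \<phi> - real n * real CARD('p) * ln (2 * pi) / 2) has_derivative
    (\<lambda>\<psi>. real n * (xi_of \<psi> \<bullet> (sample_mean n y - mu_of \<phi>) -
    trace (Lambda_of \<psi> ** (smat (sample_cov n y) + outer (sample_mean n y) (sample_mean n y)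
      - matrix_inv (Lambda_of \<phi>) - outer (mu_of \<phi>) (mu_of \<phi>))) / 2))) (at \<phi>)"
    by (simp only: diff_0_right)
  then show ?thesis
    by (rule has_derivative_transform_within_open[OF _ open_full_params \<phi>])
      (simp add: normal_loglik_eq_ref_loglik[OF n])
qed

lemma has_zeros_iff: "has_zeros E (Lambda_of \<phi>) \<longleftrightarrow> (\<forall>e\<in>E. \<phi> $ Inr e = 0)"
proof -
  have "has_zeros E (Lambda_of \<phi>) \<longleftrightarrow> (\<forall>i j. Upair i j \<in> E \<longrightarrow> \<phi> $ Inr (Upair i j) = 0)"
    by (simp add: has_zeros_def Lambda_of_def)
  also have "\<dots> \<longleftrightarrow> (\<forall>e\<in>E. \<phi> $ Inr e = 0)" by (metis uprod_exhaust)
  finally show ?thesis .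
qed

lemma trace_Lambda_completion:
  assumes "has_zeros E (Lambda_of \<phi>)"
  shows "trace (Lambda_of \<phi> ** smat (pd_completion E X)) = trace (Lambda_of \<phi> ** smat X)"
  unfolding Lambda_of_smat trace_smat_mult
  using assms by (intro sum.cong refl) (metis has_zeros_iff mult_zero_left pack_simps(7) pd_completion_nth)

text \<open>Under the null model the covariance enters the likelihood only through its entries
  outside \<open>E\<close>. The constrained problem for \<open>X\<close> thus has the same
  likelihood as the one for the completion.\<close>

lemma ref_loglik_completion:
  assumes "\<phi> \<in> null_params E"
  shows "ref_loglik m (pd_completion E X) \<phi> = ref_loglik m X \<phi>"
  using trace_Lambda_completion[of E \<phi> X] assms
  by (simp add: null_params_def ref_loglik_eq)

context
  fixes n :: nat and y :: "nat \<Rightarrow> real^'p" and E :: "('p::finite) uprod set"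
    and S S0 :: "real^'p uprod" and m :: "real^'p" and l0 :: "'p canonical \<Rightarrow> real" and k0 :: real
  assumes n: "n > 0" and E: "\<forall>e\<in>E. proper_uprod e"
    and S_def: "S = sample_cov n y" and S0_def: "S0 = pd_completion E S" and m_def: "m = sample_mean n y"
    and l0_def: "l0 = normal_loglik n y" and k0_def: "k0 = real n * real CARD('p) * ln (2 * pi) / 2"
begin

lemma l0_eq: "\<phi> \<in> full_params \<Longrightarrow> l0 \<phi> = real n * ref_loglik m S \<phi> - k0"
  unfolding l0_def m_def S_def k0_def by (rule normal_loglik_eq_ref_loglik[OF n])

text \<open>Stated for any multiple of \<open>ref_loglik m X\<close> up to a constant, so that it
  applies to the observed likelihood and to each tilted one.\<close>

lemma full_mle_iff:
  assumes l: "\<And>\<phi>. \<phi> \<in> full_params \<Longrightarrow> l \<phi> = real n * ref_loglik m X \<phi> - k"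
  shows "mle_exists full_params l \<longleftrightarrow> X \<in> pd_cone"
    and "X \<in> pd_cone \<Longrightarrow> mle full_params l = peak m X"
proof -
  have *: "mle_exists full_params l \<and> mle full_params l = peak m X" if X: "X \<in> pd_cone"
  proof -
    have "peak m X \<in> full_params" by (rule peak_full_params[OF X])
    moreover have "l \<psi> \<le> l (peak m X)" if "\<psi> \<in> full_params" for \<psi>
      using that ref_loglik_le_peak[OF X that] n by (simp add: l peak_full_params[OF X])
    moreover have "\<psi> = peak m X" if "\<psi> \<in> full_params" "l \<psi> = l (peak m X)" for \<psi>
      using that ref_loglik_eq_peakD[OF X that(1)] n by (simp add: l peak_full_params[OF X])
    ultimately show ?thesis using mleI[of "peak m X" full_params l] by blast
  qed
  then show "X \<in> pd_cone \<Longrightarrow> mle full_params l = peak m X" by blast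
  show "mle_exists full_params l \<longleftrightarrow> X \<in> pd_cone"
  proof
    assume "mle_exists full_params l"
    then obtain \<phi> where \<phi>: "is_arg_max l (\<lambda>x. x \<in> full_params) \<phi>" by (auto simp: mle_exists_def)
    show "X \<in> pd_cone"
    proof (rule ccontr)
      assume "X \<notin> pd_cone"
      then obtain \<psi> where "\<psi> \<in> full_params" "ref_loglik m X \<phi> < ref_loglik m X \<psi>"
        using ref_loglik_unbounded \<phi> by (metis is_arg_max_def)
      then show False using \<phi> n by (auto simp: is_arg_max_def l)
    qed
  qed (use * in blast)
qed

lemma full_mle_exists_iff: "mle_exists full_params l0 \<longleftrightarrow> S \<in> pd_cone"
  by (rule full_mle_iff(1)) (rule l0_eq)

context
  assumes S: "S \<in> pd_cone"
begin

lemma S0: "S0 \<in> pd_cone"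
  unfolding S0_def by (rule pd_completion_pd_cone[OF E S])

lemma peak_null_params: "peak m S0 \<in> null_params E"
proof -
  have "has_zeros E (Lambda_of (peak m S0))"
    using vinv_completion_nth[OF E S] by (simp add: has_zeros_iff peak_def S0_def)
  then show ?thesis by (simp add: null_params_def peak_full_params S0)
qed

text \<open>\<open>peak m S0\<close> maximizes the likelihood for the completion \<open>S0\<close>
  over the full model and has the required zeros, since the inverse of \<open>S0\<close> vanishes on
  \<open>E\<close>. On the null model this likelihood coincides with the observed one.\<close>

lemma null_mle: "mle_exists (null_params E) l0" "mle (null_params E) l0 = peak m S0"
proof -
  have l: "l0 \<phi> = real n * ref_loglik m S0 \<phi> - k0" if "\<phi> \<in> null_params E" for \<phi>
    using that ref_loglik_completion[OF that] by (simp add: l0_eq null_params_def S0_def)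
  have sub: "null_params E \<subseteq> full_params" by (auto simp: null_params_def)
  have "l0 \<psi> \<le> l0 (peak m S0)" if "\<psi> \<in> null_params E" for \<psi>
    using that sub ref_loglik_le_peak[OF S0, of \<psi> m] by (simp add: l peak_null_params subset_iff mult_left_mono)
  moreover have "\<psi> = peak m S0" if "\<psi> \<in> null_params E" "l0 \<psi> = l0 (peak m S0)" for \<psi>
    using that sub ref_loglik_eq_peakD[OF S0, of \<psi> m] n by (simp add: l peak_null_params subset_iff)
  ultimately show "mle_exists (null_params E) l0" "mle (null_params E) l0 = peak m S0"
    using mleI[of "peak m S0" "null_params E" l0] peak_null_params by blast+
qed

text \<open>The score at the constrained estimate has no component along \<open>xi\<close>, because
  both fits have mean \<open>m\<close>; its matrix component is the difference of \<open>S\<close>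
  and \<open>S0\<close>. Tilting by a multiple of it therefore moves the covariance along the line
  through the two.\<close>

lemma tilted_loglik_path:
  assumes \<phi>: "\<phi> \<in> full_params"
  shows "tilted_loglik l0 (directional_path (null_params E) l0 t) \<phi> = real n * ref_loglik m (slide E t S) \<phi> - k0"
proof -
  let ?T = "trace (Lambda_of \<phi> ** smat (S - S0))"
  have "\<phi> \<bullet> directional_path (null_params E) l0 t = - (1 - t) * (gradient l0 (peak m S0) \<bullet> \<phi>)"
    unfolding directional_path_def null_mle(2) by (simp add: inner_commute algebra_simps)
  also have "gradient l0 (peak m S0) \<bullet> \<phi> = - real n * ?T / 2"
    unfolding l0_def gradient_inner[OF has_derivative_normal_loglik[OF n peak_full_params[OF S0]]]
      mu_of_peak[OF S0] matrix_inv_Lambda_of_peak[OF S0]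
    by (simp add: smat_diff S_def m_def)
  finally have 1: "\<phi> \<bullet> directional_path (null_params E) l0 t = real n * ((1 - t) * ?T / 2)" by (simp add: field_simps)
  have "slide E t S = S + (t - 1) *\<^sub>R (S - S0)" by (simp add: slide_def S0_def algebra_simps)
  then have "smat (slide E t S) = smat S + (t - 1) *\<^sub>R smat (S - S0)" by (simp only: smat_add smat_scaleR)
  moreover have "trace (A ** (B + c *\<^sub>R C)) = trace (A ** B) + c * trace (A ** C)" for A B C :: "real^'p^'p" and c
    by (simp add: trace_def matrix_matrix_mult_def sum.distrib sum_distrib_left algebra_simps)
  ultimately have "trace (Lambda_of \<phi> ** smat (slide E t S)) = trace (Lambda_of \<phi> ** smat S) + (t - 1) * ?T"
    by simp
  then have "ref_loglik m (slide E t S) \<phi> = ref_loglik m S \<phi> + (1 - t) * ?T / 2"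
    by (simp add: ref_loglik_eq[OF \<phi>] field_simps)
  then show ?thesis
    unfolding tilted_loglik_def 1 l0_eq[OF \<phi>] by (simp add: algebra_simps)
qed

lemma tilted_mle:
  "mle_exists full_params (tilted_loglik l0 (directional_path (null_params E) l0 t)) \<longleftrightarrow> slide E t S \<in> pd_cone"
  "slide E t S \<in> pd_cone \<Longrightarrow> mle full_params (tilted_loglik l0 (directional_path (null_params E) l0 t)) = peak m (slide E t S)"
  using full_mle_iff[of "tilted_loglik l0 (directional_path (null_params E) l0 t)", OF tilted_loglik_path] by blast+

end

end

section \<open>The determinant of the information as a product of linear maps\<close>

definition shear_xi :: "real^'p \<Rightarrow> ('p::finite) canonical \<Rightarrow> 'p canonical" where
  "shear_xi m \<psi> = pack (xi_of \<psi> - Lambda_of \<psi> *v m) (sigma_of \<psi>)"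

definition shear_sigma :: "real^'p \<Rightarrow> ('p::finite) canonical \<Rightarrow> 'p canonical" where
  "shear_sigma m z = pack (xi_of z) (sigma_of z - svec (outer (xi_of z) m + outer m (xi_of z)))"

text \<open>The coefficients of the gradient: \<open>n\<close> for the coordinates of
  \<open>xi\<close>, and for an entry of \<open>Lambda\<close> the factor \<open>n / 2\<close> times
  the multiplicity of that entry in the trace form.\<close>

definition fisher_weight :: "nat \<Rightarrow> 'p + ('p::finite) uprod \<Rightarrow> real" where
  "fisher_weight n k = (case k of Inl i \<Rightarrow> real n | Inr e \<Rightarrow> real n * upair_weight e / 2)"

definition scale_weight :: "nat \<Rightarrow> ('p::finite) canonical \<Rightarrow> 'p canonical" where
  "scale_weight n z = (\<chi> k. fisher_weight n k * z $ k)"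

lemma linear_scale_weight: "linear (scale_weight n)"
  by (rule linearI) (simp_all add: scale_weight_def vec_eq_iff algebra_simps)

lemma matrix_vector_mult_Lambda: "linear (\<lambda>\<psi>. Lambda_of \<psi> *v m)"
  by (rule linearI) (simp_all add: Lambda_of_def vec_eq_iff matrix_vector_mult_def sum.distrib sum_distrib_left algebra_simps)

lemma linear_shear_xi: "linear (shear_xi m)"
  unfolding shear_xi_def[abs_def]
  by (intro linear_pack linear_compose_sub linear_xi_of linear_sigma_of matrix_vector_mult_Lambda)

lemma linear_svec_outer: "linear (\<lambda>v. svec (outer v m + outer m v))"
proof -
  have "linear (\<lambda>v. outer v m + outer m v)"
    by (rule linearI) (simp_all add: vec_eq_iff algebra_simps)
  from linear_compose[OF this linear_svec] show ?thesis by (simp add: comp_def)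
qed

lemma linear_shear_sigma: "linear (shear_sigma m)"
  unfolding shear_sigma_def[abs_def]
  using linear_compose[OF linear_xi_of linear_svec_outer[of m]]
  by (intro linear_pack linear_compose_sub linear_xi_of linear_sigma_of) (simp add: comp_def)

text \<open>\<open>f a\<close> is the square of \<open>f\<close> at half of \<open>a\<close>, whose
  determinant is nonzero because the negative argument gives the inverse map. The shears are such
  families in \<open>m\<close>.\<close>

lemma det_additive_family_pos:
  fixes f :: "real^'p \<Rightarrow> real^'k \<Rightarrow> real^'k"
  assumes lin: "\<And>a. linear (f a)" and add: "\<And>a b. f (a + b) = f a \<circ> f b" and zero: "f 0 = id"
  shows "det (matrix (f a)) > 0"
proof -
  have D: "det (matrix (f (a + b))) = det (matrix (f a)) * det (matrix (f b))" for a b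
    by (simp add: add matrix_compose lin det_mul)
  let ?h = "(1/2) *\<^sub>R a"
  have "det (matrix (f ?h)) * det (matrix (f (- ?h))) = 1"
    using D[of ?h "- ?h"] by (simp add: zero matrix_id)
  then have "det (matrix (f ?h)) \<noteq> 0" by auto
  moreover have "det (matrix (f a)) = det (matrix (f ?h)) * det (matrix (f ?h))"
    using D[of ?h ?h] by (simp add: scaleR_add_left[symmetric])
  ultimately show ?thesis by (metis not_real_square_gt_zero)
qed

lemma det_shear_xi_pos: "det (matrix (shear_xi m)) > 0"
proof (rule det_additive_family_pos[OF linear_shear_xi])
  show "shear_xi (a + b) = shear_xi a \<circ> shear_xi b" for a b :: "real^'a"
    by (simp add: fun_eq_iff shear_xi_def Lambda_of_smat matrix_vector_right_distrib algebra_simps)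
  show "shear_xi (0 :: real^'a) = id" by (simp add: fun_eq_iff shear_xi_def)
qed

lemma det_shear_sigma_pos: "det (matrix (shear_sigma m)) > 0"
proof (rule det_additive_family_pos[OF linear_shear_sigma])
  show "shear_sigma (a + b) = shear_sigma a \<circ> shear_sigma b" for a b :: "real^'a"
  proof
    fix z :: "'a canonical"
    have "outer (xi_of z) (a + b) + outer (a + b) (xi_of z) = (outer (xi_of z) a + outer a (xi_of z)) + (outer (xi_of z) b + outer b (xi_of z))"
      by (simp add: vec_eq_iff algebra_simps)
    then show "shear_sigma (a + b) z = (shear_sigma a \<circ> shear_sigma b) z"
      by (simp add: shear_sigma_def linear_add[OF linear_svec] algebra_simps)
  qed
  have "outer v 0 = 0" "outer 0 v = 0" for v :: "real^'a" by (simp_all add: vec_eq_iff)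
  then show "shear_sigma (0 :: real^'a) = id"
    by (simp add: fun_eq_iff shear_sigma_def linear_0[OF linear_svec])
qed

lemma canon_congr_mult: "canon_congr (g ** h) = canon_congr g \<circ> canon_congr h"
  by (simp add: canon_congr_def fun_eq_iff congr_mult matrix_vector_mul_assoc)

text \<open>Writing \<open>A\<close> as a square removes the absolute value from the general
  formula.\<close>

lemma det_canon_congr_posdef:
  fixes A :: "real^'p^'p::finite"
  assumes A: "posdef A"
  shows "det (matrix (canon_congr A)) = det A ^ (CARD('p) + 2)"
proof -
  obtain h where h: "posdef h" "h ** h = A" using posdef_sqrt[OF A] by metis
  have "det (matrix (canon_congr A)) = \<bar>det (matrix (canon_congr h))\<bar> * \<bar>det (matrix (canon_congr h))\<bar>"
    by (simp add: h(2)[symmetric] canon_congr_mult matrix_compose linear_canon_congr det_mul)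
  also have "\<dots> = (\<bar>det h\<bar> * \<bar>det h\<bar>) ^ (CARD('p) + 2)"
    unfolding abs_det_canon_congr[OF posdef_invertible[OF h(1)]] by (rule power_mult_distrib[symmetric])
  also have "\<bar>det h\<bar> * \<bar>det h\<bar> = det A" by (simp add: h(2)[symmetric] det_mul)
  finally show ?thesis .
qed

lemma trace_smat_axis_Upair:
  assumes "transpose A = A"
  shows "trace (smat (axis (Upair i j) 1) ** A) = upair_weight (Upair i j) * A $ i $ j"
proof -
  have "trace (smat (axis (Upair i j) 1) ** A) = trace (smat (svec A) ** smat (axis (Upair i j) 1))"
    by (subst trace_mul_sym) (simp add: smat_svec[OF assms])
  then show ?thesis by (simp only: trace_smat_axis svec_nth[OF assms])
qed

text \<open>The tilt \<open>s\<close> is constant in the gradient and drops out. Read from right to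
  left, the factors centre the direction at the mean, turn it into the change of the mean and minus
  the change of the covariance, pass to second moments about 0, and apply the coefficients of the
  gradient.\<close>

lemma information_tilted_loglik:
  fixes \<phi> :: "('p::finite) canonical"
  assumes n: "n > 0" and \<phi>: "\<phi> \<in> full_params"
  shows "information (tilted_loglik (normal_loglik n y) s) \<phi> =
    matrix (scale_weight n \<circ> shear_sigma (mu_of \<phi>) \<circ> canon_congr (matrix_inv (Lambda_of \<phi>)) \<circ> shear_xi (mu_of \<phi>))"
    (is "_ = matrix ?J")
proof -
  let ?l = "tilted_loglik (normal_loglik n y) s" and ?m = "sample_mean n y"
  let ?A = "smat (sample_cov n y) + outer ?m ?m"
  let ?S = "\<lambda>\<phi>. matrix_inv (Lambda_of \<phi>)"
  let ?\<nu> = "\<lambda>\<psi>. ?S \<phi> *v (xi_of \<psi> - Lambda_of \<psi> *v mu_of \<phi>)"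
  have tS: "transpose (?S \<phi>) = ?S \<phi>" if "\<phi> \<in> full_params" for \<phi> :: "'p canonical"
    using full_params_posdef[OF that] by (intro posdef_symmetric posdef_matrix_inv)
  have dl: "(?l has_derivative (\<lambda>\<psi>. \<psi> \<bullet> s + real n * (xi_of \<psi> \<bullet> (?m - mu_of \<phi>) - trace (Lambda_of \<psi> ** (?A
      - ?S \<phi> - outer (mu_of \<phi>) (mu_of \<phi>))) / 2))) (at \<phi>)" if "\<phi> \<in> full_params" for \<phi>
    unfolding tilted_loglik_def[abs_def]
    by (intro has_derivative_add has_derivative_normal_loglik[OF n that] has_derivative_inner_left has_derivative_ident)
  have axL: "xi_of (axis (Inl i) 1) = axis i 1" "Lambda_of (axis (Inl i) 1) = 0"
    "xi_of (axis (Inr e) 1) = 0" "Lambda_of (axis (Inr e) 1) = smat (axis e 1)" for i :: 'p and e :: "'p uprod"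
    by (simp_all add: vec_eq_iff Lambda_of_def axis_def)
  have gL: "gradient ?l \<phi> $ Inl i = s $ Inl i + real n * (?m $ i - mu_of \<phi> $ i)" if "\<phi> \<in> full_params" for \<phi> i
    unfolding gradient_nth[OF dl[OF that]] axL by (simp add: inner_axis' trace_def matrix_matrix_mult_def)
  have gR: "gradient ?l \<phi> $ Inr (Upair i j) = s $ Inr (Upair i j) - real n * upair_weight (Upair i j) / 2 *
    (?A $ i $ j - ?S \<phi> $ i $ j - mu_of \<phi> $ i * mu_of \<phi> $ j)" if \<phi>: "\<phi> \<in> full_params" for \<phi> i j
  proof -
    have "transpose (?A - ?S \<phi> - outer (mu_of \<phi>) (mu_of \<phi>)) = ?A - ?S \<phi> - outer (mu_of \<phi>) (mu_of \<phi>)"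
      using tS[OF \<phi>] by (simp add: transpose_def vec_eq_iff Upair_commute mult.commute)
    from trace_smat_axis_Upair[OF this, of i j]
    have t: "trace (smat (axis (Upair i j) 1) ** (?A - ?S \<phi> - outer (mu_of \<phi>) (mu_of \<phi>))) =
      upair_weight (Upair i j) * (?A $ i $ j - ?S \<phi> $ i $ j - mu_of \<phi> $ i * mu_of \<phi> $ j)"
      by (simp only: vector_minus_component outer_nth)
    show ?thesis
      unfolding gradient_nth[OF dl[OF \<phi>]] axL t by (simp add: inner_axis' del: vector_add_component)
  qed
  have mu': "((\<lambda>\<phi>. mu_of \<phi> $ i) has_derivative (\<lambda>\<psi>. ?\<nu> \<psi> $ i)) (at \<phi>)" for i
    using bounded_linear.has_derivative[OF bounded_linear_vec_nth has_derivative_mu_of[OF \<phi>]] .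
  have S': "((\<lambda>\<phi>. ?S \<phi> $ i $ j) has_derivative (\<lambda>\<psi>. - (?S \<phi> ** Lambda_of \<psi> ** ?S \<phi>) $ i $ j)) (at \<phi>)" for i j
    using bounded_linear.has_derivative[OF bounded_linear_compose[OF bounded_linear_vec_nth[of j] bounded_linear_vec_nth[of i]] has_derivative_matrix_inv_Lambda[OF \<phi>]]
    by simp
  have JL: "?J \<psi> $ Inl i = real n * ?\<nu> \<psi> $ i" for \<psi> i
    by (simp add: scale_weight_def fisher_weight_def shear_sigma_def canon_congr_def shear_xi_def)
  have JR: "?J \<psi> $ Inr (Upair i j) = real n * upair_weight (Upair i j) / 2 *
    ((?S \<phi> ** Lambda_of \<psi> ** ?S \<phi>) $ i $ j - (?\<nu> \<psi> $ i * mu_of \<phi> $ j + mu_of \<phi> $ i * ?\<nu> \<psi> $ j))" for \<psi> i j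
  proof -
    have "congr (?S \<phi>) (sigma_of \<psi>) $ Upair i j = (?S \<phi> ** Lambda_of \<psi> ** ?S \<phi>) $ i $ j"
      using smat_nth[of "congr (?S \<phi>) (sigma_of \<psi>)" i j]
      unfolding smat_congr tS[OF \<phi>] Lambda_of_smat[of \<psi>, symmetric] by simp
    moreover have "svec (outer v w + outer w v) $ Upair i j = v $ i * w $ j + w $ i * v $ j" for v w :: "real^'p"
      by (subst svec_nth) (simp_all add: transpose_def vec_eq_iff mult.commute add.commute)
    ultimately show ?thesis
      by (simp add: scale_weight_def fisher_weight_def shear_sigma_def canon_congr_def shear_xi_def del: pack_simps(7))
  qed
  have "(gradient ?l has_derivative (\<lambda>\<psi>. - ?J \<psi>)) (at \<phi>)"
  proof (rule has_derivative_vecI)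
    fix k :: "'p + 'p uprod"
    show "((\<lambda>x. gradient ?l x $ k) has_derivative (\<lambda>v. (- ?J v) $ k)) (at \<phi>)"
    proof (cases k)
      case (Inl i)
      have "((\<lambda>\<phi>. s $ Inl i + real n * (?m $ i - mu_of \<phi> $ i)) has_derivative (\<lambda>\<psi>. (- ?J \<psi>) $ Inl i)) (at \<phi>)"
        unfolding vector_uminus_component JL by (auto intro!: derivative_eq_intros mu')
      then show ?thesis unfolding Inl
        by (rule has_derivative_transform_within_open[OF _ open_full_params \<phi>]) (simp add: gL)
    next
      case (Inr e)
      obtain i j where e: "e = Upair i j" by (cases e)
      have "((\<lambda>\<phi>. s $ Inr (Upair i j) - real n * upair_weight (Upair i j) / 2 *
         (?A $ i $ j - ?S \<phi> $ i $ j - mu_of \<phi> $ i * mu_of \<phi> $ j)) has_derivative (\<lambda>\<psi>. (- ?J \<psi>) $ Inr (Upair i j))) (at \<phi>)"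
        unfolding vector_uminus_component JR
        by (rule derivative_eq_intros mu' S' refl)+ (simp add: fun_eq_iff algebra_simps)
      then show ?thesis unfolding Inr e
        by (rule has_derivative_transform_within_open[OF _ open_full_params \<phi>]) (simp add: gR)
    qed
  qed
  then have "jacobian (gradient ?l) (at \<phi>) = matrix (\<lambda>\<psi>. - ?J \<psi>)"
    unfolding jacobian_def by (simp only: frechet_derivative_at[symmetric])
  then show ?thesis by (simp add: information_def matrix_def vec_eq_iff)
qed

text \<open>\<open>K\<close> collects the weights and the two shears. It depends on \<open>m\<close>
  but is chosen before \<open>X\<close>, so it stays constant along the path, where the mean does
  not move.\<close>

lemma det_information:
  fixes X :: "real^('p::finite) uprod" and m :: "real^'p"
  assumes n: "n > 0"
  obtains K where "K > 0" "\<And>X y s. X \<in> pd_cone \<Longrightarrow>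
    det (information (tilted_loglik (normal_loglik n y) s) (peak m X)) = K * det (smat X) ^ (CARD('p) + 2)"
proof
  let ?K = "(\<Prod>k\<in>UNIV. fisher_weight n (k :: 'p + 'p uprod)) * det (matrix (shear_sigma m)) * det (matrix (shear_xi m))"
  have "fisher_weight n k > 0" for k :: "'p + 'p uprod"
    using n by (auto simp: fisher_weight_def upair_weight_pos split: sum.split)
  then show "?K > 0" by (intro mult_pos_pos prod_pos det_shear_xi_pos det_shear_sigma_pos) auto
  fix X :: "real^'p uprod" and y s assume X: "X \<in> pd_cone"
  have sw: "det (matrix (scale_weight n :: 'p canonical \<Rightarrow> _)) = (\<Prod>k\<in>UNIV. fisher_weight n (k :: 'p + 'p uprod))"
    by (rule abs_det_diagonal_map) (simp add: scale_weight_def)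
  have "posdef (smat X)" using X by (simp add: pd_cone_def)
  then show "det (information (tilted_loglik (normal_loglik n y) s) (peak m X)) = ?K * det (smat X) ^ (CARD('p) + 2)"
    unfolding information_tilted_loglik[OF n peak_full_params[OF X]] mu_of_peak[OF X] matrix_inv_Lambda_of_peak[OF X]
    by (simp add: matrix_compose linear_compose linear_scale_weight linear_shear_sigma linear_shear_xi
        linear_canon_congr det_mul sw det_canon_congr_posdef del: power_Suc)
qed

subsection \<open>The directional p-value\<close>

lemma slide_pd_cone_le:
  assumes E: "\<forall>e\<in>E. proper_uprod e" and x: "x \<in> pd_cone"
    and s: "slide E s x \<in> pd_cone" and t: "0 \<le> t" "t \<le> s"
  shows "slide E t x \<in> pd_cone"
proof (cases "s = 0")
  case True then show ?thesis using s t by simp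
next
  case False
  then have "s > 0" using t by simp
  then have "slide E t x = slide E (t / s) (slide E s x)" by simp
  then show ?thesis using slide_pd_cone[OF E s, of "t / s"] t \<open>s > 0\<close> by simp
qed

lemma slide_pd_cone_extend:
  assumes s: "slide E s x \<in> pd_cone"
  obtains t where "t > s" "slide E t x \<in> pd_cone"
proof -
  let ?f = "\<lambda>t. slide E t x"
  have "open (?f -` pd_cone)"
    unfolding slide_def by (intro open_vimage open_pd_cone continuous_intros)
  then obtain e where e: "e > 0" "ball s e \<subseteq> ?f -` pd_cone"
    using s open_contains_ball by (metis vimageI)
  have "s + e / 2 \<in> ball s e" using e(1) by (simp add: dist_real_def)
  then have "slide E (s + e / 2) x \<in> pd_cone" using e(2) by auto
  then show ?thesis using that[of "s + e / 2"] e(1) by simp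
qed

text \<open>Since the interval integral excludes its end points, its domain is exactly the set of
  \<open>t > r\<close> at which the line is in the cone; the cone condition inside
  \<open>cone_density\<close> thus replaces the upper limit, even when the latter is
  infinite.\<close>

lemma integral_slide_interval:
  fixes f :: "real \<Rightarrow> real"
  defines "T \<equiv> \<lambda>E x. (SUP t\<in>{t. slide E t x \<in> pd_cone}. ereal t)"
  assumes E: "\<forall>e\<in>E. proper_uprod e" and x: "x \<in> pd_cone" and r: "0 \<le> r" "r \<le> 1" and C: "C \<ge> 0"
    and f: "\<And>t. 0 \<le> t \<Longrightarrow> slide E t x \<in> pd_cone \<Longrightarrow> f t = C * det (smat (slide E t x)) powr a"
  shows "(LBINT t=ereal r..T E x. t ^ (card E - 1) * f t) = C * enn2real (tail E a r x)"
proof -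
  \<comment> \<open>From left to right by convexity, as all points between the completion and a
    point of the cone are in the cone. From right to left by openness, as the supremum is not
    attained.\<close>
  have Tr: "ereal r < ereal t \<and> ereal t < T E x \<longleftrightarrow> r < t \<and> slide E t x \<in> pd_cone" for t
  proof
    assume *: "ereal r < ereal t \<and> ereal t < T E x"
    then obtain s where "slide E s x \<in> pd_cone" "t < s" unfolding T_def less_SUP_iff by auto
    then show "r < t \<and> slide E t x \<in> pd_cone" using * r slide_pd_cone_le[OF E x, of s t] by auto
  next
    assume *: "r < t \<and> slide E t x \<in> pd_cone"
    then obtain s where "s > t" "slide E s x \<in> pd_cone" using slide_pd_cone_extend by metis
    then have "ereal t < T E x" unfolding T_def less_SUP_iff by auto
    then show "ereal r < ereal t \<and> ereal t < T E x" using * by simp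
  qed
  have "ereal r \<le> T E x"
  proof -
    have "ereal 1 \<le> T E x" unfolding T_def by (rule SUP_upper) (simp add: x)
    then show ?thesis using r order_trans[of "ereal r" "ereal 1"] by simp
  qed
  then have "(LBINT t=ereal r..T E x. t ^ (card E - 1) * f t) = (LBINT t:einterval (ereal r) (T E x). t ^ (card E - 1) * f t)"
    by (simp add: interval_lebesgue_integral_def)
  also have "\<dots> = (\<integral>t. C * (indicator {r<..} t * (t ^ (card E - 1) * enn2real (cone_density a (slide E t x)))) \<partial>lborel)"
    unfolding set_lebesgue_integral_def
  proof (rule Bochner_Integration.integral_cong[OF refl])
    fix t
    show "indicator (einterval (ereal r) (T E x)) t *\<^sub>R (t ^ (card E - 1) * f t) =
      C * (indicator {r<..} t * (t ^ (card E - 1) * enn2real (cone_density a (slide E t x))))"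
      using Tr[of t] f[of t] r
      by (cases "r < t \<and> slide E t x \<in> pd_cone") (auto simp: einterval_def indicator_def cone_density_def)
  qed
  also have "\<dots> = C * (\<integral>t. indicator {r<..} t * (t ^ (card E - 1) * enn2real (cone_density a (slide E t x))) \<partial>lborel)"
    by (rule integral_mult_right_zero)
  also have "(\<integral>t. indicator {r<..} t * (t ^ (card E - 1) * enn2real (cone_density a (slide E t x))) \<partial>lborel) =
    enn2real (\<integral>\<^sup>+t. ennreal (indicator {r<..} t * (t ^ (card E - 1) * enn2real (cone_density a (slide E t x)))) \<partial>lborel)"
  proof (rule integral_eq_nn_integral)
    show "(\<lambda>t. indicator {r<..} t * (t ^ (card E - 1) * enn2real (cone_density a (slide E t x)))) \<in> borel_measurable lborel"
      by measurable
    show "AE t in lborel. 0 \<le> indicator {r<..} t * (t ^ (card E - 1) * enn2real (cone_density a (slide E t x)))"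
      using r by (intro AE_I2) (auto simp: indicator_def)
  qed
  also have "(\<integral>\<^sup>+t. ennreal (indicator {r<..} t * (t ^ (card E - 1) * enn2real (cone_density a (slide E t x)))) \<partial>lborel) = tail E a r x"
    unfolding tail_def
  proof (rule nn_integral_cong)
    fix t
    show "ennreal (indicator {r<..} t * (t ^ (card E - 1) * enn2real (cone_density a (slide E t x)))) =
      indicator {r<..} t * (ennreal (t ^ (card E - 1)) * cone_density a (slide E t x))"
      using r cone_density_finite[of a "slide E t x"]
      by (cases "r < t") (auto simp: ennreal_mult less_top)
  qed
  finally show ?thesis .
qed

lemma zeros_pvalue_eq_radial_pvalue:
  fixes y :: "nat \<Rightarrow> real^'p" and E :: "('p::finite) uprod set"
  assumes n: "n > 0" and E: "\<forall>e\<in>E. proper_uprod e" and c: "c > 0"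
  shows "zeros_pvalue c n E y = (if sample_cov n y \<in> pd_cone
    then radial_pvalue E ((real n - real CARD('p) - 2) / 2) (sample_cov n y) else 0)"
proof (cases "sample_cov n y \<in> pd_cone")
  case False
  then show ?thesis
    by (simp add: zeros_pvalue_def directional_pvalue_def full_mle_exists_iff[OF n E refl refl refl refl refl])
next
  case S: True
  let ?S = "sample_cov n y" and ?m = "sample_mean n y" and ?l0 = "normal_loglik n y"
  let ?comp = "pd_completion E ?S" and ?p = "real CARD('p)"
  let ?a = "(real n - ?p - 2) / 2"
  let ?path = "directional_path (null_params E) ?l0"
  note ctx = n E refl refl refl refl refl S
  have S0: "?comp \<in> pd_cone" by (rule S0[OF ctx])
  obtain K where K: "K > 0" and det_info: "\<And>X s. X \<in> pd_cone \<Longrightarrow>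
    det (information (tilted_loglik ?l0 s) (peak ?m X)) = K * det (smat X) ^ (CARD('p) + 2)"
    using det_information[OF n, of ?m] by metis
  \<comment> \<open>Everything in the saddlepoint density that does not depend on \<open>t\<close>.
    It is positive and cancels in the ratio.\<close>
  define C where "C = c * det (smat ?comp) powr (- real n / 2) * K powr (- 1 / 2)"
  have dS0: "det (smat ?comp) > 0" by (rule pd_cone_det_pos[OF S0])
  have C: "C > 0" using c K dS0 by (simp add: C_def)
  have h: "saddlepoint c full_params (null_params E) ?l0 (?path t) = C * det (smat (slide E t ?S)) powr ?a"
    if X: "slide E t ?S \<in> pd_cone" for t
  proof -
    let ?X = "slide E t ?S"
    have dX: "det (smat ?X) > 0" by (rule pd_cone_det_pos[OF X])
    have null: "peak ?m ?comp \<in> null_params E" by (rule peak_null_params[OF ctx])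
    have "tilted_loglik ?l0 (?path t) (peak ?m ?comp) - tilted_loglik ?l0 (?path t) (peak ?m ?X) =
      real n * (ref_loglik ?m ?X (peak ?m ?comp) - ref_loglik ?m ?X (peak ?m ?X))"
      by (simp add: tilted_loglik_path[OF ctx] peak_full_params[OF S0] peak_full_params[OF X] algebra_simps)
    \<comment> \<open>\<open>?X\<close> differs from the completion only on \<open>E\<close>, where
      the constrained estimate vanishes, so the first term of the likelihood ratio does not depend
      on \<open>t\<close>.\<close>
    also have "ref_loglik ?m ?X (peak ?m ?comp) = ref_loglik ?m ?comp (peak ?m ?comp)"
      using ref_loglik_completion[OF null, of ?m ?X] by simp
    also have "real n * (ref_loglik ?m ?comp (peak ?m ?comp) - ref_loglik ?m ?X (peak ?m ?X)) =
      (- real n / 2) * ln (det (smat ?comp)) + (real n / 2) * ln (det (smat ?X))"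
      by (simp add: ref_loglik_peak S0 X field_simps)
    finally have "exp (tilted_loglik ?l0 (?path t) (peak ?m ?comp) - tilted_loglik ?l0 (?path t) (peak ?m ?X)) =
      det (smat ?comp) powr (- real n / 2) * det (smat ?X) powr (real n / 2)"
      using dX dS0 by (simp only: exp_add powr_def) simp
    moreover have "det (information (tilted_loglik ?l0 (?path t)) (peak ?m ?X)) powr (- 1 / 2) =
      K powr (- 1 / 2) * det (smat ?X) powr (- (?p + 2) / 2)"
    proof -
      have "det (smat ?X) ^ (CARD('p) + 2) = det (smat ?X) powr (?p + 2)"
        using dX powr_realpow[OF dX, of "CARD('p) + 2"] by (simp add: add.commute)
      then have "det (information (tilted_loglik ?l0 (?path t)) (peak ?m ?X)) = K * det (smat ?X) powr (?p + 2)"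
        by (simp only: det_info[OF X])
      also have "\<dots> powr (- 1 / 2) = K powr (- 1 / 2) * (det (smat ?X) powr (?p + 2)) powr (- 1 / 2)"
        by (rule powr_mult)
      also have "(det (smat ?X) powr (?p + 2)) powr (- 1 / 2) = det (smat ?X) powr (- (?p + 2) / 2)"
        unfolding powr_powr by (rule arg_cong[where f = "(powr) _"]) (simp add: field_simps)
      finally show ?thesis .
    qed
    moreover have "det (smat ?X) powr (real n / 2) * det (smat ?X) powr (- (?p + 2) / 2) = det (smat ?X) powr ?a"
      unfolding powr_add[symmetric] by (rule arg_cong[where f = "(powr) _"]) (simp add: field_simps)
    ultimately show ?thesis
      unfolding saddlepoint_def Let_def null_mle(2)[OF ctx] tilted_mle(2)[OF ctx X] C_def
      by (simp add: ac_simps)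
  qed
  have T: "t_sup full_params (null_params E) ?l0 = (SUP t\<in>{t. slide E t ?S \<in> pd_cone}. ereal t)"
    unfolding t_sup_def tilted_mle(1)[OF ctx] ..
  have I: "(LBINT t=ereal r..t_sup full_params (null_params E) ?l0. t ^ (card E - 1) * saddlepoint c full_params (null_params E) ?l0 (?path t))
    = C * enn2real (tail E ?a r ?S)" if "0 \<le> r" "r \<le> 1" for r
    unfolding T by (rule integral_slide_interval[OF E S that]) (use C h in auto)
  have ex: "mle_exists (null_params E) ?l0" "mle_exists full_params ?l0"
    using null_mle(1)[OF ctx] full_mle_exists_iff[OF n E refl refl refl refl refl] S by simp_all
  show ?thesis
    using I[of 1] I[of 0] C S ex
    by (simp add: zeros_pvalue_def directional_pvalue_def radial_pvalue_def zero_ereal_def one_ereal_def)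
qed

lemma PiM_density_lborel:
  fixes f :: "'a::euclidean_space \<Rightarrow> ennreal"
  assumes f [measurable]: "f \<in> borel_measurable borel" and sf: "sigma_finite_measure (density lborel f)" and I: "finite I"
  shows "PiM I (\<lambda>_. density lborel f) = density (PiM I (\<lambda>_. lborel)) (\<lambda>y. \<Prod>i\<in>I. f (y i))"
proof -
  interpret P: product_sigma_finite "\<lambda>_. density lborel f" by (rule product_sigma_finite.intro) (rule sf)
  have sP: "sets (PiM I (\<lambda>_. density lborel f)) = sets (PiM I (\<lambda>_. lborel))" by (intro sets_PiM_cong) auto
  have [measurable]: "(\<lambda>y. \<Prod>i\<in>I. f (y i)) \<in> borel_measurable (PiM I (\<lambda>_. lborel))"
    by (intro borel_measurable_prod_ennreal measurable_compose[OF measurable_component_singleton]) auto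
  show ?thesis
  proof (rule P.PiM_eqI[OF I, symmetric])
    show "sets (density (PiM I (\<lambda>_. lborel)) (\<lambda>y. \<Prod>i\<in>I. f (y i))) = sets (PiM I (\<lambda>_. density lborel f))"
      by (simp add: sP)
    fix A assume "\<And>i. i \<in> I \<Longrightarrow> A i \<in> sets (density lborel f)"
    then have A: "\<And>i. i \<in> I \<Longrightarrow> A i \<in> sets borel" by simp
    have "Pi\<^sub>E I A \<in> sets (PiM I (\<lambda>_. lborel))" using A by (intro sets_PiM_I_finite I) auto
    then have "emeasure (density (PiM I (\<lambda>_. lborel)) (\<lambda>y. \<Prod>i\<in>I. f (y i))) (Pi\<^sub>E I A) =
      (\<integral>\<^sup>+y. (\<Prod>i\<in>I. f (y i)) * indicator (Pi\<^sub>E I A) y \<partial>PiM I (\<lambda>_. lborel))"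
      by (intro emeasure_density) auto
    also have "\<dots> = (\<integral>\<^sup>+y. (\<Prod>i\<in>I. f (y i) * indicator (A i) (y i)) \<partial>PiM I (\<lambda>_. lborel))"
    proof (rule nn_integral_cong)
      fix y assume "y \<in> space (PiM I (\<lambda>_. lborel :: 'a measure))"
      then have "y \<in> Pi\<^sub>E I A \<longleftrightarrow> (\<forall>i\<in>I. y i \<in> A i)" by (auto simp: space_PiM PiE_iff)
      then show "(\<Prod>i\<in>I. f (y i)) * indicator (Pi\<^sub>E I A) y = (\<Prod>i\<in>I. f (y i) * indicator (A i) (y i))"
        using I by (auto simp: prod.distrib indicator_def)
    qed
    also have "\<dots> = (\<Prod>i\<in>I. \<integral>\<^sup>+x. f x * indicator (A i) x \<partial>lborel)"
      using A by (intro lborel_prod.product_nn_integral_prod I) auto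
    also have "\<dots> = (\<Prod>i\<in>I. emeasure (density lborel f) (A i))"
      using A by (intro prod.cong refl) (simp add: emeasure_density)
    finally show "emeasure (density (PiM I (\<lambda>_. lborel)) (\<lambda>y. \<Prod>i\<in>I. f (y i))) (Pi\<^sub>E I A) = (\<Prod>i\<in>I. emeasure (density lborel f) (A i))" .
  qed
qed

subsection \<open>Exact uniformity\<close>

lemma posdef_quadratic_nonneg: "posdef A \<Longrightarrow> 0 \<le> z \<bullet> (A *v z)"
  by (cases "z = 0") (auto simp: posdef_def less_imp_le)

lemma borel_measurable_quadratic [measurable]:
  "(\<lambda>z::real^'p. (z - \<mu>) \<bullet> (A *v (z - \<mu>))) \<in> borel_measurable borel"
  unfolding inner_vec_def matrix_vector_mult_def
  by (intro borel_measurable_continuous_onI) (auto intro!: continuous_intros)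

text \<open>The joint density of the sample is a product of a function of the sample covariance and a
  function of the sample mean, so the Wishart density carries over to the sample covariance.\<close>
lemma normal_sample_cov_distribution:
  fixes Y :: "nat \<Rightarrow> 'a \<Rightarrow> real^'p" and \<mu> :: "real^'p" and \<Lambda> :: "real^'p^'p::finite"
  assumes n: "n \<ge> CARD('p) + 1" and \<Lambda>: "posdef \<Lambda>" and M: "prob_space M"
    and indep: "prob_space.indep_vars M (\<lambda>_. borel) Y {1..n}"
    and Y: "\<forall>i\<in>{1..n}. distributed M lborel (Y i) (\<lambda>x. ennreal (mvnormal_density \<mu> (matrix_inv \<Lambda>) x))"
  shows "(\<lambda>\<omega>. sample_cov n (\<lambda>i. Y i \<omega>)) \<in> borel_measurable M"
    and "\<exists>C. \<forall>F\<in>borel_measurable borel. (\<integral>\<^sup>+\<omega>. F (sample_cov n (\<lambda>i. Y i \<omega>)) \<partial>M) =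
      C * (\<integral>\<^sup>+x. F x * (ennreal (exp (- real n / 2 * trace (\<Lambda> ** smat x))) *
        cone_density ((real n - real CARD('p) - 2) / 2) x) \<partial>lborel)"
proof -
  interpret prob_space M by fact
  have n0: "n > 0" using n by simp
  have iL: "invertible \<Lambda>" by (rule posdef_invertible[OF \<Lambda>])
  let ?Q = "\<lambda>z. (z - \<mu>) \<bullet> (\<Lambda> *v (z - \<mu>))"
  define k where "k = 1 / sqrt ((2 * pi) ^ CARD('p) * det (matrix_inv \<Lambda>))"
  have k: "k > 0" using posdef_det_pos[OF posdef_matrix_inv[OF \<Lambda>]] by (simp add: k_def)
  let ?\<phi> = "\<lambda>z. ennreal (mvnormal_density \<mu> (matrix_inv \<Lambda>) z)"
  have \<phi>_eq: "mvnormal_density \<mu> (matrix_inv \<Lambda>) z = k * exp (- ?Q z / 2)" for z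
    by (simp add: mvnormal_density_def k_def matrix_inv_matrix_inv[OF iL])
  have \<phi> [measurable]: "?\<phi> \<in> borel_measurable borel" unfolding \<phi>_eq by measurable
  have Ym: "Y i \<in> borel_measurable M" and Yd: "distr M borel (Y i) = density lborel ?\<phi>" if "i \<in> {1..n}" for i
  proof -
    have d: "distributed M lborel (Y i) ?\<phi>" using Y that by blast
    show "Y i \<in> borel_measurable M" using distributed_measurable[OF d] by simp
    have "distr M borel (Y i) = distr M lborel (Y i)" by (rule distr_cong) simp_all
    then show "distr M borel (Y i) = density lborel ?\<phi>" using distributed_distr_eq_density[OF d] by simp
  qed
  have one: "1 \<in> {1..n}" using n0 by simp
  have prob\<phi>: "prob_space (density lborel ?\<phi>)"
    unfolding Yd[OF one, symmetric] by (rule prob_space_distr[OF Ym[OF one]])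
  have int\<phi>: "(\<integral>\<^sup>+z. ?\<phi> z \<partial>lborel) = 1"
    using prob_space.emeasure_space_1[OF prob\<phi>] by (simp add: emeasure_density)
  let ?Y = "\<lambda>\<omega>. \<lambda>i\<in>{1..n}. Y i \<omega>"
  have Ymeas: "?Y \<in> measurable M (data_space n)"
    by (rule measurable_restrict) (use Ym in simp)
  have "distr M (PiM {1..n} (\<lambda>_. borel)) ?Y = PiM {1..n} (\<lambda>i. distr M borel (Y i))"
    using indep_vars_iff_distr_eq_PiM'[where I = "{1..n}" and M' = "\<lambda>_. borel" and X = Y] Ym indep one by blast
  also have "\<dots> = PiM {1..n} (\<lambda>_. density lborel ?\<phi>)"
    by (rule PiM_cong) (use Yd in auto)
  also have "\<dots> = density (data_space n) (\<lambda>y. \<Prod>i\<in>{1..n}. ?\<phi> (y i))"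
    by (rule PiM_density_lborel[OF \<phi> prob_space_imp_sigma_finite[OF prob\<phi>]]) simp
  also have "distr M (PiM {1..n} (\<lambda>_. borel)) ?Y = distr M (data_space n) ?Y"
    by (rule distr_cong) (auto intro!: sets_PiM_cong)
  finally have D: "distr M (data_space n) ?Y = density (data_space n) (\<lambda>y. \<Prod>i\<in>{1..n}. ?\<phi> (y i))" .
  have Sm: "(\<lambda>\<omega>. sample_cov n (?Y \<omega>)) \<in> borel_measurable M"
    by (rule measurable_compose[OF Ymeas measurable_sample_cov])
  then show "(\<lambda>\<omega>. sample_cov n (\<lambda>i. Y i \<omega>)) \<in> borel_measurable M"
    unfolding sample_cov_restrict .
  \<comment> \<open>The factor of the joint density that depends on the sample mean. Since
    \<open>n \<ge> 1\<close> it is at most a multiple of the normal density, which makes its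
    integral finite.\<close>
  define w where "w z = ennreal (exp (- real n / 2 * ?Q z))" for z
  have w [measurable]: "w \<in> borel_measurable borel" unfolding w_def by measurable
  have w_le: "w z \<le> ennreal (1 / k) * ?\<phi> z" for z
  proof -
    have "1 * ?Q z \<le> real n * ?Q z" using n0 posdef_quadratic_nonneg[OF \<Lambda>] by (intro mult_right_mono) auto
    then have "exp (- real n / 2 * ?Q z) \<le> 1 / k * mvnormal_density \<mu> (matrix_inv \<Lambda>) z"
      using k by (simp add: \<phi>_eq)
    then show ?thesis using k by (simp add: w_def ennreal_mult[symmetric] \<phi>_eq ennreal_leI)
  qed
  have "(\<integral>\<^sup>+z. w z \<partial>lborel) \<le> (\<integral>\<^sup>+z. ennreal (1 / k) * ?\<phi> z \<partial>lborel)" by (rule nn_integral_mono) (rule w_le)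
  also have "\<dots> = ennreal (1 / k)" by (simp add: nn_integral_cmult int\<phi>)
  finally have w_fin: "(\<integral>\<^sup>+z. w z \<partial>lborel) \<noteq> \<infinity>" by (auto simp: top_unique)
  have w_nz: "(\<integral>\<^sup>+z. w z \<partial>lborel) \<noteq> 0"
  proof
    assume "(\<integral>\<^sup>+z. w z \<partial>lborel) = 0"
    then have "AE z in lborel. w z = 0" by (subst (asm) nn_integral_0_iff_AE) auto
    then have "AE z in lborel. ?\<phi> z = 0" by eventually_elim (simp add: w_def)
    then have "(\<integral>\<^sup>+z. ?\<phi> z \<partial>lborel) = 0" by (subst nn_integral_0_iff_AE) auto
    then show False using int\<phi> by simp
  qed
  obtain C where C: "\<And>F. F \<in> borel_measurable borel \<Longrightarrow>
    (\<integral>\<^sup>+y. F (sample_cov n y) * w (sample_mean n y) \<partial>data_space n) =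
    C * (\<integral>\<^sup>+x. F x * cone_density ((real n - real CARD('p) - 2) / 2) x \<partial>lborel)"
    using sample_cov_wishart[OF n w _ w_nz w_fin] by (auto simp: w_def)
  let ?q = "\<lambda>x :: real^'p uprod. ennreal (exp (- real n / 2 * trace (\<Lambda> ** smat x)))"
  have q [measurable]: "?q \<in> borel_measurable borel"
  proof -
    have "(\<lambda>x :: real^'p uprod. trace (\<Lambda> ** smat x)) \<in> borel_measurable borel"
      by (intro borel_measurable_continuous_onI linear_continuous_on linear_conv_bounded_linear[THEN iffD1] linear_trace_smat)
    then show ?thesis by measurable
  qed
  have prod: "(\<Prod>i\<in>{1..n}. ?\<phi> (y i)) = ennreal (k ^ n) * (?q (sample_cov n y) * w (sample_mean n y))" for y
  proof -
    have "(\<Prod>i\<in>{1..n}. mvnormal_density \<mu> (matrix_inv \<Lambda>) (y i)) = k ^ n * exp (\<Sum>i\<in>{1..n}. - ?Q (y i) / 2)"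
      unfolding \<phi>_eq by (simp add: prod.distrib exp_sum)
    also have "(\<Sum>i\<in>{1..n}. - ?Q (y i) / 2) = - (\<Sum>i\<in>{1..n}. ?Q (y i)) / 2"
      by (simp add: sum_negf sum_divide_distrib)
    also have "\<dots> = - real n / 2 * trace (\<Lambda> ** smat (sample_cov n y)) + - real n / 2 * ?Q (sample_mean n y)"
      unfolding sum_quadratic_eq[OF n0 \<Lambda>] by (simp add: field_simps)
    finally show ?thesis
      using k by (simp only: exp_add w_def) (simp add: prod_ennreal \<phi>_eq ennreal_mult[symmetric])
  qed
  show "\<exists>C. \<forall>F\<in>borel_measurable borel. (\<integral>\<^sup>+\<omega>. F (sample_cov n (\<lambda>i. Y i \<omega>)) \<partial>M) =
      C * (\<integral>\<^sup>+x. F x * (?q x * cone_density ((real n - real CARD('p) - 2) / 2) x) \<partial>lborel)"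
  proof (intro exI[of _ "ennreal (k ^ n) * C"] ballI)
    fix F :: "real^'p uprod \<Rightarrow> ennreal" assume F [measurable]: "F \<in> borel_measurable borel"
    have FS: "(\<lambda>y. F (sample_cov n y)) \<in> borel_measurable (data_space n)"
      by (rule measurable_compose[OF measurable_sample_cov F])
    have "(\<integral>\<^sup>+\<omega>. F (sample_cov n (\<lambda>i. Y i \<omega>)) \<partial>M) = (\<integral>\<^sup>+\<omega>. F (sample_cov n (?Y \<omega>)) \<partial>M)"
      unfolding sample_cov_restrict ..
    also have "\<dots> = (\<integral>\<^sup>+y. F (sample_cov n y) \<partial>distr M (data_space n) ?Y)"
      by (rule nn_integral_distr[symmetric, OF Ymeas]) (simp only: measurable_distr_eq1 FS)
    also have "\<dots> = (\<integral>\<^sup>+y. (\<Prod>i\<in>{1..n}. ?\<phi> (y i)) * F (sample_cov n y) \<partial>data_space n)"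
      unfolding D
      by (rule nn_integral_density[OF _ FS])
        (intro borel_measurable_prod_ennreal measurable_compose[OF measurable_component_singleton], auto)
    also have "\<dots> = (\<integral>\<^sup>+y. ennreal (k ^ n) * ((F (sample_cov n y) * ?q (sample_cov n y)) * w (sample_mean n y)) \<partial>data_space n)"
      unfolding prod by (simp only: ac_simps)
    also have "\<dots> = ennreal (k ^ n) * (\<integral>\<^sup>+y. (F (sample_cov n y) * ?q (sample_cov n y)) * w (sample_mean n y) \<partial>data_space n)"
      by (rule nn_integral_cmult) measurable
    also have "\<dots> = ennreal (k ^ n) * C * (\<integral>\<^sup>+x. F x * (?q x * cone_density ((real n - real CARD('p) - 2) / 2) x) \<partial>lborel)"
    proof -
      have Fq: "(\<lambda>x. F x * ?q x) \<in> borel_measurable borel" by measurable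
      show ?thesis using C[OF Fq] by (simp only: mult.assoc)
    qed
    finally show "(\<integral>\<^sup>+\<omega>. F (sample_cov n (\<lambda>i. Y i \<omega>)) \<partial>M) =
      ennreal (k ^ n) * C * (\<integral>\<^sup>+x. F x * (?q x * cone_density ((real n - real CARD('p) - 2) / 2) x) \<partial>lborel)" .
  qed
qed

text \<open>The values at 0 and 1 follow from monotonicity by approaching the end points from inside
  the interval. Passing between the closed and the open unit interval changes the density only at
  two points.\<close>

lemma distributed_uniform_open_interval:
  assumes M: "prob_space M" and X: "X \<in> borel_measurable M"
    and cdf: "\<And>u. 0 < u \<Longrightarrow> u < 1 \<Longrightarrow> measure M {\<omega> \<in> space M. X \<omega> \<le> u} = u"
  shows "distributed M lborel X (indicator {0<..<1::real})"
proof -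
  interpret prob_space M by fact
  let ?P = "\<lambda>u. {\<omega> \<in> space M. X \<omega> \<le> u}"
  have sets: "?P u \<in> events" for u using X by measurable
  have mono: "prob (?P u) \<le> prob (?P v)" if "u \<le> v" for u v
    using that sets by (intro finite_measure_mono) auto
  have 0: "prob (?P 0) = 0"
  proof (rule antisym)
    show "prob (?P 0) \<le> 0"
    proof (rule field_le_epsilon)
      fix e :: real assume "e > 0"
      then have "prob (?P 0) \<le> prob (?P (min e (1/2)))" by (intro mono) auto
      also have "\<dots> \<le> 0 + e" using \<open>e > 0\<close> by (subst cdf) auto
      finally show "prob (?P 0) \<le> 0 + e" .
    qed
  qed simp
  have 1: "prob (?P 1) = 1"
  proof (rule antisym)
    show "1 \<le> prob (?P 1)"
    proof (rule field_le_epsilon)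
      fix e :: real assume "e > 0"
      then have "1 \<le> max (1 - e) (1/2) + e" by auto
      also have "max (1 - e) (1/2) = prob (?P (max (1 - e) (1/2)))" using \<open>e > 0\<close> by (subst cdf) auto
      also have "\<dots> \<le> prob (?P 1)" using \<open>e > 0\<close> by (intro mono) auto
      finally show "1 \<le> prob (?P 1) + e" by simp
    qed
  qed simp
  have "\<forall>t\<in>{0..1}. prob (?P t) = (t - 0) / (1 - 0)"
  proof
    fix t :: real assume t: "t \<in> {0..1}"
    consider "t = 0" | "t = 1" | "0 < t" "t < 1" using t by fastforce
    then show "prob (?P t) = (t - 0) / (1 - 0)" by cases (simp_all add: 0 1 cdf)
  qed
  then have "distributed M lborel X (\<lambda>x. indicator {0..1} x / measure lborel {0..1::real})"
    using X by (subst uniform_distributed_iff) auto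
  then have "distr M lborel X = density lborel (\<lambda>x. ennreal (indicator {0..1} x / measure lborel {0..1::real}))"
    by (rule distributed_distr_eq_density)
  also have "\<dots> = density lborel (indicator {0<..<1})"
  proof (rule density_cong)
    show "AE x in lborel. ennreal (indicator {0..1} x / measure lborel {0..1::real}) = indicator {0<..<1} (x :: real)"
      using AE_lborel_singleton[of "0 :: real"] AE_lborel_singleton[of "1 :: real"]
      by eventually_elim (auto simp: indicator_def)
  qed auto
  finally show ?thesis using X by (simp add: distributed_def)
qed

theorem theorem3:
  fixes M :: "'a measure"
    and Y :: "nat \<Rightarrow> 'a \<Rightarrow> real^'p"
    and \<mu> :: "real^'p"
    and \<Lambda> :: "real^'p^'p"
    and E :: "('p::finite) uprod set"
    and n :: nat
    and c :: real
  assumes "n \<ge> 3" and "n \<ge> CARD('p) + 2"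
    and "E \<noteq> {}" and "\<forall>e\<in>E. proper_uprod e"
    and "posdef \<Lambda>" and "has_zeros E \<Lambda>"
    and "prob_space M"
    and "prob_space.indep_vars M (\<lambda>_. borel) Y {1..n}"
    and "\<forall>i\<in>{1..n}. distributed M lborel (Y i) (\<lambda>x. ennreal (mvnormal_density \<mu> (matrix_inv \<Lambda>) x))"
    and "c > 0"
  shows "distributed M lborel (\<lambda>\<omega>. zeros_pvalue c n E (\<lambda>i. Y i \<omega>)) (indicator {0<..<1})"
proof -
  interpret prob_space M by fact
  let ?a = "(real n - real CARD('p) - 2) / 2"
  let ?S = "\<lambda>\<omega>. sample_cov n (\<lambda>i. Y i \<omega>)"
  let ?q = "\<lambda>x :: real^'p uprod. ennreal (exp (- real n / 2 * trace (\<Lambda> ** smat x)))"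
  \<comment> \<open>Outside the cone the estimates do not exist and the p-value is 0 by convention;
    \<open>cone_density\<close> gives this region no mass.\<close>
  define pv where "pv x = (if x \<in> pd_cone then radial_pvalue E ?a x else 0)" for x
  have n0: "n > 0" using \<open>n \<ge> 3\<close> by simp
  have n1: "n \<ge> CARD('p) + 1" using \<open>n \<ge> CARD('p) + 2\<close> by simp
  have pv_eq: "zeros_pvalue c n E (\<lambda>i. Y i \<omega>) = pv (?S \<omega>)" for \<omega>
    unfolding pv_def by (rule zeros_pvalue_eq_radial_pvalue[OF n0 \<open>\<forall>e\<in>E. proper_uprod e\<close> \<open>c > 0\<close>])
  have pv [measurable]: "pv \<in> borel_measurable borel" unfolding pv_def by measurable
  note dist = normal_sample_cov_distribution[OF n1 \<open>posdef \<Lambda>\<close> \<open>prob_space M\<close> assms(8,9)]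
  have S [measurable]: "?S \<in> borel_measurable M" by (rule dist(1))
  obtain C where C: "\<And>F. F \<in> borel_measurable borel \<Longrightarrow> (\<integral>\<^sup>+\<omega>. F (?S \<omega>) \<partial>M) =
      C * (\<integral>\<^sup>+x. F x * (?q x * cone_density ?a x) \<partial>lborel)"
    using dist(2) by blast
  have q: "?q \<in> borel_measurable borel"
  proof -
    have "(\<lambda>x :: real^'p uprod. trace (\<Lambda> ** smat x)) \<in> borel_measurable borel"
      by (intro borel_measurable_continuous_onI linear_continuous_on linear_conv_bounded_linear[THEN iffD1] linear_trace_smat)
    then show ?thesis by measurable
  qed
  let ?J = "\<integral>\<^sup>+x. ?q x * cone_density ?a x \<partial>lborel"
  \<comment> \<open>The test function 1 shows that \<open>C\<close> normalizes the density. In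
    particular the integral is finite, as \<open>radial_pvalue_uniform\<close> requires.\<close>
  have CJ: "C * ?J = 1" using C[of "\<lambda>_. 1"] by (simp add: emeasure_space_1)
  have fin: "?J \<noteq> \<infinity>"
  proof
    assume "?J = \<infinity>"
    then show False using CJ by (cases "C = 0") (simp_all add: ennreal_mult_top)
  qed
  have q_slide: "?q (slide E t x) = ?q x" for t x
  proof -
    have \<Lambda>s: "\<Lambda> = smat (svec \<Lambda>)" using \<open>posdef \<Lambda>\<close> by (simp add: smat_svec posdef_symmetric)
    have zero: "svec \<Lambda> $ e = 0" if "e \<in> E" for e
      using that \<open>has_zeros E \<Lambda>\<close> \<open>posdef \<Lambda>\<close>
      by (cases e) (simp add: svec_nth posdef_symmetric has_zeros_def)
    have "trace (smat (svec \<Lambda>) ** smat (slide E t x)) = trace (smat (svec \<Lambda>) ** smat x)"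
      unfolding trace_smat_mult
    proof (intro sum.cong refl)
      fix e
      show "upair_weight e * (svec \<Lambda> $ e * slide E t x $ e) = upair_weight e * (svec \<Lambda> $ e * x $ e)"
        by (cases "e \<in> E") (simp_all add: zero slide_nth_off)
    qed
    then show ?thesis by (simp only: \<Lambda>s[symmetric])
  qed
  \<comment> \<open>The lower bound on \<open>n\<close> enters here; it gives the finiteness of the
    tails.\<close>
  have a: "?a \<ge> 0" using \<open>n \<ge> CARD('p) + 2\<close> by simp
  note uniform = radial_pvalue_uniform[OF \<open>\<forall>e\<in>E. proper_uprod e\<close> \<open>E \<noteq> {}\<close> a q q_slide fin]
  show ?thesis
    unfolding pv_eq
  proof (rule distributed_uniform_open_interval[OF \<open>prob_space M\<close>])
    show "(\<lambda>\<omega>. pv (?S \<omega>)) \<in> borel_measurable M" by (rule measurable_compose[OF S pv])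
    fix u :: real assume u: "0 < u" "u < 1"
    have "emeasure M {\<omega> \<in> space M. pv (?S \<omega>) \<le> u} = (\<integral>\<^sup>+\<omega>. indicator {\<omega> \<in> space M. pv (?S \<omega>) \<le> u} \<omega> \<partial>M)"
      by (rule nn_integral_indicator[symmetric]) measurable
    also have "\<dots> = (\<integral>\<^sup>+\<omega>. indicator {..u} (pv (?S \<omega>)) \<partial>M)"
      by (rule nn_integral_cong) (simp add: indicator_def)
    also have "\<dots> = C * (\<integral>\<^sup>+x. indicator {..u} (pv x) * (?q x * cone_density ?a x) \<partial>lborel)"
      by (rule C) measurable
    also have "(\<integral>\<^sup>+x. indicator {..u} (pv x) * (?q x * cone_density ?a x) \<partial>lborel) =
      (\<integral>\<^sup>+x. ?q x * cone_density ?a x * indicator {..u} (radial_pvalue E ?a x) \<partial>lborel)"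
    proof (rule nn_integral_cong)
      fix x :: "real^'p uprod"
      show "indicator {..u} (pv x) * (?q x * cone_density ?a x) = ?q x * cone_density ?a x * indicator {..u} (radial_pvalue E ?a x)"
        by (cases "x \<in> pd_cone") (simp_all add: pv_def cone_density_def mult.commute)
    qed
    also have "C * \<dots> = ennreal u * (C * ?J)" unfolding uniform[OF u] by (rule mult.left_commute)
    finally have "emeasure M {\<omega> \<in> space M. pv (?S \<omega>) \<le> u} = ennreal u" by (simp only: CJ mult_1_right)
    then show "measure M {\<omega> \<in> space M. pv (?S \<omega>) \<le> u} = u" using u by (simp add: measure_def)
  qed
qed

end
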